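(* Let $p$ be a prime and let $\mathcal{F}$ be a saturated fusion system on a finite $p$-group $S$. Suppose that there is a subgroup $D$ of $S$ with $1<D<S$ such that every subgroup of $S$ of order $|D|$ is abelian and semi-invariant in $\mathcal{F}$, and every subgroup of $S$ of order $p|D|$ is abelian. If $S$ is non-abelian, $p=2$ and $|D|=2$, assume moreover that every cyclic subgroup of $S$ of order $4$ is semi-invariant in $\mathcal{F}$. Then $\mathcal{F}$ is supersolvable.
   Context: Let $\mathcal{F}$ be a fusion system on a finite $p$-group $S$. Semi-invariant: a subgroup $H\le S$ is semi-invariant in $\mathcal{F}$ if for every subgroup $K$ with $H\le K\le S$ and every $\alpha\in\mathrm{Aut}_{\mathcal{F}}(K)$ one has $H^{\alpha}=H$. Supersolvable: a saturated fusion system $\mathcal{F}$ on $S$ is supersolvable if there is a series of subgroups $1=S_0\le S_1\le\cdots\le S_n=S$ such that each $S_i$ ($0\le i\le n$) is strongly $\mathcal{F}$-closed and $S_{i+1}/S_i$ is cyclic for $0\le i\le n-1$. (A subgroup $T\le S$ is strongly $\mathcal{F}$-closed if for every $P\le T$ and every morphism $\phi\in\mathrm{Hom}_{\mathcal{F}}(P,S)$ one has $P^{\phi}\le T$.) *)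

theory Defs
  imports "HOL-Algebra.Algebra"
begin

definition conj_map :: "('a, 'b) monoid_scheme \<Rightarrow> 'a set \<Rightarrow> 'a \<Rightarrow> 'a \<Rightarrow> 'a" where
  "conj_map S P g = (\<lambda>x\<in>P. g \<otimes>\<^bsub>S\<^esub> x \<otimes>\<^bsub>S\<^esub> inv\<^bsub>S\<^esub> g)"

text \<open>
  \<open>Hom\<^sub>S(P, Q)\<close> and \<open>Aut\<^sub>S(P)\<close>. Replacing \<open>g\<close> by its inverse shows that these sets
  do not depend on the choice between left and right conjugation.
\<close>

definition hom_by_conj ::
    "('a, 'b) monoid_scheme \<Rightarrow> 'a set \<Rightarrow> 'a set \<Rightarrow> ('a \<Rightarrow> 'a) set" where
  "hom_by_conj S P Q = {conj_map S P g | g. g \<in> carrier S \<and> conj_map S P g ` P \<subseteq> Q}"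

definition aut_by_conj :: "('a, 'b) monoid_scheme \<Rightarrow> 'a set \<Rightarrow> ('a \<Rightarrow> 'a) set" where
  "aut_by_conj S P = conj_map S P ` normalizer S P"

text \<open>
  A fusion system is given by its morphism sets: \<open>F P Q\<close> is \<open>Hom\<^sub>F(P, Q)\<close>, a set of functions
  that are undefined outside \<open>P\<close>, so that morphisms are equal iff they agree on \<open>P\<close>. The
  values of \<open>F\<close> at sets that are not subgroups of \<open>S\<close> carry no meaning.
\<close>

type_synonym 'a fusion_homs = "'a set \<Rightarrow> 'a set \<Rightarrow> ('a \<Rightarrow> 'a) set"

definition fusion_iso :: "'a fusion_homs \<Rightarrow> 'a set \<Rightarrow> 'a set \<Rightarrow> ('a \<Rightarrow> 'a) set" where
  "fusion_iso F P Q = {\<phi> \<in> F P Q. \<exists>\<psi> \<in> F Q P.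
     compose P \<psi> \<phi> = (\<lambda>x\<in>P. x) \<and> compose Q \<phi> \<psi> = (\<lambda>y\<in>Q. y)}"

text \<open>
  The last axiom says that every morphism is an isomorphism of the category followed by an
  inclusion. Composing with an inclusion does not change the underlying function, so the
  isomorphism can only be \<open>\<phi>\<close> itself, regarded as a map onto its image. Identities and
  inclusions are morphisms by \<open>conj_mem\<close>, taking the conjugating element to be one.
\<close>

locale fusion_system = group S for S (structure) +
  fixes p :: nat and F :: "'a fusion_homs"
  assumes prime_p: "Factorial_Ring.prime p"
    and finite_carrier: "finite (carrier S)"
    and p_group: "\<exists>n. order S = p ^ n"
    and conj_mem: "\<lbrakk>subgroup P S; subgroup Q S\<rbrakk> \<Longrightarrow> hom_by_conj S P Q \<subseteq> F P Q"
    and mem_mon: "\<lbrakk>subgroup P S; subgroup Q S\<rbrakk> \<Longrightarrow>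
        F P Q \<subseteq> mon (S\<lparr>carrier := P\<rparr>) (S\<lparr>carrier := Q\<rparr>) \<inter> extensional P"
    and comp_mem: "\<lbrakk>subgroup P S; subgroup Q S; subgroup R S; \<phi> \<in> F P Q; \<psi> \<in> F Q R\<rbrakk> \<Longrightarrow>
        compose P \<psi> \<phi> \<in> F P R"
    and iso_onto_image: "\<lbrakk>subgroup P S; subgroup Q S; \<phi> \<in> F P Q\<rbrakk> \<Longrightarrow>
        \<phi> \<in> fusion_iso F P (\<phi> ` P)"

definition fusion_aut_group ::
    "('a, 'b) monoid_scheme \<Rightarrow> 'a fusion_homs \<Rightarrow> 'a set \<Rightarrow> ('a \<Rightarrow> 'a) monoid" where
  "fusion_aut_group S F P = (AutoGroup (S\<lparr>carrier := P\<rparr>))\<lparr>carrier := F P P\<rparr>"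

definition sylow_subgroup :: "nat \<Rightarrow> ('a, 'b) monoid_scheme \<Rightarrow> 'a set \<Rightarrow> bool" where
  "sylow_subgroup p G H \<longleftrightarrow> subgroup H G \<and> card H = p ^ multiplicity p (order G)"

definition fully_automized ::
    "('a, 'b) monoid_scheme \<Rightarrow> nat \<Rightarrow> 'a fusion_homs \<Rightarrow> 'a set \<Rightarrow> bool" where
  "fully_automized S p F P \<longleftrightarrow> sylow_subgroup p (fusion_aut_group S F P) (aut_by_conj S P)"

text \<open>
  The group \<open>N\<^sub>\<phi>\<close> of those \<open>g\<close> in the normalizer of \<open>Q\<close> for which
  \<open>\<phi> c\<^sub>g \<phi>\<^sup>-\<^sup>1\<close> lies in \<open>Aut\<^sub>S(P)\<close>, for an isomorphism \<open>\<phi>\<close> from \<open>Q\<close> to \<open>P\<close>.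
\<close>

definition extension_domain ::
    "('a, 'b) monoid_scheme \<Rightarrow> 'a set \<Rightarrow> 'a set \<Rightarrow> ('a \<Rightarrow> 'a) \<Rightarrow> 'a set" where
  "extension_domain S Q P \<phi> = {g \<in> normalizer S Q.
     (\<lambda>y\<in>P. \<phi> (conj_map S Q g (inv_into Q \<phi> y))) \<in> aut_by_conj S P}"

definition receptive :: "('a, 'b) monoid_scheme \<Rightarrow> 'a fusion_homs \<Rightarrow> 'a set \<Rightarrow> bool" where
  "receptive S F P \<longleftrightarrow> (\<forall>Q \<phi>. subgroup Q S \<and> \<phi> \<in> fusion_iso F Q P \<longrightarrow>
     (\<exists>\<psi> \<in> F (extension_domain S Q P \<phi>) (carrier S). \<forall>x\<in>Q. \<psi> x = \<phi> x))"

text \<open>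
  Saturation in the form of Roberts and Shpectorov, as in Aschbacher, Kessar and Oliver,
  Fusion Systems in Algebra and Topology, Part I.
\<close>

locale saturated_fusion_system = fusion_system +
  assumes saturated: "subgroup P S \<Longrightarrow>
    \<exists>Q. subgroup Q S \<and> fusion_iso F P Q \<noteq> {} \<and> fully_automized S p F Q \<and> receptive S F Q"

definition semi_invariant :: "('a, 'b) monoid_scheme \<Rightarrow> 'a fusion_homs \<Rightarrow> 'a set \<Rightarrow> bool" where
  "semi_invariant S F H \<longleftrightarrow> subgroup H S \<and>
     (\<forall>K. subgroup K S \<and> H \<subseteq> K \<longrightarrow> (\<forall>\<alpha> \<in> F K K. \<alpha> ` H = H))"

definition strongly_closed :: "('a, 'b) monoid_scheme \<Rightarrow> 'a fusion_homs \<Rightarrow> 'a set \<Rightarrow> bool" where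
  "strongly_closed S F T \<longleftrightarrow> subgroup T S \<and>
     (\<forall>P. subgroup P S \<and> P \<subseteq> T \<longrightarrow> (\<forall>\<phi> \<in> F P (carrier S). \<phi> ` P \<subseteq> T))"

text \<open>
  Each \<open>T i\<close> is normal in \<open>S\<close>, because it is strongly closed and conjugations are morphisms.
\<close>

definition supersolvable ::
    "('a, 'b) monoid_scheme \<Rightarrow> nat \<Rightarrow> 'a fusion_homs \<Rightarrow> bool" where
  "supersolvable S p F \<longleftrightarrow> saturated_fusion_system S p F \<and>
     (\<exists>(n::nat) T. T 0 = {\<one>\<^bsub>S\<^esub>} \<and> T n = carrier S \<and>
        (\<forall>i\<le>n. strongly_closed S F (T i)) \<and>
        (\<forall>i<n. T i \<subseteq> T (Suc i) \<and> cyclic_group ((S\<lparr>carrier := T (Suc i)\<rparr>) Mod (T i))))"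

end

theory Submission
  imports Defs "HOL-Number_Theory.Residues"
begin

text \<open>
  Let \<open>K\<close> be a subgroup of \<open>S\<close> of order at least \<open>p|D|\<close>, let \<open>A = Aut\<^sub>F(K)\<close>, and let \<open>B\<close> be the
  subgroup of those automorphisms that act trivially on every \<open>A\<close>-invariant section of order \<open>p\<close>
  of \<open>K\<close>. The key point is that \<open>B\<close> has no nontrivial element \<open>r\<close> of order prime to \<open>p\<close>. Otherwise
  take a smallest \<open>A\<close>-invariant subgroup \<open>M\<close> moved by such elements; as in Thompson's analysis of
  minimal coprime actions, \<open>M\<close> is generated by the elements \<open>r(x)x\<^sup>-\<^sup>1\<close>, its proper \<open>A\<close>-invariant
  subgroups are central, and so it has exponent \<open>p\<close> (or \<open>4\<close>, if it is a nonabelian \<open>2\<close>-group). If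
  \<open>|M| \<ge> p|D|\<close>, then every element of \<open>M\<close> lies in a proper subgroup that is semi-invariant, which
  is absurd. If \<open>|M| \<le> |D|\<close>, then \<open>M\<close> lies in an abelian group \<open>T\<close> of order \<open>p|D|\<close> all of whose
  maximal subgroups are invariant, and \<open>r\<close> is trivial on \<open>T\<close> because it is trivial on \<open>T/N\<close> for a
  maximal subgroup \<open>N\<close> containing the fixed points of \<open>r\<close>.

  Hence \<open>B\<close> is the set of all \<open>p\<close>-elements of \<open>A\<close>, and \<open>A/B\<close> is abelian of exponent dividing
  \<open>p - 1\<close>. The first fact shows, by downward induction on the order of \<open>P\<close>, that every isomorphism
  from \<open>P\<close> onto a fully automized receptive subgroup extends to a larger group, so all morphisms
  are restrictions of elements of \<open>Aut\<^sub>F(S)\<close>. The second one, for \<open>K = S\<close>, yields eigenvectors and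
  thus an \<open>Aut\<^sub>F(S)\<close>-invariant series of \<open>S\<close> with factors of order \<open>p\<close>.
\<close>

section \<open>Finite p-groups\<close>

lemma prime_pow_cong:
  fixes k p :: nat
  assumes "Factorial_Ring.prime p"
  shows "[k ^ p = k] (mod p)"
proof (cases "p dvd k")
  case True
  then have "p dvd k ^ p" using assms prime_gt_0_nat by (intro dvd_trans[OF True] dvd_power) auto
  then show ?thesis using True by (simp add: cong_def mod_eq_0_iff_dvd)
next
  case False
  then have "[k ^ (p - 1) * k = 1 * k] (mod p)" using fermat_theorem[OF assms] cong_scalar_right by blast
  then show ?thesis using assms prime_gt_0_nat by (metis One_nat_def Suc_diff_1 mult_1 power_Suc2)
qed

context group
begin

lemma mult_inv_cancel:
  assumes "x \<in> carrier G" "y \<in> carrier G"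
  shows "x \<otimes> (inv x \<otimes> y) = y" "inv x \<otimes> (x \<otimes> y) = y"
  using assms by (simp_all add: m_assoc[symmetric])

lemmas word_simps = m_assoc inv_mult_group mult_inv_cancel

text \<open>Left translation by \<open>a\<close> is an injective self-map of the finite set
  \<open>H\<close>, hence surjective. The element it sends to \<open>a\<close> is the unit, and the
  element it sends to the unit is the inverse of \<open>a\<close>.\<close>

lemma finite_subgroupI:
  assumes "finite H" "H \<subseteq> carrier G" "H \<noteq> {}"
    and closed: "\<And>x y. \<lbrakk>x \<in> H; y \<in> H\<rbrakk> \<Longrightarrow> x \<otimes> y \<in> H"
  shows "subgroup H G"
proof (rule subgroupI)
  fix a assume a: "a \<in> H"
  then have aG: "a \<in> carrier G" using assms(2) by auto
  have img: "(\<lambda>x. a \<otimes> x) ` H = H"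
  proof (rule card_subset_eq[OF assms(1)])
    show "(\<lambda>x. a \<otimes> x) ` H \<subseteq> H" using closed a by auto
    have "inj_on (\<lambda>x. a \<otimes> x) H"
      using aG assms(2) by (intro inj_onI) (metis l_cancel subsetD)
    then show "card ((\<lambda>x. a \<otimes> x) ` H) = card H" by (rule card_image)
  qed
  then obtain e where e: "e \<in> H" "a \<otimes> e = a" using a by (metis imageE)
  then have "e = \<one>" using aG assms(2) l_cancel[of a e \<one>] by auto
  with e img obtain b where b: "b \<in> H" "a \<otimes> b = \<one>" by (metis imageE)
  then have "inv a = b" using aG assms(2) by (intro inv_equality) (auto intro: inv_comm)
  then show "inv a \<in> H" using b by simp
qed (use assms in auto)

lemma subgroup_nat_pow_closed:
  assumes "subgroup H G" "x \<in> H"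
  shows "x [^] (n::nat) \<in> H"
  using assms by (induction n) (auto simp: subgroup.one_closed subgroup.m_closed)

text \<open>The usual formula in class 2, with commutator \<open>c\<close>: moving one more
  \<open>x\<close> to the left past the n-th power of \<open>y\<close> costs the n-th power of
  \<open>c\<close>, and 0 + 1 + ... + (n - 1) = n(n - 1)/2.\<close>

lemma pow_mult_class2:
  fixes n :: nat
  assumes x: "x \<in> carrier G" and y: "y \<in> carrier G" and c: "c \<in> carrier G"
    and yx: "y \<otimes> x = x \<otimes> y \<otimes> c" and cx: "c \<otimes> x = x \<otimes> c" and cy: "c \<otimes> y = y \<otimes> c"
  shows "(x \<otimes> y) [^] n = x [^] n \<otimes> y [^] n \<otimes> c [^] (n * (n - 1) div 2)"
proof -
  have cnx: "c [^] k \<otimes> x = x \<otimes> c [^] k" and cny: "c [^] k \<otimes> y = y \<otimes> c [^] k" for k :: nat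
    using group_commutes_pow[OF cx c x] group_commutes_pow[OF cy c y] by blast+
  have ynx: "y [^] k \<otimes> x = x \<otimes> y [^] k \<otimes> c [^] k" for k :: nat
  proof (induction k)
    case 0 then show ?case using x by simp
  next
    case (Suc k)
    have "y [^] Suc k \<otimes> x = y [^] k \<otimes> (x \<otimes> y \<otimes> c)" using x y c yx by (simp add: m_assoc)
    also have "\<dots> = (y [^] k \<otimes> x) \<otimes> y \<otimes> c" using x y c by (simp add: m_assoc)
    also have "\<dots> = x \<otimes> y [^] k \<otimes> (c [^] k \<otimes> y) \<otimes> c" using x y c Suc by (simp add: m_assoc)
    also have "\<dots> = x \<otimes> y [^] Suc k \<otimes> c [^] Suc k" using x y c cny[of k] by (simp add: m_assoc)
    finally show ?case .
  qed
  show ?thesis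
  proof (induction n)
    case 0 then show ?case by simp
  next
    case (Suc n)
    let ?t = "n * (n - 1) div 2"
    have t: "Suc n * (Suc n - 1) div 2 = n + ?t"
    proof -
      have "Suc n * n = 2 * n + n * (n - 1)" by (cases n) auto
      then show ?thesis by simp
    qed
    have "(x \<otimes> y) [^] Suc n = x [^] n \<otimes> y [^] n \<otimes> (c [^] ?t \<otimes> x) \<otimes> y"
      using x y c Suc by (simp add: m_assoc)
    also have "\<dots> = x [^] n \<otimes> (y [^] n \<otimes> x) \<otimes> (c [^] ?t \<otimes> y)"
      using x y c cnx[of ?t] by (simp add: m_assoc)
    also have "\<dots> = x [^] n \<otimes> x \<otimes> y [^] n \<otimes> (c [^] n \<otimes> y) \<otimes> c [^] ?t"
      using x y c ynx[of n] cny[of ?t] by (simp add: m_assoc)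
    also have "\<dots> = x [^] Suc n \<otimes> y [^] Suc n \<otimes> (c [^] n \<otimes> c [^] ?t)"
      using x y c cny[of n] by (simp add: m_assoc)
    also have "c [^] n \<otimes> c [^] ?t = c [^] (n + ?t)" using c by (simp add: nat_pow_mult)
    finally show ?case unfolding t .
  qed
qed

end

section \<open>Subgroups of finite p-groups: orders, centers, normalizers\<close>

locale finite_p_group = group G for G (structure) +
  fixes p :: nat
  assumes prime_p: "Factorial_Ring.prime p"
    and finite_carrier: "finite (carrier G)"
    and prime_power_order: "\<exists>n. order G = p ^ n"
begin

lemma p_gt_1: "1 < p" using prime_p prime_gt_1_nat by blast

lemma finite_subgroup: "subgroup H G \<Longrightarrow> finite H"
  using finite_carrier finite_subset subgroup.subset by blast

lemma card_subgroup_dvd: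
  assumes "subgroup U G" "subgroup Y G" "U \<subseteq> Y"
  shows "card U dvd card Y"
proof -
  interpret Y: group "G\<lparr>carrier := Y\<rparr>" using assms(2) by (rule subgroup_imp_group)
  have "card (rcosets\<^bsub>G\<lparr>carrier := Y\<rparr>\<^esub> U) * card U = order (G\<lparr>carrier := Y\<rparr>)"
    by (rule Y.lagrange) (rule subgroup_incl[OF assms])
  then have "card (rcosets\<^bsub>G\<lparr>carrier := Y\<rparr>\<^esub> U) * card U = card Y" by (simp add: order_def)
  then show ?thesis by (metis dvd_triv_right)
qed

lemma card_subgroup_prime_power:
  assumes "subgroup U G" obtains n where "card U = p ^ n"
proof -
  obtain m where m: "order G = p ^ m" using prime_power_order by auto
  have "card U dvd p ^ m" using card_subgroup_dvd[OF assms subgroup_self] m subgroup.subset[OF assms]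
    by (simp add: order_def)
  then show thesis using that divides_primepow_nat[OF prime_p] by blast
qed

lemma finite_p_group_subgroup:
  assumes "subgroup U G"
  shows "finite_p_group (G\<lparr>carrier := U\<rparr>) p"
proof -
  interpret U: group "G\<lparr>carrier := U\<rparr>" using assms by (rule subgroup_imp_group)
  show ?thesis
    using prime_p finite_subgroup[OF assms] card_subgroup_prime_power[OF assms]
    by unfold_locales (auto simp: order_def)
qed

lemma finite_p_group_quotient:
  assumes "N \<lhd> G"
  shows "finite_p_group (G Mod N) p"
proof -
  interpret Q: group "G Mod N" using assms by (rule normal.factorgroup_is_group)
  obtain m where m: "order G = p ^ m" using prime_power_order by auto
  have "card (rcosets N) * card N = order G"
    using assms lagrange normal_imp_subgroup by blast
  then have "order (G Mod N) dvd p ^ m" unfolding order_def FactGroup_def using m 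
    by (metis dvd_triv_left order_def partial_object.select_convs(1))
  then have "\<exists>n. order (G Mod N) = p ^ n" using divides_primepow_nat[OF prime_p] by blast
  then show ?thesis
    using prime_p finite_carrier by unfold_locales (auto simp: carrier_FactGroup)
qed

lemma pow_prime_power_eq_one:
  obtains e where "\<And>x. x \<in> carrier G \<Longrightarrow> x [^] (p ^ e) = \<one>"
  using prime_power_order pow_order_eq_1 by metis

text \<open>Some \<open>p ^ e\<close> annihilates the group and \<open>m\<close> is invertible
  modulo \<open>p ^ e\<close>, so \<open>x\<close> is itself a power of
  \<open>x [^] m\<close>.\<close>

lemma pow_coprime_mem:
  assumes "subgroup H G" "x \<in> carrier G" "x [^] (m::nat) \<in> H" "coprime m p"
  shows "x \<in> H"
proof -
  obtain e where e: "\<And>x. x \<in> carrier G \<Longrightarrow> x [^] (p ^ e) = \<one>" by (rule pow_prime_power_eq_one) blast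
  have "coprime m (p ^ e)" using assms(4) by simp
  then obtain k where "[m * k = 1] (mod p ^ e)" using cong_solve_coprime_nat[of m "p ^ e"] by auto
  \<comment> \<open>Over the natural numbers, being congruent to 1 leaves the extra case of modulus
    1, in which the group is trivial.\<close>
  then consider "p ^ e = 1" "m * k = 0" | j where "m * k = 1 + j * p ^ e"
    unfolding cong_to_1'_nat by auto
  then have "x [^] (m * k) = x"
  proof cases
    case 1
    then have "x = \<one>" using e[OF assms(2)] nat_pow_eone[OF assms(2)] by metis
    then show ?thesis by simp
  next
    case 2
    have "x [^] (j * p ^ e) = \<one>"
      using e[OF assms(2)] assms(2) by (metis mult.commute nat_pow_one nat_pow_pow)
    then show ?thesis unfolding 2 using assms(2) by (simp add: nat_pow_mult[symmetric])
  qed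
  then have "(x [^] m) [^] k = x" using assms(2) by (simp add: nat_pow_pow)
  then show ?thesis using subgroup_nat_pow_closed[OF assms(1,3), of k] by simp
qed

text \<open>The sequence of iterated p-th powers starts outside \<open>H\<close> and reaches the
  unit, so some consecutive pair crosses into \<open>H\<close>.\<close>

lemma exists_pow_p_mem:
  assumes "subgroup H G" "x \<in> carrier G" "x \<notin> H"
  obtains i where "x [^] (p ^ i) \<notin> H" "x [^] (p ^ Suc i) \<in> H"
proof -
  obtain e where "\<And>x. x \<in> carrier G \<Longrightarrow> x [^] (p ^ e) = \<one>" by (rule pow_prime_power_eq_one) blast
  then have "x [^] (p ^ e) \<in> H" using assms subgroup.one_closed by simp
  then have "\<exists>i. x [^] (p ^ i) \<notin> H \<and> x [^] (p ^ Suc i) \<in> H"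
    using assms(2,3)
  proof (induction e)
    case 0 then show ?case by simp
  next
    case (Suc e) then show ?case by blast
  qed
  then show thesis using that by blast
qed

text \<open>Class equation: the sizes of the conjugacy classes are powers of \<open>p\<close> that
  add up to a multiple of \<open>p\<close>. The class of the unit contributes 1, so another class
  has size prime to \<open>p\<close>, that is, size 1.\<close>

lemma nontrivial_center:
  assumes "carrier G \<noteq> {\<one>}"
  obtains z where "z \<in> carrier G" "z \<noteq> \<one>" "\<And>g. g \<in> carrier G \<Longrightarrow> z \<otimes> g = g \<otimes> z"
proof -
  let ?\<phi> = "\<lambda>g. (\<lambda>h \<in> carrier G. g \<otimes> h \<otimes> (inv g))"
  interpret act: group_action G "carrier G" ?\<phi> by (rule action_by_conjugation)
  let ?O = "orbits G (carrier G) ?\<phi>"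
  obtain m where m: "order G = p ^ m" using prime_power_order by auto
  have "order G \<noteq> 1"
    using assms by (metis one_closed order_def card_1_singletonE singletonD)
  then have pdvd: "p dvd order G" using m by (cases m) auto
  have "orbit G ?\<phi> \<one> = {\<one>}" unfolding orbit_def by (auto intro!: exI[of _ \<one>])
  then have one: "{\<one>} \<in> ?O" unfolding orbits_def using one_closed by blast
  have finO: "finite ?O"
    using finite_carrier unfolding orbits_def by (simp add: setcompr_eq_image)
  have sum: "(\<Sum>orb\<in>?O. card orb) = order G"
    using act.disjoint_sum[OF finite_carrier, of "\<lambda>_. 1::nat"] by (simp add: order_def)
  have "\<exists>orb\<in>?O - {{\<one>}}. \<not> p dvd card orb"
  proof (rule ccontr)
    assume "\<not> ?thesis"
    then have "p dvd (\<Sum>orb\<in>?O - {{\<one>}}. card orb)" by (auto intro: dvd_sum)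
    moreover have "(\<Sum>orb\<in>?O. card orb) = 1 + (\<Sum>orb\<in>?O - {{\<one>}}. card orb)"
      using sum.remove[OF finO one, of card] by simp
    ultimately have "p dvd 1" using pdvd sum dvd_add_left_iff[of p "\<Sum>orb\<in>?O - {{\<one>}}. card orb" 1] by simp
    then show False using p_gt_1 by simp
  qed
  then obtain z where z: "z \<in> carrier G" "orbit G ?\<phi> z \<noteq> {\<one>}" "\<not> p dvd card (orbit G ?\<phi> z)"
    unfolding orbits_def by auto
  have "card (orbit G ?\<phi> z) dvd p ^ m"
    using dvdI[OF act.orbit_stabilizer_theorem[OF z(1), symmetric]] m by simp
  then obtain i where i: "card (orbit G ?\<phi> z) = p ^ i" using divides_primepow_nat[OF prime_p] by blast
  with z(3) have "card (orbit G ?\<phi> z) = 1" by (cases i) auto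
  then obtain w where w: "orbit G ?\<phi> z = {w}" by (rule card_1_singletonE)
  have zin: "z \<in> orbit G ?\<phi> z" using act.orbit_refl[OF z(1)] .
  then have wz: "w = z" using w by auto
  have "z \<noteq> \<one>" using z(2) w wz by auto
  moreover have "z \<otimes> g = g \<otimes> z" if g: "g \<in> carrier G" for g
  proof -
    have "g \<otimes> z \<otimes> inv g \<in> orbit G ?\<phi> z" unfolding orbit_def using g z(1) by auto
    then have "g \<otimes> z \<otimes> inv g = z" using w wz by auto
    then have "g \<otimes> z \<otimes> inv g \<otimes> g = z \<otimes> g" by simp
    then show ?thesis using g z(1) by (simp add: m_assoc)
  qed
  ultimately show thesis using that z(1) by blast
qed

text \<open>A representative \<open>w\<close> of a nontrivial central element of the quotient is
  replaced by the iterated p-th power that is last outside \<open>N\<close>. Powers of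
  \<open>w\<close> stay central modulo \<open>N\<close>.\<close>

lemma central_mod_normal:
  assumes "N \<lhd> G" "N \<noteq> carrier G"
  obtains z where "z \<in> carrier G" "z \<notin> N" "z [^] p \<in> N"
    "\<And>g. g \<in> carrier G \<Longrightarrow> z \<otimes> g \<otimes> inv z \<otimes> inv g \<in> N"
proof -
  interpret N: normal N G by fact
  interpret Q: finite_p_group "G Mod N" p by (rule finite_p_group_quotient) fact
  obtain y where y: "y \<in> carrier G" "y \<notin> N" using assms N.subset by blast
  have "N #> y \<noteq> N" using y rcos_self N.is_subgroup by metis
  moreover have "N #> y \<in> carrier (G Mod N)" using y by (auto simp: carrier_FactGroup)
  ultimately have "carrier (G Mod N) \<noteq> {\<one>\<^bsub>G Mod N\<^esub>}" by auto
  then obtain Z where Z: "Z \<in> carrier (G Mod N)" "Z \<noteq> \<one>\<^bsub>G Mod N\<^esub>"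
    "\<And>g. g \<in> carrier (G Mod N) \<Longrightarrow> Z \<otimes>\<^bsub>G Mod N\<^esub> g = g \<otimes>\<^bsub>G Mod N\<^esub> Z"
    using Q.nontrivial_center by blast
  obtain w where w: "w \<in> carrier G" "Z = N #> w" using Z(1) by (auto simp: carrier_FactGroup)
  have wN: "w \<notin> N" using Z(2) w N.rcos_const[OF is_group] by auto
  then obtain i where i: "w [^] (p ^ i) \<notin> N" "w [^] (p ^ Suc i) \<in> N"
    using exists_pow_p_mem[OF N.is_subgroup w(1)] by blast
  let ?z = "w [^] (p ^ i)"
  have z: "?z \<in> carrier G" using w by simp
  have "?z \<otimes> g \<otimes> inv ?z \<otimes> inv g \<in> N" if g: "g \<in> carrier G" for g
  proof -
    let ?g = "N #> g"
    have gQ: "?g \<in> carrier (G Mod N)" using g by (auto simp: carrier_FactGroup)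
    have "Z [^]\<^bsub>G Mod N\<^esub> (p ^ i) \<otimes>\<^bsub>G Mod N\<^esub> ?g = ?g \<otimes>\<^bsub>G Mod N\<^esub> Z [^]\<^bsub>G Mod N\<^esub> (p ^ i)"
      using Q.group_commutes_pow[OF Z(3)[OF gQ] Z(1) gQ] .
    then have "N #> (?z \<otimes> g) = N #> (g \<otimes> ?z)"
      using w g z N.FactGroup_pow[OF w(1)] by (simp add: N.rcos_sum)
    then have "?z \<otimes> g \<in> N #> (g \<otimes> ?z)" using rcos_self N.is_subgroup g z by (metis m_closed)
    then have "(?z \<otimes> g) \<otimes> inv (g \<otimes> ?z) \<in> N"
      using N.rcos_module_imp[OF is_group] g z by blast
    then show ?thesis using g z by (simp add: word_simps)
  qed
  moreover have "?z [^] p \<in> N" using i(2) w by (simp add: nat_pow_pow mult.commute)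
  ultimately show thesis using that[of ?z] z i(1) by blast
qed


lemma conj_pow_mem:
  assumes U: "subgroup U G" and z: "z \<in> carrier G"
    and norm: "\<And>u. u \<in> U \<Longrightarrow> z \<otimes> u \<otimes> inv z \<in> U" and u: "u \<in> U"
  shows "z [^] (i::nat) \<otimes> u \<otimes> inv (z [^] i) \<in> U"
proof (induction i)
  case 0 then show ?case using u subgroup.mem_carrier[OF U u] by simp
next
  case (Suc i)
  have "z [^] Suc i \<otimes> u \<otimes> inv (z [^] Suc i) = z \<otimes> (z [^] i \<otimes> u \<otimes> inv (z [^] i)) \<otimes> inv z"
    using z subgroup.mem_carrier[OF U u] unfolding nat_pow_Suc2[OF z] by (simp add: word_simps del: nat_pow_Suc)
  then show ?case using norm[OF Suc] by simp
qed

text \<open>As \<open>z\<close> normalizes \<open>U\<close>, the set is closed under products. The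
  powers of \<open>z\<close> with exponents below \<open>p\<close> represent distinct cosets of
  \<open>U\<close>, which gives the order.\<close>

lemma adjoin_subgroup:
  assumes U: "subgroup U G" and z: "z \<in> carrier G" and zU: "z \<notin> U" and zp: "z [^] p \<in> U"
    and norm: "\<And>u. u \<in> U \<Longrightarrow> z \<otimes> u \<otimes> inv z \<in> U"
  defines "Z \<equiv> {u \<otimes> z [^] (i::nat) | u i. u \<in> U}"
  shows "subgroup Z G" "card Z = p * card U" "U \<subseteq> Z" "z \<in> Z"
proof -
  have UG: "u \<in> U \<Longrightarrow> u \<in> carrier G" for u using subgroup.mem_carrier[OF U] .
  show UZ: "U \<subseteq> Z"
  proof
    fix u assume "u \<in> U"
    then show "u \<in> Z" unfolding Z_def using UG by (intro CollectI exI[of _ u] exI[of _ "0::nat"]) simp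
  qed
  show "z \<in> Z" unfolding Z_def
    using z subgroup.one_closed[OF U] by (intro CollectI exI[of _ \<one>] exI[of _ "1::nat"]) simp
  have ZG: "Z \<subseteq> carrier G" unfolding Z_def using z UG by auto
  show "subgroup Z G"
  proof (rule finite_subgroupI)
    show "finite Z" using ZG finite_carrier finite_subset by blast
    show "Z \<noteq> {}" using UZ subgroup.one_closed[OF U] by auto
    fix x y assume "x \<in> Z" "y \<in> Z"
    then obtain u i v j where x: "x = u \<otimes> z [^] (i::nat)" "u \<in> U"
      and y: "y = v \<otimes> z [^] (j::nat)" "v \<in> U" unfolding Z_def by auto
    have "x \<otimes> y = (u \<otimes> (z [^] i \<otimes> v \<otimes> inv (z [^] i))) \<otimes> z [^] (i + j)"
      using x y z UG by (simp add: word_simps nat_pow_mult[symmetric])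
    then show "x \<otimes> y \<in> Z" unfolding Z_def
      using conj_pow_mem[OF U z norm y(2), of i] x(2) subgroup.m_closed[OF U] by blast
  qed (rule ZG)
  let ?f = "\<lambda>(u, i::nat). u \<otimes> z [^] i"
  have "inj_on ?f (U \<times> {..<p})"
  proof (rule inj_onI)
    fix s t assume st: "s \<in> U \<times> {..<p}" "t \<in> U \<times> {..<p}" "?f s = ?f t"
    obtain u i v j where s: "s = (u, i)" and t: "t = (v, j)" by (metis prod.exhaust)
    have *: "u \<in> U" "i \<in> {..<p}" "v \<in> U" "j \<in> {..<p}" "u \<otimes> z [^] i = v \<otimes> z [^] j"
      using st unfolding s t by auto
    \<comment> \<open>Two equal products would put a power of \<open>z\<close> with exponent
      strictly between 0 and \<open>p\<close> into \<open>U\<close>, and then \<open>z\<close>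
      itself.\<close>
    have aux: "i = j" if "i \<le> j" "u \<in> U" "v \<in> U" "j < p" "u \<otimes> z [^] i = v \<otimes> z [^] j" for u v i j
    proof (rule ccontr)
      assume "i \<noteq> j"
      define k where "k = j - i"
      have k: "0 < k" "k < p" "j = k + i" using that \<open>i \<noteq> j\<close> by (auto simp: k_def)
      have "u \<otimes> z [^] i = v \<otimes> z [^] k \<otimes> z [^] i"
        using that UG z k(3) by (simp add: nat_pow_mult[symmetric] m_assoc)
      then have "u = v \<otimes> z [^] k" using that UG z by simp
      then have "z [^] k = inv v \<otimes> u" using that UG z by (simp add: word_simps)
      then have "z [^] k \<in> U"
        using that U subgroup.m_closed subgroup.m_inv_closed by metis
      moreover have "coprime k p"
        using prime_p k by (metis coprime_commute nat_dvd_not_less prime_imp_coprime_nat)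
      ultimately show False using pow_coprime_mem[OF U z] zU by blast
    qed
    have "i = j"
      using aux[of i j u v] aux[of j i v u] * by (metis lessThan_iff nat_le_linear)
    then show "s = t" unfolding s t using * UG z by auto
  qed
  moreover have "?f ` (U \<times> {..<p}) = Z"
  proof
    show "?f ` (U \<times> {..<p}) \<subseteq> Z" unfolding Z_def by auto
    show "Z \<subseteq> ?f ` (U \<times> {..<p})"
    proof
      fix x assume "x \<in> Z"
      then obtain u i where x: "x = u \<otimes> z [^] (i::nat)" "u \<in> U" unfolding Z_def by auto
      have "z [^] i = z [^] (p * (i div p) + i mod p)" by simp
      also have "\<dots> = (z [^] p) [^] (i div p) \<otimes> z [^] (i mod p)"
        using z by (simp add: nat_pow_mult nat_pow_pow)
      finally have "x = (u \<otimes> (z [^] p) [^] (i div p)) \<otimes> z [^] (i mod p)"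
        using x z UG by (simp add: m_assoc)
      moreover have "u \<otimes> (z [^] p) [^] (i div p) \<in> U"
        using x(2) subgroup_nat_pow_closed[OF U zp] subgroup.m_closed[OF U] by blast
      moreover have "i mod p < p" using p_gt_1 by simp
      ultimately show "x \<in> ?f ` (U \<times> {..<p})" by force
    qed
  qed
  ultimately have "card Z = card (U \<times> {..<p})" using card_image by fastforce
  then show "card Z = p * card U" by (simp add: card_cartesian_product)
qed

text \<open>Normalizers grow. Let \<open>N\<close> be a largest normal subgroup of the whole group
  inside \<open>U\<close>, and let \<open>z\<close> be central of order \<open>p\<close> modulo
  \<open>N\<close>. If \<open>z\<close> were in \<open>U\<close>, adjoining it to \<open>N\<close>
  would give a larger normal subgroup inside \<open>U\<close>. It normalizes \<open>U\<close>
  because its commutators lie in \<open>N\<close>.\<close>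

lemma exists_normalizing_outside:
  assumes U: "subgroup U G" and ne: "U \<noteq> carrier G"
  obtains z where "z \<in> carrier G" "z \<notin> U" "z [^] p \<in> U" "\<And>u. u \<in> U \<Longrightarrow> z \<otimes> u \<otimes> inv z \<in> U"
proof -
  let ?P = "\<lambda>N. N \<lhd> G \<and> N \<subseteq> U"
  have "?P {\<one>}" using subgroup.one_closed[OF U] triv_subgroup by (auto simp: normal_inv_iff)
  moreover have "\<forall>N. ?P N \<longrightarrow> card N \<le> order G"
    unfolding order_def using finite_carrier U subgroup.subset card_mono
    by (metis (no_types, lifting) subset_trans)
  ultimately obtain N where N: "?P N" "\<And>M. ?P M \<Longrightarrow> card M \<le> card N"
    using ex_has_greatest_nat[of ?P "{\<one>}" card] by (metis le_imp_less_Suc)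
  have Nsub: "subgroup N G" using N(1) normal_imp_subgroup by blast
  have Ncl: "g \<otimes> n \<otimes> inv g \<in> N" if "g \<in> carrier G" "n \<in> N" for g n
    using N(1) that normal_inv_iff by blast
  have "N \<noteq> carrier G" using N(1) ne subgroup.subset[OF U] by auto
  then obtain z where z: "z \<in> carrier G" "z \<notin> N" "z [^] p \<in> N"
    and comm: "\<And>g. g \<in> carrier G \<Longrightarrow> z \<otimes> g \<otimes> inv z \<otimes> inv g \<in> N"
    using central_mod_normal N(1) by metis
  have "z \<notin> U"
  proof
    assume zU: "z \<in> U"
    define M where "M = {u \<otimes> z [^] (i::nat) | u i. u \<in> N}"
    note M = adjoin_subgroup[OF Nsub z Ncl[OF z(1)], folded M_def]
    have MU: "M \<subseteq> U"
      unfolding M_def using N(1) zU subgroup.m_closed[OF U] subgroup_nat_pow_closed[OF U] by blast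
    have "M \<lhd> G" unfolding normal_inv_iff
    proof (intro conjI ballI M(1))
      fix g m assume g: "g \<in> carrier G" and "m \<in> M"
      then obtain n i where m: "m = n \<otimes> z [^] (i::nat)" "n \<in> N" unfolding M_def by auto
      have nG: "n \<in> carrier G" using m(2) subgroup.mem_carrier[OF Nsub] by auto
      \<comment> \<open>A conjugate of \<open>z\<close> differs from \<open>z\<close> by a
        commutator in \<open>N\<close>, so it stays in \<open>M\<close>.\<close>
      have c: "g \<otimes> z \<otimes> inv g = inv (z \<otimes> g \<otimes> inv z \<otimes> inv g) \<otimes> z"
        using g z by (simp add: word_simps)
      have "g \<otimes> z \<otimes> inv g \<in> M"
        unfolding c using comm[OF g] M(3,4) subgroup.m_inv_closed[OF Nsub] subgroup.m_closed[OF M(1)] by blast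
      then have "(g \<otimes> z \<otimes> inv g) [^] i \<in> M" using subgroup_nat_pow_closed[OF M(1), of "g \<otimes> z \<otimes> inv g" i] by simp
      moreover have "(g \<otimes> z \<otimes> inv g) [^] i = g \<otimes> z [^] i \<otimes> inv g"
        using g z by (induction i) (auto simp: word_simps)
      ultimately have "(g \<otimes> n \<otimes> inv g) \<otimes> (g \<otimes> z [^] i \<otimes> inv g) \<in> M"
        using Ncl[OF g m(2)] M(3) subgroup.m_closed[OF M(1)] by auto
      then show "g \<otimes> m \<otimes> inv g \<in> M" using g nG z m by (simp add: word_simps)
    qed
    then have "card M \<le> card N" using N(2) MU by blast
    moreover have "card N > 0" using Nsub finite_carrier subgroup.finite_imp_card_positive by blast
    ultimately show False using M(2) p_gt_1 by simp
  qed
  moreover have "z \<otimes> u \<otimes> inv z \<in> U" if u: "u \<in> U" for u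
  proof -
    have uG: "u \<in> carrier G" using u subgroup.mem_carrier[OF U] by auto
    have "z \<otimes> u \<otimes> inv z = (z \<otimes> u \<otimes> inv z \<otimes> inv u) \<otimes> u" using uG z by (simp add: word_simps)
    moreover have "z \<otimes> u \<otimes> inv z \<otimes> inv u \<in> U" using comm[OF uG] N(1) by auto
    ultimately show ?thesis using u subgroup.m_closed[OF U] by metis
  qed
  ultimately show thesis using that z N(1) by blast
qed

lemma exists_normalizing_between:
  assumes U: "subgroup U G" and Y: "subgroup Y G" and UY: "U \<subset> Y"
  obtains z where "z \<in> Y" "z \<notin> U" "z [^] p \<in> U" "\<And>u. u \<in> U \<Longrightarrow> z \<otimes> u \<otimes> inv z \<in> U"
proof -
  interpret Y: finite_p_group "G\<lparr>carrier := Y\<rparr>" p by (rule finite_p_group_subgroup[OF Y])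
  have "subgroup U (G\<lparr>carrier := Y\<rparr>)" using subgroup_incl[OF U Y] UY by auto
  moreover have "U \<noteq> carrier (G\<lparr>carrier := Y\<rparr>)" using UY by auto
  ultimately obtain z where "z \<in> carrier (G\<lparr>carrier := Y\<rparr>)" "z \<notin> U" "z [^]\<^bsub>G\<lparr>carrier := Y\<rparr>\<^esub> p \<in> U"
    "\<And>u. u \<in> U \<Longrightarrow> z \<otimes>\<^bsub>G\<lparr>carrier := Y\<rparr>\<^esub> u \<otimes>\<^bsub>G\<lparr>carrier := Y\<rparr>\<^esub> inv\<^bsub>G\<lparr>carrier := Y\<rparr>\<^esub> z \<in> U"
    using Y.exists_normalizing_outside by metis
  then show thesis using that[of z] Y by (simp add: nat_pow_consistent[symmetric])
qed

lemma central_mod_between: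
  assumes N: "subgroup N G" and Y: "subgroup Y G" and NY: "N \<subset> Y"
    and norm: "\<And>y n. \<lbrakk>y \<in> Y; n \<in> N\<rbrakk> \<Longrightarrow> y \<otimes> n \<otimes> inv y \<in> N"
  obtains z where "z \<in> Y" "z \<notin> N" "z [^] p \<in> N"
    "\<And>g. g \<in> Y \<Longrightarrow> z \<otimes> g \<otimes> inv z \<otimes> inv g \<in> N"
proof -
  interpret Y: finite_p_group "G\<lparr>carrier := Y\<rparr>" p by (rule finite_p_group_subgroup[OF Y])
  have "N \<lhd> G\<lparr>carrier := Y\<rparr>"
    unfolding Y.normal_inv_iff using subgroup_incl[OF N Y] NY norm Y by auto
  moreover have "N \<noteq> carrier (G\<lparr>carrier := Y\<rparr>)" using NY by auto
  ultimately obtain z where "z \<in> carrier (G\<lparr>carrier := Y\<rparr>)" "z \<notin> N" "z [^]\<^bsub>G\<lparr>carrier := Y\<rparr>\<^esub> p \<in> N"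
    "\<And>g. g \<in> carrier (G\<lparr>carrier := Y\<rparr>) \<Longrightarrow> z \<otimes>\<^bsub>G\<lparr>carrier := Y\<rparr>\<^esub> g \<otimes>\<^bsub>G\<lparr>carrier := Y\<rparr>\<^esub> inv\<^bsub>G\<lparr>carrier := Y\<rparr>\<^esub> z
      \<otimes>\<^bsub>G\<lparr>carrier := Y\<rparr>\<^esub> inv\<^bsub>G\<lparr>carrier := Y\<rparr>\<^esub> g \<in> N"
    using Y.central_mod_normal by metis
  then show thesis using that[of z] Y by (simp add: nat_pow_consistent[symmetric])
qed

lemma prime_index_eq:
  assumes U: "subgroup U G" and Z: "subgroup Z G" and Y: "subgroup Y G"
    and sub: "U \<subset> Z" "Z \<subseteq> Y" and card: "card Y = p * card U"
  shows "Z = Y"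
proof (rule card_subset_eq[OF finite_subgroup[OF Y] sub(2)])
  obtain k where k: "card Z = card U * k" using card_subgroup_dvd[OF U Z] sub by blast
  have pos: "card U > 0" using U finite_carrier subgroup.finite_imp_card_positive by blast
  have "card U * k dvd card U * p"
    using card_subgroup_dvd[OF Z Y sub(2)] card k by (simp add: mult.commute)
  then have "k dvd p" using pos by simp
  moreover have "k \<noteq> 1" using psubset_card_mono[OF finite_subgroup[OF Z] sub(1)] k by auto
  ultimately have "k = p" using prime_p by (metis One_nat_def prime_nat_iff)
  then show "card Z = card Y" using k card by simp
qed

text \<open>The group climbs from \<open>U\<close> in steps of index \<open>p\<close>, each made by
  adjoining a normalizing element of \<open>Y\<close>; the induction counts the remaining
  steps.\<close>

lemma exists_subgroup_between:
  assumes U: "subgroup U G" and Y: "subgroup Y G" and UY: "U \<subseteq> Y"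
    and "card U \<le> p ^ k" "p ^ k \<le> card Y"
  obtains H where "subgroup H G" "U \<subseteq> H" "H \<subseteq> Y" "card H = p ^ k"
proof -
  obtain i where i: "card U = p ^ i" using card_subgroup_prime_power[OF U] .
  then have "i \<le> k" using assms(4) p_gt_1 power_increasing_iff by (metis)
  then obtain n where "k = i + n" using le_Suc_ex by blast
  have "\<exists>H. subgroup H G \<and> U \<subseteq> H \<and> H \<subseteq> Y \<and> card H = p ^ k"
    using U UY i \<open>k = i + n\<close>
  proof (induction n arbitrary: U i)
    case 0 then show ?case by auto
  next
    case (Suc n)
    have "p ^ i < p ^ k" using p_gt_1 Suc.prems(4) by (intro power_strict_increasing) auto
    then have "U \<subset> Y" using Suc.prems(2,3) assms(5) by auto
    then obtain z where z: "z \<in> Y" "z \<notin> U" "z [^] p \<in> U"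
      "\<And>u. u \<in> U \<Longrightarrow> z \<otimes> u \<otimes> inv z \<in> U"
      using exists_normalizing_between[OF Suc.prems(1) Y] by blast
    define Z where "Z = {u \<otimes> z [^] (i::nat) | u i. u \<in> U}"
    have zG: "z \<in> carrier G" using z(1) subgroup.mem_carrier[OF Y] by auto
    note Z = adjoin_subgroup[OF Suc.prems(1) zG z(2,3,4), folded Z_def]
    have "Z \<subseteq> Y" unfolding Z_def
      using Suc.prems(2) z(1) subgroup.m_closed[OF Y] subgroup_nat_pow_closed[OF Y] by blast
    then obtain H where "subgroup H G" "Z \<subseteq> H" "H \<subseteq> Y" "card H = p ^ k"
      using Suc.IH[of Z "Suc i"] Z Suc.prems by auto
    then show ?case using Z(3) by blast
  qed
  then show thesis using that by blast
qed

end

section \<open>Automorphisms of order prime to p\<close>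

text \<open>To be applied to Aut_F(K) acting on \<open>K\<close>. Inverses are described by values
  on the carrier, which avoids a group structure on \<open>A\<close>. By \<open>A_inner\<close>, all
  invariant subgroups are normal.\<close>

locale automorphism_family = finite_p_group G p for G (structure) and p +
  fixes A :: "('a \<Rightarrow> 'a) set"
  assumes A_hom: "\<alpha> \<in> A \<Longrightarrow> \<alpha> \<in> hom G G"
    and A_compose: "\<lbrakk>\<alpha> \<in> A; \<beta> \<in> A\<rbrakk> \<Longrightarrow> compose (carrier G) \<alpha> \<beta> \<in> A"
    and A_inverse: "\<alpha> \<in> A \<Longrightarrow> \<exists>\<beta>\<in>A. \<forall>x\<in>carrier G. \<beta> (\<alpha> x) = x \<and> \<alpha> (\<beta> x) = x"
    and A_inner: "g \<in> carrier G \<Longrightarrow> \<exists>\<alpha>\<in>A. \<forall>x\<in>carrier G. \<alpha> x = g \<otimes> x \<otimes> inv g"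
begin

lemma A_group_hom: "\<alpha> \<in> A \<Longrightarrow> group_hom G G \<alpha>"
  using A_hom by (simp add: group_hom_def group_hom_axioms_def group_axioms)

lemma A_closed [simp]: "\<lbrakk>\<alpha> \<in> A; x \<in> carrier G\<rbrakk> \<Longrightarrow> \<alpha> x \<in> carrier G"
  using A_hom hom_in_carrier by metis

lemma A_mult: "\<lbrakk>\<alpha> \<in> A; x \<in> carrier G; y \<in> carrier G\<rbrakk> \<Longrightarrow> \<alpha> (x \<otimes> y) = \<alpha> x \<otimes> \<alpha> y"
  using A_hom hom_mult by metis

lemma A_m_inv: "\<lbrakk>\<alpha> \<in> A; x \<in> carrier G\<rbrakk> \<Longrightarrow> \<alpha> (inv x) = inv (\<alpha> x)"
  using A_group_hom group_hom.hom_inv by metis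

lemma A_one: "\<alpha> \<in> A \<Longrightarrow> \<alpha> \<one> = \<one>"
  using A_group_hom group_hom.hom_one by metis

lemma A_pow: "\<lbrakk>\<alpha> \<in> A; x \<in> carrier G\<rbrakk> \<Longrightarrow> \<alpha> (x [^] (n::nat)) = \<alpha> x [^] n"
  by (induction n) (auto simp: A_one A_mult)

lemma A_eq_iff: "\<lbrakk>\<alpha> \<in> A; x \<in> carrier G; y \<in> carrier G\<rbrakk> \<Longrightarrow> \<alpha> x = \<alpha> y \<longleftrightarrow> x = y"
  using A_inverse by metis

lemma A_funpow_closed: "\<lbrakk>\<alpha> \<in> A; x \<in> carrier G\<rbrakk> \<Longrightarrow> (\<alpha> ^^ n) x \<in> carrier G"
  by (induction n) auto

lemma A_preimage_subgroup:
  assumes "\<alpha> \<in> A" "subgroup V G" "subgroup W G"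
  shows "subgroup {x \<in> V. \<alpha> x \<in> W} G"
proof (rule subgroupI)
  show "{x \<in> V. \<alpha> x \<in> W} \<subseteq> carrier G" using subgroup.subset[OF assms(2)] by auto
  show "{x \<in> V. \<alpha> x \<in> W} \<noteq> {}"
    using subgroup.one_closed[OF assms(2)] subgroup.one_closed[OF assms(3)] A_one[OF assms(1)] by auto
  note carr = subgroup.mem_carrier[OF assms(2)]
  show "inv a \<in> {x \<in> V. \<alpha> x \<in> W}" if "a \<in> {x \<in> V. \<alpha> x \<in> W}" for a
    using that A_m_inv[OF assms(1) carr] subgroup.m_inv_closed[OF assms(2)] subgroup.m_inv_closed[OF assms(3)]
    by auto
  show "a \<otimes> b \<in> {x \<in> V. \<alpha> x \<in> W}" if "a \<in> {x \<in> V. \<alpha> x \<in> W}" "b \<in> {x \<in> V. \<alpha> x \<in> W}" for a b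
    using that A_mult[OF assms(1) carr carr] subgroup.m_closed[OF assms(2)] subgroup.m_closed[OF assms(3)]
    by auto
qed

definition invariant :: "'a set \<Rightarrow> bool" where
  "invariant U \<longleftrightarrow> subgroup U G \<and> (\<forall>\<alpha>\<in>A. \<forall>x\<in>U. \<alpha> x \<in> U)"

lemma invariantD:
  assumes "invariant U"
  shows "subgroup U G" "\<lbrakk>\<alpha> \<in> A; x \<in> U\<rbrakk> \<Longrightarrow> \<alpha> x \<in> U"
  using assms unfolding invariant_def by auto

lemma invariant_carrier: "invariant (carrier G)"
  unfolding invariant_def using subgroup_self by auto

lemma invariant_trivial: "invariant {\<one>}"
  unfolding invariant_def using triv_subgroup A_one by auto

lemma invariant_conj:
  assumes "invariant U" "x \<in> U" "g \<in> carrier G"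
  shows "g \<otimes> x \<otimes> inv g \<in> U" "inv g \<otimes> x \<otimes> g \<in> U"
proof -
  have aux: "h \<otimes> x \<otimes> inv h \<in> U" if h: "h \<in> carrier G" for h
    using A_inner[OF h] invariantD[OF assms(1)] assms(2) subgroup.mem_carrier by metis
  show "g \<otimes> x \<otimes> inv g \<in> U" "inv g \<otimes> x \<otimes> g \<in> U"
    using aux[OF assms(3)] aux[of "inv g"] assms(3) by auto
qed

lemma invariant_preimage:
  assumes "invariant U" "\<alpha> \<in> A" "y \<in> U"
  obtains x where "x \<in> U" "\<alpha> x = y"
  using A_inverse[OF assms(2)] invariantD[OF assms(1)] assms(3) subgroup.mem_carrier by metis

text \<open>If \<open>t = r x \<otimes> inv x\<close> is fixed by \<open>r\<close>, then the n-th
  iterate of \<open>r\<close> sends \<open>x\<close> to \<open>t [^] n \<otimes> x\<close>. Hence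
  \<open>t [^] m\<close> is the unit, and so is \<open>t\<close>, since \<open>m\<close> is prime to
  \<open>p\<close>.\<close>

lemma coprime_order_fixed:
  assumes r: "r \<in> A" and m: "coprime m p" "\<And>x. x \<in> carrier G \<Longrightarrow> (r ^^ m) x = x"
    and x: "x \<in> carrier G" and fixed: "r (r x \<otimes> inv x) = r x \<otimes> inv x"
  shows "r x = x"
proof -
  define t where "t = r x \<otimes> inv x"
  have t: "t \<in> carrier G" "r t = t" "r x = t \<otimes> x" using r x fixed by (auto simp: t_def m_assoc)
  have "(r ^^ n) x = t [^] n \<otimes> x" for n
    by (induction n) (use t x r in \<open>simp_all add: A_mult A_pow m_assoc nat_pow_Suc2 del: nat_pow_Suc\<close>)
  then have "t [^] m \<otimes> x = x" using m(2)[OF x] by simp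
  then have "t [^] m \<in> {\<one>}" using t(1) x by (simp add: l_cancel_one)
  then have "t \<in> {\<one>}" using pow_coprime_mem[OF triv_subgroup t(1) _ m(1)] by simp
  then show ?thesis using t(3) x by simp
qed

text \<open>
  The common kernel of the linear characters of \<open>A\<close> that come from its action on the invariant
  sections of order \<open>p\<close>; it contains all commutators and all \<open>(p - 1)\<close>-st powers.
\<close>

definition section_kernel :: "('a \<Rightarrow> 'a) set" where
  "section_kernel = {\<alpha> \<in> A. \<forall>U Y. invariant U \<and> invariant Y \<and> U \<subseteq> Y \<and> card Y = p * card U
     \<longrightarrow> (\<forall>y\<in>Y. \<alpha> y \<otimes> inv y \<in> U)}"

text \<open>These are the elements of order prime to \<open>p\<close>; the value
  \<open>m = 0\<close> is excluded, because 0 is not coprime to a prime.\<close>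

definition coprime_kernel :: "('a \<Rightarrow> 'a) set" where
  "coprime_kernel = {r \<in> section_kernel. \<exists>m. coprime m p \<and> (\<forall>x\<in>carrier G. (r ^^ m) x = x)}"

lemma section_kernelD:
  "\<lbrakk>\<alpha> \<in> section_kernel; invariant U; invariant Y; U \<subseteq> Y; card Y = p * card U; y \<in> Y\<rbrakk>
    \<Longrightarrow> \<alpha> y \<otimes> inv y \<in> U"
  unfolding section_kernel_def by blast

lemma coprime_kernel_A: "r \<in> coprime_kernel \<Longrightarrow> r \<in> A"
  unfolding coprime_kernel_def section_kernel_def by blast

lemma coprime_kernel_fixed:
  assumes "r \<in> coprime_kernel" "x \<in> carrier G" "r (r x \<otimes> inv x) = r x \<otimes> inv x"
  shows "r x = x"
  using assms coprime_order_fixed[OF coprime_kernel_A] unfolding coprime_kernel_def by blast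

text \<open>The witness is the conjugate of \<open>r\<close> by \<alpha>. It is trivial on the same
  sections as \<open>r\<close> because \<alpha> and its inverse preserve \<open>U\<close> and
  \<open>Y\<close>, and its iterates are the conjugates of those of \<open>r\<close>.\<close>

lemma coprime_kernel_conj:
  assumes r: "r \<in> coprime_kernel" and \<alpha>: "\<alpha> \<in> A"
  obtains r' where "r' \<in> coprime_kernel" "\<And>x. x \<in> carrier G \<Longrightarrow> r' (\<alpha> x) = \<alpha> (r x)"
proof -
  have rA: "r \<in> A" using r by (rule coprime_kernel_A)
  obtain \<beta> where \<beta>: "\<beta> \<in> A" "\<And>x. x \<in> carrier G \<Longrightarrow> \<beta> (\<alpha> x) = x" "\<And>x. x \<in> carrier G \<Longrightarrow> \<alpha> (\<beta> x) = x"
    using A_inverse[OF \<alpha>] by blast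
  define r' where "r' = compose (carrier G) \<alpha> (compose (carrier G) r \<beta>)"
  have r'A: "r' \<in> A" unfolding r'_def using \<alpha> rA \<beta>(1) A_compose by blast
  have r': "r' x = \<alpha> (r (\<beta> x))" if "x \<in> carrier G" for x
    unfolding r'_def using that by (simp add: compose_def)
  have "r' y \<otimes> inv y \<in> U" if U: "invariant U" "invariant Y" "U \<subseteq> Y" "card Y = p * card U" "y \<in> Y" for U Y y
  proof -
    have y: "y \<in> carrier G" using U subgroup.mem_carrier invariantD by metis
    have "r (\<beta> y) \<otimes> inv (\<beta> y) \<in> U"
      using section_kernelD[OF _ U(1-4)] invariantD(2)[OF U(2) \<beta>(1) U(5)] r
      unfolding coprime_kernel_def by blast
    then have "\<alpha> (r (\<beta> y) \<otimes> inv (\<beta> y)) \<in> U" using invariantD(2)[OF U(1) \<alpha>] by blast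
    then show ?thesis using \<alpha> rA \<beta> y by (simp add: A_mult A_m_inv r')
  qed
  then have "r' \<in> section_kernel" unfolding section_kernel_def using r'A by blast
  moreover obtain m where m: "coprime m p" "\<And>x. x \<in> carrier G \<Longrightarrow> (r ^^ m) x = x"
    using r unfolding coprime_kernel_def by blast
  have "(r' ^^ n) x = \<alpha> ((r ^^ n) (\<beta> x))" if x: "x \<in> carrier G" for x n
    by (induction n) (use x \<alpha> \<beta> rA A_funpow_closed[of r "\<beta> x"] in \<open>auto simp: r'\<close>)
  then have "\<forall>x\<in>carrier G. (r' ^^ m) x = x" using m(2) \<beta> by simp
  ultimately have "r' \<in> coprime_kernel" unfolding coprime_kernel_def using m(1) by blast
  then show thesis using that r' \<alpha> rA \<beta> by simp
qed

end

section \<open>Minimal invariant subgroups moved by the coprime kernel\<close>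

locale minimal_moved = automorphism_family +
  fixes K
  assumes K_inv: "invariant K"
    and K_moved: "\<exists>r\<in>coprime_kernel. \<exists>x\<in>K. r x \<noteq> x"
    and K_min: "\<lbrakk>invariant U; U \<subset> K; r \<in> coprime_kernel; x \<in> U\<rbrakk> \<Longrightarrow> r x = x"
begin

lemma K_subgroup: "subgroup K G" using K_inv by (rule invariantD)

lemma K_carrier: "x \<in> K \<Longrightarrow> x \<in> carrier G" using K_subgroup subgroup.mem_carrier by metis

text \<open>The coprime kernel is stable under conjugation by \<open>A\<close>, so the elements
  \<open>r x \<otimes> inv x\<close> generate an invariant subgroup \<open>W\<close> of
  \<open>K\<close>, which turns out to be \<open>K\<close>. Properties of \<open>K\<close> need
  therefore be checked on these elements only.\<close>

lemma commutators_generate: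
  assumes Y: "subgroup Y G" and "\<And>r x. \<lbrakk>r \<in> coprime_kernel; x \<in> K\<rbrakk> \<Longrightarrow> r x \<otimes> inv x \<in> Y"
  shows "K \<subseteq> Y"
proof -
  define g where "g = {r x \<otimes> inv x | r x. r \<in> coprime_kernel \<and> x \<in> K}"
  define W where "W = generate G g"
  have gK: "g \<subseteq> K" unfolding g_def
    using K_subgroup coprime_kernel_A invariantD(2)[OF K_inv]
    by (auto intro!: subgroup.m_closed subgroup.m_inv_closed)
  then have gG: "g \<subseteq> carrier G" using K_carrier by auto
  have W: "subgroup W G" unfolding W_def using gG by (rule generate_is_subgroup)
  have WK: "W \<subseteq> K" unfolding W_def using gK K_subgroup by (rule generate_subgroup_incl)
  have gW: "g \<subseteq> W" unfolding W_def by (auto intro: generate.incl)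
  have "invariant W" unfolding invariant_def
  proof (intro conjI W ballI)
    fix \<alpha> w assume \<alpha>: "\<alpha> \<in> A" and w: "w \<in> W"
    have "g \<subseteq> {x \<in> carrier G. \<alpha> x \<in> W}"
    proof
      fix y assume y: "y \<in> g"
      then obtain r x where rx: "y = r x \<otimes> inv x" "r \<in> coprime_kernel" "x \<in> K" unfolding g_def by auto
      obtain r' where r': "r' \<in> coprime_kernel" "\<And>x. x \<in> carrier G \<Longrightarrow> r' (\<alpha> x) = \<alpha> (r x)"
        using coprime_kernel_conj[OF rx(2) \<alpha>] by blast
      have "\<alpha> y = r' (\<alpha> x) \<otimes> inv (\<alpha> x)"
        unfolding rx(1) using \<alpha> rx r' K_carrier coprime_kernel_A by (simp add: A_mult A_m_inv)
      moreover have "\<alpha> x \<in> K" using invariantD(2)[OF K_inv \<alpha> rx(3)] .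
      ultimately have "\<alpha> y \<in> g" unfolding g_def using r'(1) by blast
      then show "y \<in> {x \<in> carrier G. \<alpha> x \<in> W}" using y gG gW by auto
    qed
    then have "W \<subseteq> {x \<in> carrier G. \<alpha> x \<in> W}"
      using A_preimage_subgroup[OF \<alpha> subgroup_self W] generate_subgroup_incl by (metis W_def)
    then show "\<alpha> w \<in> W" using w by auto
  qed
  \<comment> \<open>If \<open>W\<close> were proper, minimality would make \<open>r\<close> fix
    \<open>r x \<otimes> inv x\<close>, and coprimality would then make it fix
    \<open>x\<close>.\<close>
  have "W = K"
  proof (rule ccontr)
    assume "W \<noteq> K"
    then have "W \<subset> K" using WK by auto
    obtain r x where rx: "r \<in> coprime_kernel" "x \<in> K" "r x \<noteq> x" using K_moved by blast
    have "r x \<otimes> inv x \<in> W" using gW rx unfolding g_def by blast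
    then have "r (r x \<otimes> inv x) = r x \<otimes> inv x" using K_min[OF \<open>invariant W\<close> \<open>W \<subset> K\<close> rx(1)] by blast
    then show False using coprime_kernel_fixed[OF rx(1)] K_carrier rx(2,3) by blast
  qed
  moreover have "g \<subseteq> Y" unfolding g_def using assms(2) by auto
  then have "W \<subseteq> Y" unfolding W_def using Y by (rule generate_subgroup_incl)
  ultimately show ?thesis by simp
qed

text \<open>Three subgroups lemma: \<open>U\<close> is centralized by \<open>[K, R]\<close>, where \<open>R\<close> is the coprime kernel.\<close>

lemma proper_invariant_central:
  assumes U: "invariant U" "U \<subset> K" and x: "x \<in> U" and y: "y \<in> K"
  shows "x \<otimes> y = y \<otimes> x"
proof -
  have UG: "u \<in> U \<Longrightarrow> u \<in> carrier G" for u using U(2) K_carrier by auto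
  let ?C = "{y \<in> carrier G. \<forall>x\<in>U. x \<otimes> y = y \<otimes> x}"
  have "subgroup ?C G"
  proof (rule subgroupI)
    fix a assume a: "a \<in> ?C"
    show "inv a \<in> ?C"
    proof (intro CollectI conjI ballI)
      fix u assume u: "u \<in> U"
      have "inv a \<otimes> (u \<otimes> a) \<otimes> inv a = inv a \<otimes> (a \<otimes> u) \<otimes> inv a" using a u by simp
      then show "u \<otimes> inv a = inv a \<otimes> u" using a UG[OF u] by (simp add: word_simps)
    qed (use a in auto)
  next
    fix a b assume ab: "a \<in> ?C" "b \<in> ?C"
    have "u \<otimes> (a \<otimes> b) = a \<otimes> b \<otimes> u" if u: "u \<in> U" for u
    proof -
      have c: "u \<otimes> a = a \<otimes> u" "u \<otimes> b = b \<otimes> u" using ab u by auto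
      have "u \<otimes> (a \<otimes> b) = a \<otimes> (u \<otimes> b)"
        using ab UG[OF u] c(1) by (simp add: m_assoc[symmetric])
      then show ?thesis using ab UG[OF u] c(2) by (simp add: m_assoc)
    qed
    then show "a \<otimes> b \<in> ?C" using ab by auto
  qed (use UG in auto)
  moreover have "r y \<otimes> inv y \<in> ?C" if r: "r \<in> coprime_kernel" and y: "y \<in> K" for r y
  proof (intro CollectI conjI ballI)
    have rA: "r \<in> A" using r by (rule coprime_kernel_A)
    note yG = K_carrier[OF y]
    show "r y \<otimes> inv y \<in> carrier G" using rA yG by simp
    fix u assume u: "u \<in> U"
    note uG = UG[OF u]
    \<comment> \<open>Since \<open>r\<close> fixes \<open>u\<close> and its conjugate by
      \<open>y\<close>, conjugation by \<open>r y\<close> and by \<open>y\<close> agree on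
      \<open>U\<close>, so their quotient centralizes \<open>U\<close>.\<close>
    have "inv y \<otimes> u \<otimes> y \<in> U" using invariant_conj[OF U(1) u yG] by blast
    then have "r (inv y \<otimes> u \<otimes> y) = inv y \<otimes> u \<otimes> y" using K_min[OF U r] by blast
    moreover have "r u = u" using K_min[OF U r u] .
    ultimately have "inv (r y) \<otimes> u \<otimes> r y = inv y \<otimes> u \<otimes> y"
      using rA yG uG by (simp add: A_mult A_m_inv)
    then have "r y \<otimes> (inv (r y) \<otimes> u \<otimes> r y) \<otimes> inv y = r y \<otimes> (inv y \<otimes> u \<otimes> y) \<otimes> inv y" by simp
    then show "u \<otimes> (r y \<otimes> inv y) = r y \<otimes> inv y \<otimes> u"
      using rA yG uG by (simp add: word_simps)
  qed
  ultimately have "K \<subseteq> ?C" by (rule commutators_generate)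
  then show ?thesis using x y by blast
qed

text \<open>If raising to the power \<open>q\<close> is multiplicative and \<open>r\<close> fixes
  all q-th powers, then the q-th power of \<open>r x \<otimes> inv x\<close> is trivial. These
  elements generate \<open>K\<close>.\<close>

lemma exponentI:
  fixes q :: nat
  assumes mult: "\<And>x y. \<lbrakk>x \<in> K; y \<in> K\<rbrakk> \<Longrightarrow> (x \<otimes> y) [^] q = x [^] q \<otimes> y [^] q"
    and fixed: "\<And>r x. \<lbrakk>r \<in> coprime_kernel; x \<in> K\<rbrakk> \<Longrightarrow> r (x [^] q) = x [^] q"
    and x: "x \<in> K"
  shows "x [^] q = \<one>"
proof -
  let ?Y = "{x \<in> K. x [^] q = \<one>}"
  have "subgroup ?Y G"
  proof (rule finite_subgroupI)
    show "finite ?Y" using finite_subgroup[OF K_subgroup] by auto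
    show "?Y \<noteq> {}" using subgroup.one_closed[OF K_subgroup] by auto
  qed (use K_carrier mult subgroup.m_closed[OF K_subgroup] in auto)
  moreover have "r x \<otimes> inv x \<in> ?Y" if r: "r \<in> coprime_kernel" and x: "x \<in> K" for r x
  proof (intro CollectI conjI)
    have rA: "r \<in> A" using r by (rule coprime_kernel_A)
    note xG = K_carrier[OF x]
    show gK: "r x \<otimes> inv x \<in> K"
      using subgroup.m_closed[OF K_subgroup] subgroup.m_inv_closed[OF K_subgroup] x
        invariantD(2)[OF K_inv rA x] by blast
    have "(r x \<otimes> inv x) [^] q \<otimes> x [^] q = (r x \<otimes> inv x \<otimes> x) [^] q" using mult[OF gK x] by simp
    also have "\<dots> = r (x [^] q)" using rA xG by (simp add: m_assoc A_pow)
    also have "\<dots> = x [^] q" using fixed[OF r x] .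
    finally show "(r x \<otimes> inv x) [^] q = \<one>" using rA xG by (simp add: l_cancel_one)
  qed
  ultimately have "K \<subseteq> ?Y" by (rule commutators_generate)
  then show ?thesis using x by auto
qed

definition K_center :: "'a set" where
  "K_center = {z \<in> K. \<forall>y\<in>K. z \<otimes> y = y \<otimes> z}"

lemma K_center_invariant: "invariant K_center"
  unfolding invariant_def
proof (intro conjI ballI)
  show "subgroup K_center G"
  proof (rule finite_subgroupI)
    show "finite K_center" using finite_subgroup[OF K_subgroup] by (auto simp: K_center_def)
    show "K_center \<noteq> {}" using subgroup.one_closed[OF K_subgroup] K_carrier by (auto simp: K_center_def)
    fix a b assume ab: "a \<in> K_center" "b \<in> K_center"
    have "a \<otimes> b \<otimes> y = y \<otimes> (a \<otimes> b)" if "y \<in> K" for y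
    proof -
      have G: "a \<in> carrier G" "b \<in> carrier G" "y \<in> carrier G"
        using ab that K_carrier by (auto simp: K_center_def)
      have c: "b \<otimes> y = y \<otimes> b" "a \<otimes> y = y \<otimes> a" using ab that by (auto simp: K_center_def)
      have "a \<otimes> b \<otimes> y = a \<otimes> y \<otimes> b" using G c(1) by (simp add: m_assoc)
      then show ?thesis using G c(2) by (simp add: m_assoc)
    qed
    then show "a \<otimes> b \<in> K_center" using ab subgroup.m_closed[OF K_subgroup] unfolding K_center_def by blast
  qed (auto simp: K_center_def K_carrier)
  fix \<alpha> z assume \<alpha>: "\<alpha> \<in> A" and z: "z \<in> K_center"
  have "\<alpha> z \<otimes> y = y \<otimes> \<alpha> z" if y: "y \<in> K" for y
  proof -
    obtain x where x: "x \<in> K" "\<alpha> x = y" using invariant_preimage[OF K_inv \<alpha> y] .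
    have zK: "z \<in> K" "z \<otimes> x = x \<otimes> z" using z x(1) unfolding K_center_def by blast+
    then have "\<alpha> (z \<otimes> x) = \<alpha> (x \<otimes> z)" by simp
    then show ?thesis using x(2) A_mult[OF \<alpha>] K_carrier[OF zK(1)] K_carrier[OF x(1)] by simp
  qed
  then show "\<alpha> z \<in> K_center" using z invariantD(2)[OF K_inv \<alpha>] unfolding K_center_def by blast
qed

text \<open>The p-th powers form an invariant subgroup. It is proper: otherwise each element would
  be a p^n-th power for all \<open>n\<close>, hence trivial. By minimality the coprime kernel fixes
  it pointwise, and \<open>exponentI\<close> applies.\<close>

lemma abelian_exponent:
  assumes ab: "\<And>x y. \<lbrakk>x \<in> K; y \<in> K\<rbrakk> \<Longrightarrow> x \<otimes> y = y \<otimes> x" and x: "x \<in> K"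
  shows "x [^] p = \<one>"
proof (rule exponentI[OF _ _ x])
  show mult: "(x \<otimes> y) [^] p = x [^] p \<otimes> y [^] p" if "x \<in> K" "y \<in> K" for x y
    using pow_mult_distrib[OF ab[OF that]] that K_carrier by blast
  let ?P = "(\<lambda>x. x [^] p) ` K"
  have P: "invariant ?P" unfolding invariant_def
  proof (intro conjI ballI)
    show "subgroup ?P G"
    proof (rule finite_subgroupI)
      show "finite ?P" using finite_subgroup[OF K_subgroup] by auto
      show "?P \<noteq> {}" using subgroup.one_closed[OF K_subgroup] by auto
      fix a b assume "a \<in> ?P" "b \<in> ?P"
      then show "a \<otimes> b \<in> ?P" using mult subgroup.m_closed[OF K_subgroup] by (force simp: mult[symmetric])
    qed (use K_carrier in auto)
    fix \<alpha> a assume "\<alpha> \<in> A" "a \<in> ?P"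
    then obtain x where x: "x \<in> K" "a = x [^] p" by blast
    show "\<alpha> a \<in> ?P" using A_pow[OF \<open>\<alpha> \<in> A\<close> K_carrier[OF x(1)]] invariantD(2)[OF K_inv \<open>\<alpha> \<in> A\<close> x(1)] x(2) by auto
  qed
  have PK: "?P \<subseteq> K" using subgroup_nat_pow_closed[OF K_subgroup] by auto
  have "?P \<noteq> K"
  proof
    assume eq: "?P = K"
    obtain e where e: "\<And>x. x \<in> carrier G \<Longrightarrow> x [^] (p ^ e) = \<one>" by (rule pow_prime_power_eq_one) blast
    have "\<exists>y\<in>K. x = y [^] (p ^ n)" if "x \<in> K" for x n
    proof (induction n)
      case 0 then show ?case using that K_carrier by (auto intro!: bexI[of _ x])
    next
      case (Suc n)
      then obtain y where y: "y \<in> K" "x = y [^] (p ^ n)" by blast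
      then obtain w where "w \<in> K" "y = w [^] p" using eq by blast
      then show ?case using y K_carrier by (auto simp: nat_pow_pow)
    qed
    then have "x = \<one>" if "x \<in> K" for x using that e K_carrier by metis
    moreover obtain r x where "r \<in> coprime_kernel" "x \<in> K" "r x \<noteq> x" using K_moved by blast
    ultimately show False using A_one coprime_kernel_A by metis
  qed
  then have "?P \<subset> K" using PK by auto
  then show "r (x [^] p) = x [^] p" if "r \<in> coprime_kernel" "x \<in> K" for r x
    using K_min[OF P] that by blast
qed

context
  assumes nonabelian: "\<exists>x\<in>K. \<exists>y\<in>K. x \<otimes> y \<noteq> y \<otimes> x"
begin

lemma K_center_psubset: "K_center \<subset> K"
  using nonabelian unfolding K_center_def by blast

lemma K_centerD: "\<lbrakk>z \<in> K_center; y \<in> K\<rbrakk> \<Longrightarrow> z \<otimes> y = y \<otimes> z"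
  unfolding K_center_def by blast

text \<open>The set \<open>V\<close> is the preimage of the elements of order dividing
  \<open>p\<close> in the center of K/Z(K). It is invariant and contains a noncentral element,
  whereas proper invariant subgroups are central; hence it is all of \<open>K\<close>.\<close>

lemma K_class2:
  assumes "x \<in> K"
  shows "x [^] p \<in> K_center" "y \<in> K \<Longrightarrow> x \<otimes> y \<otimes> inv x \<otimes> inv y \<in> K_center"
proof -
  note Zs = invariantD(1)[OF K_center_invariant]
  have ZK: "z \<in> K_center \<Longrightarrow> z \<in> K" for z using K_center_psubset by auto
  define V where "V = {x \<in> K. x [^] p \<in> K_center \<and> (\<forall>g\<in>K. x \<otimes> g \<otimes> inv x \<otimes> inv g \<in> K_center)}"
  have VK: "V \<subseteq> K" unfolding V_def by auto
  have "invariant V" unfolding invariant_def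
  proof (intro conjI ballI)
    show "subgroup V G"
    proof (rule finite_subgroupI)
      show "finite V" using VK finite_subgroup[OF K_subgroup] finite_subset by blast
      show "V \<noteq> {}" using subgroup.one_closed[OF K_subgroup] subgroup.one_closed[OF Zs] K_carrier
        by (auto simp: V_def intro!: exI[of _ \<one>])
      fix a b assume a: "a \<in> V" and b: "b \<in> V"
      then have aK: "a \<in> K" and bK: "b \<in> K" using VK by auto
      note abG = K_carrier[OF aK] K_carrier[OF bK]
      have "(a \<otimes> b) \<otimes> g \<otimes> inv (a \<otimes> b) \<otimes> inv g \<in> K_center" if g: "g \<in> K" for g
      proof -
        note gG = K_carrier[OF g]
        let ?c = "b \<otimes> g \<otimes> inv b \<otimes> inv g"
        have c: "?c \<in> K_center" using b g unfolding V_def by auto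
        then have cG: "?c \<in> carrier G" using ZK K_carrier by blast
        have "(a \<otimes> b) \<otimes> g \<otimes> inv (a \<otimes> b) \<otimes> inv g = (a \<otimes> ?c) \<otimes> (g \<otimes> inv a \<otimes> inv g)"
          using abG gG by (simp add: word_simps)
        also have "a \<otimes> ?c = ?c \<otimes> a" using K_centerD[OF c aK] by simp
        also have "?c \<otimes> a \<otimes> (g \<otimes> inv a \<otimes> inv g) = ?c \<otimes> (a \<otimes> g \<otimes> inv a \<otimes> inv g)"
          using abG gG cG by (simp add: m_assoc)
        finally show ?thesis using c a g subgroup.m_closed[OF Zs] unfolding V_def by auto
      qed
      moreover have "(a \<otimes> b) [^] p \<in> K_center"
      proof -
        let ?c = "b \<otimes> a \<otimes> inv b \<otimes> inv a"
        have c: "?c \<in> K_center" using b aK unfolding V_def by auto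
        then have cG: "?c \<in> carrier G" using ZK K_carrier by blast
        have "b \<otimes> a = ?c \<otimes> (a \<otimes> b)" using abG by (simp add: word_simps)
        also have "\<dots> = a \<otimes> b \<otimes> ?c"
          using K_centerD[OF c] subgroup.m_closed[OF K_subgroup aK bK] by blast
        finally have "(a \<otimes> b) [^] p = a [^] p \<otimes> b [^] p \<otimes> ?c [^] (p * (p - 1) div 2)"
          by (rule pow_mult_class2[OF abG cG]) (use K_centerD[OF c] aK bK in auto)
        then show ?thesis
          using a b subgroup_nat_pow_closed[OF Zs c] subgroup.m_closed[OF Zs] unfolding V_def by auto
      qed
      ultimately show "a \<otimes> b \<in> V" using subgroup.m_closed[OF K_subgroup aK bK] unfolding V_def by auto
    qed (use VK K_carrier in auto)
    fix \<alpha> x assume \<alpha>: "\<alpha> \<in> A" and x: "x \<in> V"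
    have xK: "x \<in> K" using x VK by auto
    have "\<alpha> x \<otimes> g \<otimes> inv (\<alpha> x) \<otimes> inv g \<in> K_center" if g: "g \<in> K" for g
    proof -
      obtain h where h: "h \<in> K" "\<alpha> h = g" using invariant_preimage[OF K_inv \<alpha> g] .
      then have "\<alpha> (x \<otimes> h \<otimes> inv x \<otimes> inv h) \<in> K_center"
        using x invariantD(2)[OF K_center_invariant \<alpha>] unfolding V_def by blast
      then show ?thesis using h \<alpha> xK K_carrier by (simp add: A_mult A_m_inv)
    qed
    moreover have "\<alpha> x [^] p \<in> K_center"
      using x xK \<alpha> K_carrier invariantD(2)[OF K_center_invariant \<alpha>] by (auto simp: V_def A_pow[symmetric])
    ultimately show "\<alpha> x \<in> V" using invariantD(2)[OF K_inv \<alpha> xK] unfolding V_def by auto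
  qed
  obtain z where z: "z \<in> K" "z \<notin> K_center" "z [^] p \<in> K_center"
    "\<And>g. g \<in> K \<Longrightarrow> z \<otimes> g \<otimes> inv z \<otimes> inv g \<in> K_center"
    using central_mod_between[OF Zs K_subgroup K_center_psubset]
      invariant_conj(1)[OF K_center_invariant] K_carrier by metis
  then have zV: "z \<in> V" unfolding V_def by auto
  have "V = K"
  proof (rule ccontr)
    assume "V \<noteq> K"
    then have "V \<subset> K" using VK by auto
    then have "z \<in> K_center"
      using proper_invariant_central[OF \<open>invariant V\<close> _ zV] z(1) unfolding K_center_def by blast
    then show False using z(2) by simp
  qed
  then show "x [^] p \<in> K_center" "y \<in> K \<Longrightarrow> x \<otimes> y \<otimes> inv x \<otimes> inv y \<in> K_center"
    using assms unfolding V_def by blast+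
qed

text \<open>Commutators have order dividing \<open>p\<close>, since p-th powers are central. The
  divisibility conditions thus make the q-th power map multiplicative with central values. They hold
  for \<open>q = p\<close> if \<open>p\<close> is odd, and for \<open>q = 4\<close> if
  \<open>p = 2\<close>.\<close>

lemma nonabelian_exponent:
  fixes q :: nat
  assumes q: "p dvd q" "p dvd q * (q - 1) div 2" and x: "x \<in> K"
  shows "x [^] q = \<one>"
proof (rule exponentI[OF _ _ x])
  have ZK: "z \<in> K_center \<Longrightarrow> z \<in> K" for z using K_center_psubset by auto
  show "(x \<otimes> y) [^] q = x [^] q \<otimes> y [^] q" if x: "x \<in> K" and y: "y \<in> K" for x y
  proof -
    note G = K_carrier[OF x] K_carrier[OF y]
    let ?c = "y \<otimes> x \<otimes> inv y \<otimes> inv x"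
    have c: "?c \<in> K_center" using K_class2(2)[OF y x] .
    then have cG: "?c \<in> carrier G" using ZK K_carrier by blast
    have yx: "y \<otimes> x = ?c \<otimes> (x \<otimes> y)" using G by (simp add: word_simps)
    also have "\<dots> = x \<otimes> y \<otimes> ?c"
      using K_centerD[OF c] subgroup.m_closed[OF K_subgroup x y] by blast
    finally have pow: "(x \<otimes> y) [^] q = x [^] q \<otimes> y [^] q \<otimes> ?c [^] (q * (q - 1) div 2)"
      by (rule pow_mult_class2[OF G cG]) (use K_centerD[OF c] x y in auto)
    have xp: "x [^] p \<otimes> y = y \<otimes> x [^] p" using K_centerD[OF K_class2(1)[OF x] y] .
    \<comment> \<open>The p-th power of the commutator is the commutator of \<open>y\<close> with
      the central element \<open>x [^] p\<close>, seen by raising a conjugate of \<open>x\<close> to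
      the p-th power in two ways.\<close>
    have "?c [^] p \<otimes> x [^] p = (?c \<otimes> x) [^] p"
      using pow_mult_distrib[OF K_centerD[OF c x] cG G(1)] by simp
    also have "?c \<otimes> x = y \<otimes> x \<otimes> inv y" using G by (simp add: word_simps)
    also have "(y \<otimes> x \<otimes> inv y) [^] n = y \<otimes> x [^] n \<otimes> inv y" for n :: nat
      using G by (induction n) (auto simp: word_simps)
    also have "y \<otimes> x [^] p \<otimes> inv y = x [^] p" using G xp[symmetric] by (simp add: m_assoc)
    finally have "?c [^] p = \<one>" using cG G by (simp add: l_cancel_one)
    then have "?c [^] (q * (q - 1) div 2) = \<one>" using q(2) cG by (metis dvdE nat_pow_one nat_pow_pow)
    then show ?thesis using pow G by simp
  qed
  show "r (x [^] q) = x [^] q" if r: "r \<in> coprime_kernel" and x: "x \<in> K" for r x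
  proof -
    obtain k where "q = p * k" using q(1) by blast
    then have "x [^] q \<in> K_center"
      using subgroup_nat_pow_closed[OF invariantD(1)[OF K_center_invariant] K_class2(1)[OF x]]
        K_carrier[OF x] by (metis nat_pow_pow)
    then show ?thesis using K_min[OF K_center_invariant K_center_psubset r] by blast
  qed
qed

end

end

section \<open>Triviality of the coprime kernel\<close>

context automorphism_family
begin

lemma invariant_reflect:
  assumes "invariant U" "\<alpha> \<in> A" "x \<in> carrier G" "\<alpha> x \<in> U"
  shows "x \<in> U"
proof -
  obtain z where z: "z \<in> U" "\<alpha> z = \<alpha> x" using invariant_preimage[OF assms(1,2,4)] .
  then have "z \<in> carrier G" using invariantD(1)[OF assms(1)] subgroup.mem_carrier by metis
  then show ?thesis using A_eq_iff[OF assms(2)] z assms(3) by blast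
qed

text \<open>The hypotheses are those on the fusion system, seen inside one group: invariance under
  \<open>A\<close> replaces semi-invariance, and in \<open>four\<close> the pair \<open>a\<close>,
  \<open>b\<close> witnesses that the group is not abelian.\<close>

theorem coprime_kernel_trivial:
  assumes d: "1 \<le> d" and size: "p ^ Suc d \<le> order G"
    and inv: "\<And>H. \<lbrakk>subgroup H G; card H = p ^ d\<rbrakk> \<Longrightarrow> invariant H"
    and abel: "\<And>T x y. \<lbrakk>subgroup T G; card T = p ^ Suc d; x \<in> T; y \<in> T\<rbrakk> \<Longrightarrow> x \<otimes> y = y \<otimes> x"
    and four: "\<And>a b x. \<lbrakk>p = 2; d = 1; a \<in> carrier G; b \<in> carrier G; a \<otimes> b \<noteq> b \<otimes> a;
      x \<in> carrier G; ord x = 4\<rbrakk> \<Longrightarrow> invariant (generate G {x})"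
    and r: "r \<in> coprime_kernel" and x: "x \<in> carrier G"
  shows "r x = x"
proof (rule ccontr)
  assume moved: "r x \<noteq> x"
  let ?P = "\<lambda>U. invariant U \<and> (\<exists>r\<in>coprime_kernel. \<exists>x\<in>U. r x \<noteq> x)"
  have "?P (carrier G)" using invariant_carrier r x moved by blast
  then obtain K where K: "?P K" "\<And>U. ?P U \<Longrightarrow> card K \<le> card U"
    using ex_has_least_nat[of ?P "carrier G" card] by blast
  have Kmin: "s y = y" if "invariant U" "U \<subset> K" "s \<in> coprime_kernel" "y \<in> U" for U s y
  proof -
    have "finite K" using K(1) finite_subgroup invariantD by blast
    then have "card U < card K" using that(2) by (rule psubset_card_mono)
    then have "\<not> ?P U" using K(2)[of U] by (metis not_le)
    then show ?thesis using that by blast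
  qed
  interpret minimal_moved G p A K using K(1) Kmin by unfold_locales blast+
  \<comment> \<open>The coprime kernel fixes every proper invariant subgroup of \<open>K\<close>
    pointwise but moves some element of \<open>K\<close>, so these subgroups cannot cover
    \<open>K\<close>.\<close>
  have not_covered: "\<not> (\<forall>y\<in>K. \<exists>U. invariant U \<and> U \<subset> K \<and> y \<in> U)"
    using Kmin K_moved by blast
  obtain i where i: "card K = p ^ i" using card_subgroup_prime_power[OF K_subgroup] .
  have finK: "finite K" using K_subgroup by (rule finite_subgroup)
  have pd: "p \<le> p ^ d" using d p_gt_1 self_le_power[of p d] by simp
  show False
  proof (cases "p ^ Suc d \<le> card K")
    case large: True
    \<comment> \<open>A cyclic group of order at most \<open>p ^ d\<close> can be enlarged inside
      \<open>K\<close> to order exactly \<open>p ^ d\<close>; the result is invariant by hypothesis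
      and proper because \<open>K\<close> is larger.\<close>
    have small: "\<exists>U. invariant U \<and> U \<subset> K \<and> y \<in> U" if y: "y \<in> K" "ord y \<le> p ^ d" for y
    proof -
      have gs: "subgroup (generate G {y}) G" using K_carrier[OF y(1)] by (simp add: generate_is_subgroup)
      have gK: "generate G {y} \<subseteq> K" using y(1) K_subgroup by (simp add: generate_subgroup_incl)
      have "p ^ d \<le> card K" using large p_gt_1 by (meson le_trans lessI less_imp_le_nat power_increasing_iff)
      then obtain H where H: "subgroup H G" "generate G {y} \<subseteq> H" "H \<subseteq> K" "card H = p ^ d"
        using exists_subgroup_between[OF gs K_subgroup gK] generate_pow_card[OF K_carrier[OF y(1)]] y(2) by metis
      have "H \<noteq> K" using H(4) large p_gt_1 by auto
      then show ?thesis using inv[OF H(1,4)] H(2,3) generate.incl[of y "{y}"] by blast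
    qed
    have ord_le: "ord y \<le> n" if "y \<in> K" "y [^] n = \<one>" "0 < n" for y and n :: nat
      using pow_eq_id[OF K_carrier[OF that(1)]] that(2,3) dvd_imp_le by blast
    have "\<exists>U. invariant U \<and> U \<subset> K \<and> y \<in> U" if y: "y \<in> K" for y
    proof (cases "\<exists>a\<in>K. \<exists>b\<in>K. a \<otimes> b \<noteq> b \<otimes> a")
      case False
      then have "y [^] p = \<one>" using abelian_exponent[OF _ y] by blast
      then have "ord y \<le> p ^ d" using ord_le[OF y] pd p_gt_1 by force
      then show ?thesis by (rule small[OF y])
    next
      case nonab: True
      show ?thesis
      proof (cases "p = 2")
        case False
        \<comment> \<open>For odd \<open>p\<close> the exponent \<open>p\<close> itself is
          admissible, because p - 1 is even.\<close>
        then have "odd p" using prime_p primes_dvd_imp_eq two_is_prime_nat by blast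
        then obtain k where "p = 2 * k + 1" by (rule oddE)
        then have "p - 1 = 2 * k" by presburger
        then have "p * (p - 1) = 2 * (p * k)" by (simp only: mult.left_commute)
        then have "p dvd p * (p - 1) div 2" by (metis dvd_triv_left nonzero_mult_div_cancel_left zero_neq_numeral)
        then have "y [^] p = \<one>" by (rule nonabelian_exponent[OF nonab dvd_refl _ y])
        then have "ord y \<le> p ^ d" using ord_le[OF y] pd p_gt_1 by force
        then show ?thesis by (rule small[OF y])
      next
        case p2: True
        have y4: "y [^] (4::nat) = \<one>" using nonabelian_exponent[OF nonab _ _ y, of 4] p2 by simp
        show ?thesis
        proof (cases "ord y \<le> p ^ d")
          case True then show ?thesis by (rule small[OF y])
        next
          case False
          \<comment> \<open>An element of exponent 4 whose order exceeds \<open>2 ^ d\<close> has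
            order 4, and \<open>d = 1\<close>: precisely the situation of
            \<open>four\<close>.\<close>
          have "ord y dvd 2 ^ 2" using y4 pow_eq_id[OF K_carrier[OF y]] by simp
          then obtain j where j: "j \<le> 2" "ord y = 2 ^ j" using divides_primepow_nat[of 2 "ord y" 2] by auto
          then have "j = 2" "d = 1" using False p2 d
            by (auto simp: not_le power_strict_increasing_iff)
          then have o: "ord y = 4" using j by simp
          obtain a b where ab: "a \<in> K" "b \<in> K" "a \<otimes> b \<noteq> b \<otimes> a" using nonab by blast
          have "invariant (generate G {y})"
            using four[OF p2 \<open>d = 1\<close> K_carrier[OF ab(1)] K_carrier[OF ab(2)] ab(3) K_carrier[OF y] o] .
          moreover have "generate G {y} \<subseteq> K" using y K_subgroup by (simp add: generate_subgroup_incl)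
          \<comment> \<open>The subgroup generated by \<open>y\<close> has order 4 =
            \<open>p ^ Suc d\<close>. Subgroups of that order are abelian, so it is proper in the
            nonabelian \<open>K\<close>.\<close>
          moreover have "card K \<noteq> p ^ Suc d" using abel[OF K_subgroup _ ab(1,2)] ab(3) by blast
          then have "generate G {y} \<noteq> K"
            using generate_pow_card[OF K_carrier[OF y]] o p2 \<open>d = 1\<close> by auto
          ultimately show ?thesis using generate.incl[of y "{y}"] by blast
        qed
      qed
    qed
    then show False using not_covered by blast
  next
    case False
    \<comment> \<open>Now \<open>K\<close> has order at most \<open>p ^ d\<close> and embeds into an
      abelian \<open>T\<close> of order \<open>p ^ Suc d\<close>; in particular it is abelian of
      exponent \<open>p\<close>.\<close>
    obtain T where T: "subgroup T G" "K \<subseteq> T" "T \<subseteq> carrier G" "card T = p ^ Suc d"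
      using exists_subgroup_between[OF K_subgroup subgroup_self _ _ size[unfolded order_def]] False
        K_carrier by (metis nat_le_linear subsetI)
    have TG: "t \<in> T \<Longrightarrow> t \<in> carrier G" for t using T(3) by auto
    note Tab = abel[OF T(1,4)]
    have Kp: "k [^] p = \<one>" if "k \<in> K" for k using abelian_exponent[OF _ that] Tab T(2) by blast
    obtain s k where s: "s \<in> coprime_kernel" and k: "k \<in> K" "s k \<noteq> k" using K_moved by blast
    have sA: "s \<in> A" and sB: "s \<in> section_kernel"
      using s coprime_kernel_A unfolding coprime_kernel_def by auto
    have "i \<noteq> 0"
    proof
      assume "i = 0"
      then have "K = {\<one>}" using i subgroup.one_closed[OF K_subgroup] by (metis card_1_singletonE power_0 singletonD)
      then show False using k A_one[OF sA] by simp
    qed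
    \<comment> \<open>If \<open>K\<close> had order \<open>p\<close>, it would itself be an
      invariant section of order \<open>p\<close> over the trivial group, on which \<open>s\<close>
      acts trivially.\<close>
    moreover have "i \<noteq> 1"
    proof
      assume "i = 1"
      then have "s k \<otimes> inv k \<in> {\<one>}"
        using section_kernelD[OF sB invariant_trivial K_inv _ _ k(1)] i subgroup.one_closed[OF K_subgroup] by simp
      then have "s k = k" using K_carrier[OF k(1)] sA by (metis A_closed inv_closed inv_inv inv_equality singletonD)
      then show False using k(2) by simp
    qed
    ultimately have "2 \<le> i" by simp
    define C where "C = {t \<in> T. s t = t}"
    have C: "subgroup C G"
    proof (rule finite_subgroupI)
      show "finite C" using finite_subgroup[OF T(1)] by (simp add: C_def)
      show "C \<noteq> {}" using subgroup.one_closed[OF T(1)] A_one[OF sA] by (auto simp: C_def)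
    qed (use TG A_mult[OF sA] subgroup.m_closed[OF T(1)] in \<open>auto simp: C_def\<close>)
    have CT: "C \<subset> T" using k T(2) by (auto simp: C_def)
    obtain c where c: "card C = p ^ c" using card_subgroup_prime_power[OF C] .
    have "card C < p ^ Suc d" using psubset_card_mono[OF finite_subgroup[OF T(1)] CT] T(4) by simp
    then have "c \<le> d" unfolding c using p_gt_1 by (metis less_Suc_eq_le power_less_imp_less_exp)
    then have "card C \<le> p ^ d" unfolding c using p_gt_1 by (simp add: power_increasing_iff)
    moreover have "p ^ d \<le> card T" using T(4) p_gt_1 by simp
    \<comment> \<open>This is the maximal subgroup called \<open>N\<close> in the overview, chosen
      to contain all fixed points \<open>C\<close> of \<open>s\<close> in \<open>T\<close>.\<close>
    ultimately obtain M where M: "subgroup M G" "C \<subseteq> M" "M \<subseteq> T" "card M = p ^ d"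
      using exists_subgroup_between[OF C T(1)] CT by (metis psubsetE)
    have Minv: "invariant M" using inv M by blast
    have cardT: "card T = p * card M" using T(4) M(4) by simp
    have "M \<noteq> T" using cardT M(4) p_gt_1 T(4) by auto
    then obtain y where y: "y \<in> T" "y \<notin> M" using M(3) by blast
    note yG = TG[OF y(1)]
    let ?Y = "generate G {y}"
    have Ys: "subgroup ?Y G" using yG by (simp add: generate_is_subgroup)
    have YT: "?Y \<subseteq> T" using y(1) T(1) by (simp add: generate_subgroup_incl)
    \<comment> \<open>If \<open>T\<close> were cyclic, it would have only \<open>p\<close> elements
      annihilated by \<open>p\<close>, the powers of \<open>?z\<close>, but \<open>K\<close>
      supplies at least p^2 of them.\<close>
    have "?Y \<noteq> T"
    proof
      assume eq: "?Y = T"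
      then have o: "ord y = p ^ Suc d" using generate_pow_card[OF yG] T(4) by simp
      let ?z = "y [^] (p ^ d)"
      have zp: "?z [^] p = \<one>" using yG o pow_ord_eq_1[OF yG] by (simp add: nat_pow_pow mult.commute)
      have "K \<subseteq> (\<lambda>j. ?z [^] (j::nat)) ` {..<p}"
      proof
        fix a assume a: "a \<in> K"
        have "ord y \<noteq> 0" using o p_gt_1 by simp
        then obtain n where n: "a = y [^] (n::nat)" using a T(2) eq generate_pow_nat[OF yG] by auto
        have "y [^] (n * p) = \<one>" using Kp[OF a] n yG by (simp add: nat_pow_pow)
        then have "p ^ d * p dvd n * p" using pow_eq_id[OF yG] o by (simp add: mult.commute)
        then have "p ^ d dvd n" using p_gt_1 by simp
        then obtain j where j: "n = p ^ d * j" by blast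
        have "a = ?z [^] j" using n j yG by (simp add: nat_pow_pow)
        also have "?z [^] j = ?z [^] (p * (j div p) + j mod p)" by simp
        also have "\<dots> = (?z [^] p) [^] (j div p) \<otimes> ?z [^] (j mod p)"
          using nat_pow_closed[OF yG, of "p ^ d"] by (simp only: nat_pow_mult nat_pow_pow nat_pow_closed)
        also have "\<dots> = ?z [^] (j mod p)" using zp yG by simp
        finally show "a \<in> (\<lambda>j. ?z [^] (j::nat)) ` {..<p}" using p_gt_1 by auto
      qed
      then have "card K \<le> p" by (metis card_image_le card_lessThan card_mono finite_imageI finite_lessThan le_trans)
      moreover have "p ^ 1 < p ^ i" using \<open>2 \<le> i\<close> p_gt_1 by (intro power_strict_increasing) auto
      ultimately show False using i by simp
    qed
    then have "?Y \<subset> T" using YT by auto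
    obtain c' where c': "card ?Y = p ^ c'" using card_subgroup_prime_power[OF Ys] .
    have "card ?Y < p ^ Suc d" using psubset_card_mono[OF finite_subgroup[OF T(1)] \<open>?Y \<subset> T\<close>] T(4) by simp
    then have "c' \<le> d" unfolding c' using p_gt_1 by (metis less_Suc_eq_le power_less_imp_less_exp)
    then have "card ?Y \<le> p ^ d" unfolding c' using p_gt_1 by (simp add: power_increasing_iff)
    then obtain M' where M': "subgroup M' G" "?Y \<subseteq> M'" "M' \<subseteq> T" "card M' = p ^ d"
      using exists_subgroup_between[OF Ys T(1) YT] \<open>p ^ d \<le> card T\<close> by metis
    \<comment> \<open>Both \<open>M\<close> and a subgroup \<open>M'\<close> of the same order
      containing \<open>y\<close> are invariant, and together they generate \<open>T\<close>, since
      \<open>M\<close> has prime index.\<close>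
    have "invariant T" unfolding invariant_def
    proof (intro conjI T(1) ballI)
      fix \<alpha> t assume \<alpha>: "\<alpha> \<in> A" and t: "t \<in> T"
      let ?V = "{x \<in> T. \<alpha> x \<in> T}"
      have V: "subgroup ?V G" by (rule A_preimage_subgroup[OF \<alpha> T(1) T(1)])
      have "M \<subseteq> ?V" using M(3) invariantD(2)[OF Minv \<alpha>] by auto
      moreover have "y \<in> ?V"
        using M' invariantD(2)[OF inv[OF M'(1,4)] \<alpha>] generate.incl[of y "{y}" G] y(1) by blast
      ultimately have "?V = T" using prime_index_eq[OF M(1) V T(1) _ _ cardT] y(2) by blast
      then show "\<alpha> t \<in> T" using t by auto
    qed
    then have sec: "s t \<otimes> inv t \<in> M" if "t \<in> T" for t
      using section_kernelD[OF sB Minv _ M(3) cardT that] by blast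
    have sT: "(s ^^ n) y \<in> T" for n
      by (induction n) (use y(1) invariantD(2)[OF \<open>invariant T\<close> sA] in auto)
    have step: "(s ^^ n) y \<otimes> inv y \<in> M" for n
    proof (induction n)
      case 0 then show ?case using yG subgroup.one_closed[OF M(1)] by simp
    next
      case (Suc n)
      have "(s ^^ Suc n) y \<otimes> inv y = (s ((s ^^ n) y) \<otimes> inv ((s ^^ n) y)) \<otimes> ((s ^^ n) y \<otimes> inv y)"
        using TG[OF sT[of n]] yG sA by (simp add: word_simps)
      then show ?case using sec[OF sT[of n]] Suc subgroup.m_closed[OF M(1)] by metis
    qed
    \<comment> \<open>The element \<open>a\<close> is the partial norm, the product of the iterates
      of \<open>s\<close> at \<open>y\<close> with indices 0 to n - 1. It is congruent to
      \<open>y [^] n\<close> modulo \<open>M\<close>, since \<open>s\<close> is trivial on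
      T/M.\<close>
    have norm: "\<exists>a\<in>T. y \<otimes> s a = a \<otimes> (s ^^ n) y \<and> a \<otimes> inv (y [^] n) \<in> M" for n
    proof (induction n)
      case 0
      show ?case using yG A_one[OF sA] subgroup.one_closed[OF T(1)] subgroup.one_closed[OF M(1)]
        by (intro bexI[of _ \<one>]) auto
    next
      case (Suc n)
      then obtain a where a: "a \<in> T" "y \<otimes> s a = a \<otimes> (s ^^ n) y" "a \<otimes> inv (y [^] n) \<in> M" by blast
      let ?y = "(s ^^ n) y"
      note G = TG[OF a(1)] TG[OF sT[of n]] yG
      have "y \<otimes> s (a \<otimes> ?y) = y \<otimes> s a \<otimes> s ?y" using G sA by (simp add: A_mult m_assoc)
      then have 1: "y \<otimes> s (a \<otimes> ?y) = a \<otimes> ?y \<otimes> (s ^^ Suc n) y" unfolding a(2) by simp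
      have "a \<otimes> ?y \<otimes> inv (y [^] Suc n) = a \<otimes> (?y \<otimes> inv y) \<otimes> inv (y [^] n)"
        using G by (simp add: word_simps)
      also have "a \<otimes> (?y \<otimes> inv y) = (?y \<otimes> inv y) \<otimes> a"
        using Tab[OF a(1)] step[of n] M(3) by blast
      also have "?y \<otimes> inv y \<otimes> a \<otimes> inv (y [^] n) = ?y \<otimes> inv y \<otimes> (a \<otimes> inv (y [^] n))"
        using G by (simp add: m_assoc)
      finally have "a \<otimes> ?y \<otimes> inv (y [^] Suc n) \<in> M"
        using step[of n] a(3) subgroup.m_closed[OF M(1)] by metis
      then show ?case using 1 subgroup.m_closed[OF T(1) a(1) sT[of n]] by blast
    qed
    obtain m where m: "coprime m p" "\<And>x. x \<in> carrier G \<Longrightarrow> (s ^^ m) x = x"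
      using s unfolding coprime_kernel_def by blast
    obtain a where a: "a \<in> T" "y \<otimes> s a = a \<otimes> (s ^^ m) y" "a \<otimes> inv (y [^] m) \<in> M"
      using norm by blast
    \<comment> \<open>For \<open>n = m\<close> the norm is fixed by \<open>s\<close> because
      \<open>T\<close> is abelian. So it lies in \<open>C\<close> and hence in \<open>M\<close>,
      which forces \<open>y [^] m\<close>, and then \<open>y\<close>, into \<open>M\<close>.\<close>
    have "y \<otimes> s a = y \<otimes> a" using a(2) m(2)[OF yG] Tab[OF a(1) y(1)] by simp
    then have "s a = a" using yG TG[OF a(1)] sA by simp
    then have "a \<in> M" using a(1) M(2) by (auto simp: C_def)
    moreover have "y [^] m = inv (a \<otimes> inv (y [^] m)) \<otimes> a"
      using yG TG[OF a(1)] by (simp add: word_simps)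
    ultimately have "y [^] m \<in> M"
      using a(3) subgroup.m_closed[OF M(1)] subgroup.m_inv_closed[OF M(1)] by metis
    then show False using pow_coprime_mem[OF M(1) yG _ m(1)] y(2) by blast
  qed
qed

section \<open>Congruence modulo an invariant subgroup and characters on sections of order p\<close>

definition eqm :: "'a set \<Rightarrow> 'a \<Rightarrow> 'a \<Rightarrow> bool" where
  "eqm U g h \<longleftrightarrow> g \<in> carrier G \<and> h \<in> carrier G \<and> g \<otimes> inv h \<in> U"

lemma eqmD: "eqm U g h \<Longrightarrow> g \<in> carrier G" "eqm U g h \<Longrightarrow> h \<in> carrier G" "eqm U g h \<Longrightarrow> g \<otimes> inv h \<in> U"
  by (auto simp: eqm_def)

context
  fixes U assumes U: "invariant U"
begin

lemma eqm_refl: "g \<in> carrier G \<Longrightarrow> eqm U g g"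
  using subgroup.one_closed[OF invariantD(1)[OF U]] by (auto simp: eqm_def)

lemma eqm_sym:
  assumes "eqm U g h" shows "eqm U h g"
proof -
  have "h \<otimes> inv g = inv (g \<otimes> inv h)" using assms by (simp add: eqm_def inv_mult_group)
  then show ?thesis using assms subgroup.m_inv_closed[OF invariantD(1)[OF U]] by (simp add: eqm_def)
qed

lemma eqm_trans [trans]:
  assumes "eqm U g h" "eqm U h k" shows "eqm U g k"
proof -
  have "g \<otimes> inv k = (g \<otimes> inv h) \<otimes> (h \<otimes> inv k)" using assms by (simp add: eqm_def word_simps)
  then show ?thesis using assms subgroup.m_closed[OF invariantD(1)[OF U]] by (simp add: eqm_def)
qed

lemma eqm_mult:
  assumes "eqm U a b" "eqm U c d" shows "eqm U (a \<otimes> c) (b \<otimes> d)"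
proof -
  note G = eqmD(1,2)[OF assms(1)] eqmD(1,2)[OF assms(2)]
  have "(a \<otimes> c) \<otimes> inv (b \<otimes> d) = (a \<otimes> (c \<otimes> inv d) \<otimes> inv a) \<otimes> (a \<otimes> inv b)"
    using G by (simp add: word_simps)
  moreover have "a \<otimes> (c \<otimes> inv d) \<otimes> inv a \<in> U"
    using invariant_conj(1)[OF U eqmD(3)[OF assms(2)] G(1)] .
  ultimately show ?thesis
    using G eqmD(3)[OF assms(1)] subgroup.m_closed[OF invariantD(1)[OF U]] by (simp add: eqm_def)
qed

lemma eqm_pow: "eqm U a b \<Longrightarrow> eqm U (a [^] (n::nat)) (b [^] n)"
  by (induction n) (auto simp: eqm_refl intro: eqm_mult)

lemma eqm_image: "\<lbrakk>\<alpha> \<in> A; eqm U a b\<rbrakk> \<Longrightarrow> eqm U (\<alpha> a) (\<alpha> b)"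
  using invariantD(2)[OF U, of \<alpha> "a \<otimes> inv b"] by (auto simp: eqm_def A_mult A_m_inv)

lemma eqm_mem: "\<lbrakk>eqm U a b; b \<in> U\<rbrakk> \<Longrightarrow> a \<in> U"
proof -
  assume ab: "eqm U a b" and b: "b \<in> U"
  have "a = (a \<otimes> inv b) \<otimes> b" using ab by (simp add: eqm_def m_assoc)
  then show "a \<in> U" using ab b subgroup.m_closed[OF invariantD(1)[OF U]] by (metis eqmD(3))
qed

lemma eqm_one: "a \<in> U \<Longrightarrow> eqm U a \<one>"
  using subgroup.mem_carrier[OF invariantD(1)[OF U]] by (auto simp: eqm_def)

lemma eqm_pow_cong:
  fixes m n :: nat
  assumes y: "y \<in> carrier G" "y [^] p \<in> U" and mn: "[m = n] (mod p)"
  shows "eqm U (y [^] m) (y [^] n)"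
proof -
  have aux: "eqm U (y [^] k) (y [^] (k mod p))" for k
  proof -
    have "eqm U ((y [^] p) [^] (k div p) \<otimes> y [^] (k mod p)) (\<one> [^] (k div p) \<otimes> y [^] (k mod p))"
      using y eqm_one by (intro eqm_mult eqm_pow eqm_refl) auto
    moreover have "(y [^] p) [^] (k div p) \<otimes> y [^] (k mod p) = y [^] k"
      using y(1) by (simp add: nat_pow_mult nat_pow_pow)
    ultimately show ?thesis using y(1) by simp
  qed
  show ?thesis using aux[of m] aux[of n] mn eqm_sym eqm_trans unfolding cong_def by metis
qed

text \<open>The elements of \<open>Y\<close> fixed modulo \<open>U\<close> form a subgroup
  containing \<open>U\<close> and \<open>y\<close>; as the index is prime, it is all of
  \<open>Y\<close>. Triviality on a section can thus be tested at one element outside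
  \<open>U\<close>.\<close>

lemma section_trivialI:
  assumes Y: "invariant Y" "U \<subseteq> Y" "card Y = p * card U"
    and \<gamma>: "\<gamma> \<in> A" and y: "y \<in> Y" "y \<notin> U" and eq: "eqm U (\<gamma> y) y" and w: "w \<in> Y"
  shows "\<gamma> w \<otimes> inv w \<in> U"
proof -
  have YG: "v \<in> Y \<Longrightarrow> v \<in> carrier G" for v using subgroup.mem_carrier[OF invariantD(1)[OF Y(1)]] .
  let ?V = "{w \<in> Y. eqm U (\<gamma> w) w}"
  have V: "subgroup ?V G"
  proof (rule finite_subgroupI)
    show "finite ?V" using finite_subgroup[OF invariantD(1)[OF Y(1)]] by simp
    show "?V \<noteq> {}" using y(1) eq by blast
  qed (use YG A_mult[OF \<gamma>] eqm_mult subgroup.m_closed[OF invariantD(1)[OF Y(1)]] in auto)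
  have "eqm U (\<gamma> u) u" if "u \<in> U" for u
    using eqm_trans[OF eqm_one[OF invariantD(2)[OF U \<gamma> that]] eqm_sym[OF eqm_one[OF that]]] .
  then have "U \<subseteq> ?V" using Y(2) by blast
  then have "?V = Y"
    using prime_index_eq[OF invariantD(1)[OF U] V invariantD(1)[OF Y(1)] _ _ Y(3)] y eq by blast
  then show ?thesis using w eqmD(3) by blast
qed

text \<open>Provides a generator \<open>y\<close> of Y/U, so that each member of \<open>A\<close>
  acts on the section as raising to some power \<open>k\<close>, the value of the associated
  character.\<close>

lemma section_power:
  assumes Y: "invariant Y" "U \<subseteq> Y" "card Y = p * card U"
  obtains y where "y \<in> Y" "y \<notin> U" "y [^] p \<in> U" "\<And>w. w \<in> Y \<Longrightarrow> \<exists>k::nat. eqm U w (y [^] k)"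
proof -
  note sU = invariantD(1)[OF U] and sY = invariantD(1)[OF Y(1)]
  have "card U > 0" using finite_subgroup[OF sU] subgroup.one_closed[OF sU] card_gt_0_iff by blast
  then have "U \<noteq> Y" using Y(3) p_gt_1 by auto
  then have "U \<subset> Y" using Y(2) by auto
  then obtain y where y: "y \<in> Y" "y \<notin> U" "y [^] p \<in> U" "\<And>u. u \<in> U \<Longrightarrow> y \<otimes> u \<otimes> inv y \<in> U"
    using exists_normalizing_between[OF sU sY] by blast
  define Z where "Z = {u \<otimes> y [^] (i::nat) | u i. u \<in> U}"
  have yG: "y \<in> carrier G" using y(1) subgroup.mem_carrier[OF sY] by auto
  note Z = adjoin_subgroup[OF sU yG y(2,3,4), folded Z_def]
  have "Z \<subseteq> Y" unfolding Z_def
    using Y(2) y(1) subgroup.m_closed[OF sY] subgroup_nat_pow_closed[OF sY] by blast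
  then have "Z = Y" using prime_index_eq[OF sU Z(1) sY _ _ Y(3)] Z(3,4) y(2) by blast
  moreover have "\<exists>k::nat. eqm U w (y [^] k)" if "w \<in> Z" for w
  proof -
    obtain u i where w: "w = u \<otimes> y [^] (i::nat)" "u \<in> U" using \<open>w \<in> Z\<close> unfolding Z_def by auto
    have "eqm U (u \<otimes> y [^] i) (\<one> \<otimes> y [^] i)" using yG by (intro eqm_mult eqm_one eqm_refl w(2)) auto
    then show ?thesis using w(1) yG by auto
  qed
  ultimately show thesis using that y(1,2,3) by blast
qed

lemma eqm_funpow:
  assumes \<alpha>: "\<alpha> \<in> A" and y: "y \<in> carrier G" and k: "eqm U (\<alpha> y) (y [^] (k::nat))"
  shows "eqm U ((\<alpha> ^^ n) y) (y [^] (k ^ n))"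
proof (induction n)
  case 0 then show ?case using y eqm_refl by simp
next
  case (Suc n)
  have "eqm U (\<alpha> ((\<alpha> ^^ n) y)) (\<alpha> (y [^] (k ^ n)))" using eqm_image[OF \<alpha> Suc] .
  also have "\<alpha> (y [^] (k ^ n)) = \<alpha> y [^] (k ^ n)" using A_pow[OF \<alpha> y] .
  also have "eqm U (\<alpha> y [^] (k ^ n)) ((y [^] k) [^] (k ^ n))" using eqm_pow[OF k] .
  finally show ?case using y by (simp add: nat_pow_pow)
qed

end

text \<open>If \<beta> acts on a section with eigenvalue \<open>k\<close>, its iterate of order
  \<open>p ^ e\<close>, the identity, acts with k^(p^e), which is congruent to \<open>k\<close> by
  Fermat. Hence \<beta> acts trivially too.\<close>

lemma p_element_section_kernel:
  assumes \<beta>: "\<beta> \<in> A" and pow: "\<And>x. x \<in> carrier G \<Longrightarrow> (\<beta> ^^ (p ^ e)) x = x"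
  shows "\<beta> \<in> section_kernel"
  unfolding section_kernel_def
proof (intro CollectI conjI \<beta> allI impI ballI; elim conjE)
  fix U Y w assume U: "invariant U" and Y: "invariant Y" "U \<subseteq> Y" "card Y = p * card U" and w: "w \<in> Y"
  obtain y where y: "y \<in> Y" "y \<notin> U" "y [^] p \<in> U" "\<And>w. w \<in> Y \<Longrightarrow> \<exists>k::nat. eqm U w (y [^] k)"
    using section_power[OF U Y] by blast
  have yG: "y \<in> carrier G" using y(1) subgroup.mem_carrier[OF invariantD(1)[OF Y(1)]] by auto
  obtain k where k: "eqm U (\<beta> y) (y [^] (k::nat))" using y(4) invariantD(2)[OF Y(1) \<beta> y(1)] by blast
  have "[k ^ (p ^ n) = k] (mod p)" for n
  proof (induction n)
    case 0 then show ?case by simp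
  next
    case (Suc n)
    have "[(k ^ (p ^ n)) ^ p = k ^ p] (mod p)" using Suc by (rule cong_pow)
    then show ?case using prime_pow_cong[OF prime_p] cong_trans by (metis power_Suc2 power_mult)
  qed
  then have "eqm U (y [^] (k ^ (p ^ e))) (y [^] k)" using eqm_pow_cong[OF U yG y(3)] by blast
  then have "eqm U y (\<beta> y)"
    using eqm_funpow[OF U \<beta> yG k, of "p ^ e"] pow[OF yG] eqm_trans[OF U] eqm_sym[OF U k] by metis
  then show "\<beta> w \<otimes> inv w \<in> U" using section_trivialI[OF U Y \<beta> y(1,2) eqm_sym[OF U] w] by blast
qed

text \<open>Characters have commuting values. The commutator \<gamma> is given by an equation
  without inverses, and its triviality is tested at \<alpha>(\<beta>(y)), which still lies outside
  \<open>U\<close>.\<close>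

lemma commutator_section_kernel:
  assumes \<alpha>: "\<alpha> \<in> A" and \<beta>: "\<beta> \<in> A" and \<gamma>: "\<gamma> \<in> A"
    and eq: "\<And>x. x \<in> carrier G \<Longrightarrow> \<gamma> (\<alpha> (\<beta> x)) = \<beta> (\<alpha> x)"
  shows "\<gamma> \<in> section_kernel"
  unfolding section_kernel_def
proof (intro CollectI conjI \<gamma> allI impI ballI; elim conjE)
  fix U Y w assume U: "invariant U" and Y: "invariant Y" "U \<subseteq> Y" "card Y = p * card U" and w: "w \<in> Y"
  obtain y where y: "y \<in> Y" "y \<notin> U" "y [^] p \<in> U" "\<And>w. w \<in> Y \<Longrightarrow> \<exists>k::nat. eqm U w (y [^] k)"
    using section_power[OF U Y] by blast
  have yG: "y \<in> carrier G" using y(1) subgroup.mem_carrier[OF invariantD(1)[OF Y(1)]] by auto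
  have comp: "eqm U (\<sigma> (\<tau> y)) (y [^] (k * l))"
    if "\<sigma> \<in> A" "eqm U (\<sigma> y) (y [^] (k::nat))" "eqm U (\<tau> y) (y [^] (l::nat))" for \<sigma> \<tau> k l
  proof -
    have "eqm U (\<sigma> (\<tau> y)) (\<sigma> (y [^] l))" using eqm_image[OF U that(1,3)] .
    then have "eqm U (\<sigma> (\<tau> y)) (\<sigma> y [^] l)" using A_pow[OF that(1) yG] by simp
    also have "eqm U (\<sigma> y [^] l) ((y [^] k) [^] l)" using eqm_pow[OF U that(2)] .
    finally (eqm_trans[OF U]) show ?thesis using yG by (simp add: nat_pow_pow)
  qed
  obtain k l where k: "eqm U (\<alpha> y) (y [^] (k::nat))" and l: "eqm U (\<beta> y) (y [^] (l::nat))"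
    using y(4) invariantD(2)[OF Y(1) \<alpha> y(1)] invariantD(2)[OF Y(1) \<beta> y(1)] by blast
  have "eqm U (\<beta> (\<alpha> y)) (\<alpha> (\<beta> y))"
    using eqm_trans[OF U comp[of \<beta> l \<alpha> k, OF \<beta> l k] eqm_sym[OF U]] comp[of \<alpha> k \<beta> l, OF \<alpha> k l]
    by (simp add: mult.commute)
  then have *: "eqm U (\<gamma> (\<alpha> (\<beta> y))) (\<alpha> (\<beta> y))" using eq[OF yG] by simp
  have "\<alpha> (\<beta> y) \<in> Y" using invariantD(2)[OF Y(1)] \<alpha> \<beta> y(1) by blast
  moreover have "\<alpha> (\<beta> y) \<notin> U"
    using invariant_reflect[OF U \<beta> yG] invariant_reflect[OF U \<alpha> A_closed[OF \<beta> yG]] y(2) by blast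
  ultimately show "\<gamma> w \<otimes> inv w \<in> U" using section_trivialI[OF U Y \<gamma> _ _ * w] by blast
qed

text \<open>The eigenvalue \<open>k\<close> on a section is prime to \<open>p\<close>, because
  \<alpha> is invertible modulo \<open>U\<close>, so its power with exponent p - 1 is 1 by
  Fermat.\<close>

lemma power_section_kernel:
  assumes \<alpha>: "\<alpha> \<in> A" and \<gamma>: "\<gamma> \<in> A"
    and eq: "\<And>x. x \<in> carrier G \<Longrightarrow> \<gamma> x = (\<alpha> ^^ (p - 1)) x"
  shows "\<gamma> \<in> section_kernel"
  unfolding section_kernel_def
proof (intro CollectI conjI \<gamma> allI impI ballI; elim conjE)
  fix U Y w assume U: "invariant U" and Y: "invariant Y" "U \<subseteq> Y" "card Y = p * card U" and w: "w \<in> Y"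
  obtain y where y: "y \<in> Y" "y \<notin> U" "y [^] p \<in> U" "\<And>w. w \<in> Y \<Longrightarrow> \<exists>k::nat. eqm U w (y [^] k)"
    using section_power[OF U Y] by blast
  have yG: "y \<in> carrier G" using y(1) subgroup.mem_carrier[OF invariantD(1)[OF Y(1)]] by auto
  obtain k where k: "eqm U (\<alpha> y) (y [^] (k::nat))" using y(4) invariantD(2)[OF Y(1) \<alpha> y(1)] by blast
  have "\<not> p dvd k"
  proof
    assume "p dvd k"
    then have "y [^] k \<in> U" using subgroup_nat_pow_closed[OF invariantD(1)[OF U] y(3)] yG
      by (metis dvdE nat_pow_pow)
    then have "\<alpha> y \<in> U" using eqm_mem[OF U k] by blast
    then show False using invariant_reflect[OF U \<alpha> yG] y(2) by blast
  qed
  then have "[k ^ (p - 1) = 1] (mod p)" by (rule fermat_theorem[OF prime_p])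
  then have "eqm U (y [^] (k ^ (p - 1))) (y [^] (1::nat))" using eqm_pow_cong[OF U yG y(3)] by blast
  then have "eqm U (\<gamma> y) y"
    using eqm_funpow[OF U \<alpha> yG k, of "p - 1"] eq[OF yG] eqm_trans[OF U] yG by (metis nat_pow_eone)
  then show "\<gamma> w \<otimes> inv w \<in> U" using section_trivialI[OF U Y \<gamma> y(1,2) _ w] by blast
qed

end

section \<open>Invariant series\<close>

text \<open>Telescoping the differences of consecutive powers with exponent j + 1 and expanding
  binomially gives a relation in which, by induction, all terms but j + 1 times the wanted sum are
  divisible by \<open>p\<close>. For \<open>j = 0\<close> the convention 0^0 = 1 makes the sum equal
  to \<open>p\<close>.\<close>

lemma prime_dvd_power_sum:
  fixes p :: nat
  assumes p: "Factorial_Ring.prime p" and "j + 1 < p"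
  shows "p dvd (\<Sum>k<p. k ^ j)"
  using assms(2)
proof (induction j rule: less_induct)
  case (less j)
  let ?S = "\<lambda>i. \<Sum>k<p. k ^ i"
  have "(\<Sum>k<p. Suc k ^ Suc j) = (\<Sum>k<p. \<Sum>i\<le>Suc j. (Suc j choose i) * k ^ i)"
    by (intro sum.cong refl) (use binomial[of _ 1 "Suc j"] in \<open>simp del: power_Suc\<close>)
  also have "\<dots> = (\<Sum>i\<le>Suc j. (Suc j choose i) * ?S i)"
    by (subst sum.swap) (simp add: sum_distrib_left)
  also have "\<dots> = (\<Sum>i<j. (Suc j choose i) * ?S i) + Suc j * ?S j + ?S (Suc j)"
    by (simp add: lessThan_Suc_atMost[symmetric])
  finally have 1: "(\<Sum>k<p. Suc k ^ Suc j) = \<dots>" .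
  have "(\<Sum>k<p. Suc k ^ Suc j) = p ^ Suc j + ?S (Suc j)"
  proof -
    have "(\<Sum>k<Suc p. k ^ Suc j) = 0 ^ Suc j + (\<Sum>k<p. Suc k ^ Suc j)" by (rule sum.lessThan_Suc_shift)
    then show ?thesis by simp
  qed
  then have eq: "(\<Sum>i<j. (Suc j choose i) * ?S i) + Suc j * ?S j = p ^ Suc j" using 1 by simp
  have "p dvd (\<Sum>i<j. (Suc j choose i) * ?S i)"
    using less by (intro dvd_sum) auto
  moreover have "p dvd (\<Sum>i<j. (Suc j choose i) * ?S i) + Suc j * ?S j" unfolding eq by simp
  ultimately have "p dvd Suc j * ?S j" using dvd_add_right_iff by blast
  moreover have "\<not> p dvd Suc j" using less.prems by (auto dest: dvd_imp_le)
  ultimately show ?case using p prime_dvd_mult_iff by blast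
qed

lemma (in group) pow_cong_exponent:
  fixes m n :: nat
  assumes "x \<in> carrier G" "x [^] p = \<one>" "[m = n] (mod p)"
  shows "x [^] m = x [^] n"
proof -
  have "x [^] k = x [^] (k mod p)" for k
  proof -
    have "x [^] k = (x [^] p) [^] (k div p) \<otimes> x [^] (k mod p)"
      using assms(1) by (simp add: nat_pow_mult nat_pow_pow)
    then show ?thesis using assms by simp
  qed
  then show ?thesis using assms(3) unfolding cong_def by metis
qed

text \<open>
  The elements \<open>\<Prod>\<^sub>i f\<^sup>i(x)\<^bsup>k^(p-1-i)\<^esup>\<close> for \<open>k < p\<close> are (possibly trivial) eigenvectors of \<open>f\<close>
  with eigenvalue \<open>k\<close>; by the values of the power sums modulo \<open>p\<close>, their product is \<open>x\<^bsup>p-1\<^esup>\<close>.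
\<close>

lemma (in comm_group) exists_eigenvector:
  assumes p: "Factorial_Ring.prime p" and f: "f \<in> hom G G"
    and exponent: "\<And>x. x \<in> carrier G \<Longrightarrow> x [^] p = \<one>"
    and period: "\<And>x. x \<in> carrier G \<Longrightarrow> (f ^^ (p - 1)) x = x"
    and x: "x \<in> carrier G" "x \<noteq> \<one>"
  obtains y k where "y \<in> carrier G" "y \<noteq> \<one>" "f y = y [^] (k::nat)"
proof -
  interpret f: group_hom G G f
    using f by (simp add: group_hom_def group_hom_axioms_def group_axioms)
  define m where "m = p - 1"
  have pm: "p = Suc m" "0 < m" using p prime_gt_1_nat[OF p] by (auto simp: m_def)
  define a where "a i = (f ^^ i) x" for i
  have a: "a i \<in> carrier G" for i unfolding a_def using x(1) by (induction i) auto
  have a_Suc: "f (a i) = a (Suc i)" for i unfolding a_def by simp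
  define t where "t k n = finprod G (\<lambda>i. a i [^] (k ^ (m - i))) {..<n}" for k n :: nat
  have t: "t k n \<in> carrier G" for k n unfolding t_def using a by (intro finprod_closed) auto
  have t_0: "t k 0 = \<one>" for k unfolding t_def by simp
  have t_Suc: "t k (Suc n) = a n [^] (k ^ (m - n)) \<otimes> t k n" for k n
    unfolding t_def lessThan_Suc using a by (subst finprod_insert) auto
  \<comment> \<open>Applying \<open>f\<close> shifts the factors by one place, as does raising to
    the power \<open>k\<close> in the exponents. The two products differ only in their end terms:
    \<open>x [^] (k ^ p)\<close> at index 0 and the power of \<open>a n\<close>. At
    \<open>n = m\<close> the end terms cancel, by periodicity and Fermat.\<close>
  have "f (t k n) \<otimes> x [^] (k ^ p) = t k n [^] k \<otimes> a n [^] (k ^ (p - n))" if "n \<le> m" for k n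
    using that
  proof (induction n)
    case 0 then show ?case using x(1) by (simp add: t_0 a_def)
  next
    case (Suc n)
    let ?e = "k ^ (m - n)"
    have e: "k ^ (p - n) = ?e * k" "p - Suc n = m - n" using Suc.prems pm by (auto simp: Suc_diff_le)
    have "f (t k (Suc n)) \<otimes> x [^] (k ^ p) = a (Suc n) [^] ?e \<otimes> (f (t k n) \<otimes> x [^] (k ^ p))"
      unfolding t_Suc using a t x(1) by (simp add: f.hom_nat_pow a_Suc m_assoc)
    also have "\<dots> = a (Suc n) [^] ?e \<otimes> (t k n [^] k \<otimes> a n [^] (?e * k))" using Suc e by simp
    also have "\<dots> = (a n [^] ?e \<otimes> t k n) [^] k \<otimes> a (Suc n) [^] ?e"
      using a t by (simp add: nat_pow_distrib nat_pow_pow m_ac)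
    finally show ?case unfolding t_Suc e .
  qed
  from this[of m] have end_eq: "f (t k m) \<otimes> x [^] (k ^ p) = t k m [^] k \<otimes> x [^] k" for k
    using period[OF x(1)] unfolding a_def m_def[symmetric] by (simp add: pm(1))
  have "x [^] (k ^ p) = x [^] k" for k :: nat
    by (rule pow_cong_exponent[OF x(1) exponent[OF x(1)] prime_pow_cong[OF p]])
  then have "f (t k m) \<otimes> x [^] k = t k m [^] k \<otimes> x [^] k" for k using end_eq[of k] by simp
  then have eigen: "f (t k m) = t k m [^] k" for k using t[of k m] x(1)
    by (metis (no_types, lifting) f.hom_closed nat_pow_closed right_cancel)
  have pow_sum: "finprod G (\<lambda>k. b [^] (e k)) {..<n} = b [^] (\<Sum>k<n. e k)"
    if "b \<in> carrier G" for b and e :: "nat \<Rightarrow> nat" and n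
    by (induction n) (use that in \<open>auto simp: lessThan_Suc nat_pow_mult add.commute\<close>)
  \<comment> \<open>In the product over all \<open>k\<close>, the factor \<open>a i\<close> gets the
    power sum with exponent m - i. This is \<open>m\<close> modulo \<open>p\<close> for
    \<open>i = 0\<close>, and 0 for the other \<open>i\<close>, so only \<open>x [^] m\<close>
    survives.\<close>
  have tot: "finprod G (\<lambda>k. t k (Suc n)) {..<p} = x [^] m" if "Suc n \<le> m" for n
    using that
  proof (induction n)
    case 0
    have "finprod G (\<lambda>k. t k (Suc 0)) {..<p} = x [^] (\<Sum>k<p. k ^ m)"
      unfolding t_Suc t_0 using x(1) pow_sum[OF x(1), of "\<lambda>k. k ^ m" p] by (simp add: a_def)
    moreover have "[(\<Sum>k<p. k ^ m) = m] (mod p)"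
    proof -
      have "(\<Sum>k<p. k ^ m) = (\<Sum>k<m. Suc k ^ m)"
        unfolding pm(1) by (subst sum.lessThan_Suc_shift) (use pm(2) in simp)
      also have "[\<dots> = (\<Sum>k<m. 1)] (mod p)"
      proof (rule cong_sum)
        fix k assume "k \<in> {..<m}"
        then have "\<not> p dvd Suc k" using pm(1) by (auto dest: dvd_imp_le)
        then show "[Suc k ^ m = 1] (mod p)" unfolding m_def by (rule fermat_theorem[OF p])
      qed
      finally show ?thesis by simp
    qed
    ultimately show ?case using pow_cong_exponent[OF x(1) exponent[OF x(1)]] by metis
  next
    case (Suc n)
    let ?j = "m - Suc n"
    have "finprod G (\<lambda>k. t k (Suc (Suc n))) {..<p}
        = finprod G (\<lambda>k. a (Suc n) [^] (k ^ ?j)) {..<p} \<otimes> finprod G (\<lambda>k. t k (Suc n)) {..<p}"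
      unfolding t_Suc[of _ "Suc n"] using a t by (intro finprod_multf) auto
    also have "finprod G (\<lambda>k. a (Suc n) [^] (k ^ ?j)) {..<p} = a (Suc n) [^] (\<Sum>k<p. k ^ ?j)"
      by (rule pow_sum[OF a])
    also have "\<dots> = a (Suc n) [^] (0::nat)"
      using prime_dvd_power_sum[OF p, of ?j] Suc.prems pm
      by (intro pow_cong_exponent[OF a exponent[OF a]]) (auto simp: cong_def mod_eq_0_iff_dvd)
    finally show ?case using Suc x(1) by simp
  qed
  have "x [^] m \<noteq> \<one>"
  proof
    assume "x [^] m = \<one>"
    then show False using exponent[OF x(1)] x pm(1) by simp
  qed
  moreover have "finprod G (\<lambda>k. t k m) {..<p} = x [^] m" using tot[of "m - 1"] pm(2) by simp
  ultimately obtain k where "t k m \<noteq> \<one>" by (metis finprod_one_eqI)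
  then show thesis using that[of "t k m" k] t eigen by blast
qed

section \<open>Construction of the invariant series\<close>

context automorphism_family
begin

lemma A_funpow_exists: "\<alpha> \<in> A \<Longrightarrow> \<exists>\<gamma>\<in>A. \<forall>x\<in>carrier G. \<gamma> x = (\<alpha> ^^ n) x"
proof (induction n)
  case 0 then show ?case using A_inner[of \<one>] by auto
next
  case (Suc n)
  then obtain \<gamma> where \<gamma>: "\<gamma> \<in> A" "\<forall>x\<in>carrier G. \<gamma> x = (\<alpha> ^^ n) x" by blast
  show ?case using A_compose[OF Suc.prems \<gamma>(1)] \<gamma>(2)
    by (intro bexI[of _ "compose (carrier G) \<alpha> \<gamma>"]) (auto simp: compose_def)
qed

lemma coset_eq_iff:
  assumes "invariant N" "x \<in> carrier G" "y \<in> carrier G"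
  shows "N #> x = N #> y \<longleftrightarrow> eqm N x y"
proof
  note N = invariantD(1)[OF assms(1)]
  assume "N #> x = N #> y"
  then have "x \<in> N #> y" using rcos_self[OF assms(2) N] by simp
  then show "eqm N x y" using subgroup.rcos_module_imp[OF N is_group assms(3)] assms by (simp add: eqm_def)
next
  note N = invariantD(1)[OF assms(1)]
  assume "eqm N x y"
  then have "x \<in> N #> y" using subgroup.rcos_module_rev[OF N is_group assms(3,2)] by (simp add: eqm_def)
  then show "N #> x = N #> y" using repr_independence[OF _ assms(3) N] by simp
qed

text \<open>Central elements of order dividing \<open>p\<close> modulo \<open>N\<close> form a
  module on which inner automorphisms act trivially. So \<open>A\<close> acts on it through
  commuting operators with trivial (p - 1)-st powers. A minimal submodule consists of common
  eigenvectors, and any nonzero vector in it spans an invariant line.\<close>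

lemma exists_invariant_extension:
  assumes N: "invariant N" "N \<noteq> carrier G"
    and inner: "\<And>\<beta>. \<beta> \<in> section_kernel \<Longrightarrow> \<exists>g\<in>carrier G. \<forall>x\<in>carrier G. \<beta> x = g \<otimes> x \<otimes> inv g"
  obtains M where "invariant M" "N \<subseteq> M" "card M = p * card N"
proof -
  note sN = invariantD(1)[OF N(1)]
  have NG: "n \<in> N \<Longrightarrow> n \<in> carrier G" for n using subgroup.mem_carrier[OF sN] .
  note refl = eqm_refl[OF N(1)] and sym = eqm_sym[OF N(1)] and trans = eqm_trans[OF N(1)]
    and mult = eqm_mult[OF N(1)]
  \<comment> \<open>V/N consists of the elements of order dividing \<open>p\<close> in the center of
    the quotient by \<open>N\<close>.\<close>
  define V where "V = {v \<in> carrier G. v [^] p \<in> N \<and> (\<forall>g\<in>carrier G. eqm N (v \<otimes> g) (g \<otimes> v))}"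
  have VG: "v \<in> V \<Longrightarrow> v \<in> carrier G" for v by (simp add: V_def)
  have comm: "eqm N (v \<otimes> g) (g \<otimes> v)" if "v \<in> V" "g \<in> carrier G" for v g using that by (simp add: V_def)
  have pow_dist: "eqm N ((v \<otimes> w) [^] n) (v [^] n \<otimes> w [^] n)"
    if v: "v \<in> V" and w: "w \<in> V" for v w and n :: nat
  proof (induction n)
    case 0 then show ?case using refl by simp
  next
    case (Suc n)
    note G = VG[OF v] VG[OF w]
    have "eqm N ((v \<otimes> w) [^] n \<otimes> (v \<otimes> w)) (v [^] n \<otimes> w [^] n \<otimes> (v \<otimes> w))"
      using G by (intro mult Suc refl) auto
    moreover have "eqm N (v [^] n \<otimes> ((w [^] n \<otimes> v) \<otimes> w)) (v [^] n \<otimes> ((v \<otimes> w [^] n) \<otimes> w))"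
      using G comm[OF v] by (intro mult refl sym[OF comm[OF v]]) auto
    ultimately show ?case using trans G by (simp add: m_assoc)
  qed
  have V: "invariant V" unfolding invariant_def
  proof (intro conjI ballI)
    show "subgroup V G"
    proof (rule finite_subgroupI)
      show "finite V" using finite_carrier by (simp add: V_def)
      show "V \<noteq> {}" using subgroup.one_closed[OF sN] refl by (auto simp: V_def intro!: exI[of _ \<one>])
      fix v w assume vw: "v \<in> V" "w \<in> V"
      note G = VG[OF vw(1)] VG[OF vw(2)]
      have "v [^] p \<otimes> w [^] p \<in> N" using vw subgroup.m_closed[OF sN] by (simp add: V_def)
      then have "(v \<otimes> w) [^] p \<in> N" using eqm_mem[OF N(1) pow_dist[OF vw]] by blast
      moreover have "eqm N (v \<otimes> w \<otimes> g) (g \<otimes> (v \<otimes> w))" if g: "g \<in> carrier G" for g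
      proof -
        have "eqm N (v \<otimes> (w \<otimes> g)) (v \<otimes> (g \<otimes> w))" using G by (intro mult refl comm vw g) auto
        moreover have "eqm N (v \<otimes> g \<otimes> w) (g \<otimes> v \<otimes> w)" using G by (intro mult refl comm vw g) auto
        ultimately show ?thesis using trans G g by (simp add: m_assoc)
      qed
      ultimately show "v \<otimes> w \<in> V" using G by (simp add: V_def)
    qed (auto simp: V_def)
    fix \<alpha> v assume \<alpha>: "\<alpha> \<in> A" and v: "v \<in> V"
    have "eqm N (\<alpha> v \<otimes> g) (g \<otimes> \<alpha> v)" if g: "g \<in> carrier G" for g
    proof -
      obtain h where h: "h \<in> carrier G" "\<alpha> h = g" using invariant_preimage[OF invariant_carrier \<alpha> g] .
      show ?thesis using eqm_image[OF N(1) \<alpha> comm[OF v h(1)]] h VG[OF v] \<alpha> by (simp add: A_mult)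
    qed
    moreover have "\<alpha> v [^] p \<in> N"
      using v invariantD(2)[OF N(1) \<alpha>, of "v [^] p"] A_pow[OF \<alpha> VG[OF v], of p] by (simp add: V_def)
    ultimately show "\<alpha> v \<in> V" using VG[OF v] \<alpha> by (simp add: V_def)
  qed
  have NV: "N \<subseteq> V"
  proof
    fix n assume n: "n \<in> N"
    have "eqm N (n \<otimes> g) (g \<otimes> n)" if g: "g \<in> carrier G" for g
    proof -
      have "eqm N (n \<otimes> g) (\<one> \<otimes> g)" by (intro mult eqm_one[OF N(1) n] refl g)
      then have 1: "eqm N (n \<otimes> g) g" using g by simp
      have "eqm N (g \<otimes> n) (g \<otimes> \<one>)" by (intro mult eqm_one[OF N(1) n] refl g)
      then have "eqm N (g \<otimes> n) g" using g by simp
      then show ?thesis using trans[OF 1 sym] by blast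
    qed
    then show "n \<in> V" using NG[OF n] subgroup_nat_pow_closed[OF sN n] by (simp add: V_def)
  qed
  have "N \<lhd> G" unfolding normal_inv_iff using sN invariant_conj(1)[OF N(1)] by blast
  then obtain z where z: "z \<in> carrier G" "z \<notin> N" "z [^] p \<in> N"
    "\<And>g. g \<in> carrier G \<Longrightarrow> z \<otimes> g \<otimes> inv z \<otimes> inv g \<in> N"
    using central_mod_normal N(2) by metis
  have "z \<in> V" using z by (simp add: V_def eqm_def word_simps)
  then have "N \<subset> V" using NV z(2) by blast
  \<comment> \<open>A minimal invariant \<open>W\<close> strictly above \<open>N\<close> corresponds
    to a simple submodule of V/N.\<close>
  let ?P = "\<lambda>W. invariant W \<and> N \<subset> W \<and> W \<subseteq> V"
  have "?P V" using V \<open>N \<subset> V\<close> by blast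
  from ex_has_least_nat[of ?P V card, OF this]
  obtain W where W: "?P W" and least: "\<forall>W'. ?P W' \<longrightarrow> card W \<le> card W'" by blast
  have Wmin: "card W \<le> card W'" if "?P W'" for W' using least[rule_format, OF that] .
  have sW: "subgroup W G" using W invariantD by blast
  have WV: "w \<in> W \<Longrightarrow> w \<in> V" for w using W by blast
  have WG: "w \<in> W \<Longrightarrow> w \<in> carrier G" for w using WV VG by blast
  have ker: "eqm N (\<gamma> w) w" if \<gamma>: "\<gamma> \<in> section_kernel" and w: "w \<in> V" for \<gamma> w
  proof -
    obtain g where g: "g \<in> carrier G" "\<forall>x\<in>carrier G. \<gamma> x = g \<otimes> x \<otimes> inv g" using inner[OF \<gamma>] by blast
    have "eqm N (g \<otimes> w \<otimes> inv g) (w \<otimes> g \<otimes> inv g)"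
      using g(1) VG[OF w] by (intro mult refl sym[OF comm] w) auto
    then show ?thesis using g VG[OF w] by (simp add: m_assoc)
  qed
  obtain y where y: "y \<in> W" "y \<notin> N" using W by blast
  \<comment> \<open>Each \<alpha> acts on W/N as a scalar: it has an eigenvector there, and its
    eigenspace is invariant under \<open>A\<close>, hence everything by minimality of
    \<open>W\<close>.\<close>
  have scalar: "\<exists>k::nat. eqm N (\<alpha> y) (y [^] k)" if \<alpha>: "\<alpha> \<in> A" for \<alpha>
  proof -
    let ?H = "G\<lparr>carrier := W\<rparr>"
    interpret H: group ?H using sW by (rule subgroup_imp_group)
    have NW: "N \<subseteq> W" using W by blast
    have "N \<lhd> ?H" unfolding H.normal_inv_iff
      using subgroup_incl[OF sN sW NW] invariant_conj(1)[OF N(1)] WG sW by auto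
    then interpret N: normal N ?H .
    let ?Q = "?H Mod N"
    have mem: "N #> w \<in> carrier ?Q" if "w \<in> W" for w using that by (auto simp: carrier_FactGroup)
    have mulQ: "(N #> v) \<otimes>\<^bsub>?Q\<^esub> (N #> w) = N #> (v \<otimes> w)" if "v \<in> W" "w \<in> W" for v w
      using N.rcos_sum[of v w] that by simp
    interpret Q: comm_group ?Q
    proof (rule group.group_comm_groupI)
      show "group ?Q" by (rule N.factorgroup_is_group)
      fix a b assume "a \<in> carrier ?Q" "b \<in> carrier ?Q"
      then obtain v w where vw: "v \<in> W" "w \<in> W" "a = N #> v" "b = N #> w" by (auto simp: carrier_FactGroup)
      show "a \<otimes>\<^bsub>?Q\<^esub> b = b \<otimes>\<^bsub>?Q\<^esub> a"
        unfolding vw(3,4) mulQ[OF vw(1,2)] mulQ[OF vw(2,1)]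
        using coset_eq_iff[OF N(1)] comm[OF WV[OF vw(1)]] WG vw(1,2) by simp
    qed
    have powQ: "(N #> w) [^]\<^bsub>?Q\<^esub> n = N #> (w [^] n)" if "w \<in> W" for w and n :: nat
      using N.FactGroup_pow[of w n] that by (simp add: nat_pow_consistent[symmetric])
    have oneQ: "N #> w = \<one>\<^bsub>?Q\<^esub> \<longleftrightarrow> w \<in> N" if "w \<in> W" for w
    proof
      assume "N #> w = \<one>\<^bsub>?Q\<^esub>"
      then show "w \<in> N" using rcos_self[OF WG[OF that] sN] by simp
    next
      assume "w \<in> N"
      then show "N #> w = \<one>\<^bsub>?Q\<^esub>" using subgroup.rcos_const[OF sN is_group] by simp
    qed
    have \<alpha>W: "w \<in> W \<Longrightarrow> \<alpha> w \<in> W" for w using W invariantD(2)[OF _ \<alpha>] by blast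
    have "(\<lambda>w. N #> \<alpha> w) \<in> hom ?H ?Q"
    proof (rule homI)
      fix v w assume "v \<in> carrier ?H" "w \<in> carrier ?H"
      then show "N #> \<alpha> (v \<otimes>\<^bsub>?H\<^esub> w) = (N #> \<alpha> v) \<otimes>\<^bsub>?Q\<^esub> (N #> \<alpha> w)"
        using mulQ[OF \<alpha>W \<alpha>W] A_mult[OF \<alpha> WG WG] by simp
    qed (use mem \<alpha>W in auto)
    \<comment> \<open>The map \<open>f\<close> is the endomorphism of W/N induced by
      \<alpha>.\<close>
    then obtain f where f: "f \<in> hom ?Q ?Q" "\<And>w. w \<in> W \<Longrightarrow> f (N #> w) = N #> \<alpha> w"
    proof (rule FactGroup_universal[OF _ \<open>N \<lhd> ?H\<close>])
      show "N #> \<alpha> v = N #> \<alpha> w" if "v \<in> carrier ?H" "w \<in> carrier ?H" "r_coset ?H N v = r_coset ?H N w" for v w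
        using that coset_eq_iff[OF N(1)] eqm_image[OF N(1) \<alpha>] \<alpha> WG by simp
    qed (use that in auto)
    have funpow: "(f ^^ n) (N #> w) = N #> (\<alpha> ^^ n) w \<and> (\<alpha> ^^ n) w \<in> W" if "w \<in> W" for w n
      by (induction n) (use that f(2) \<alpha>W in auto)
    \<comment> \<open>The (p - 1)-st power of \<alpha> is in the section kernel and so trivial on
      W/N, which is the period required for eigenvectors.\<close>
    obtain \<gamma> where \<gamma>: "\<gamma> \<in> A" "\<forall>x\<in>carrier G. \<gamma> x = (\<alpha> ^^ (p - 1)) x" using A_funpow_exists[OF \<alpha>] by blast
    then have "\<gamma> \<in> section_kernel" using power_section_kernel[OF \<alpha>] by blast
    then have period: "N #> (\<alpha> ^^ (p - 1)) w = N #> w" if "w \<in> W" for w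
      using coset_eq_iff[OF N(1)] ker[OF _ WV[OF that]] \<gamma>(2) WG[OF that] A_funpow_closed[OF \<alpha> WG[OF that]] by metis
    obtain E k where E: "E \<in> carrier ?Q" "E \<noteq> \<one>\<^bsub>?Q\<^esub>" "f E = E [^]\<^bsub>?Q\<^esub> (k::nat)"
    proof (rule Q.exists_eigenvector[OF prime_p f(1)])
      show "a [^]\<^bsub>?Q\<^esub> p = \<one>\<^bsub>?Q\<^esub>" if a: "a \<in> carrier ?Q" for a
      proof -
        obtain w where w: "w \<in> W" "a = N #> w" using a by (auto simp: carrier_FactGroup)
        show ?thesis unfolding w(2) powQ[OF w(1)]
          using oneQ[OF subgroup_nat_pow_closed[OF sW w(1)]] WV[OF w(1)] by (simp add: V_def)
      qed
      show "(f ^^ (p - 1)) a = a" if a: "a \<in> carrier ?Q" for a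
      proof -
        obtain w where w: "w \<in> W" "a = N #> w" using a by (auto simp: carrier_FactGroup)
        show ?thesis unfolding w(2) using funpow[OF w(1)] period[OF w(1)] by simp
      qed
      show "N #> y \<in> carrier ?Q" "N #> y \<noteq> \<one>\<^bsub>?Q\<^esub>" using mem oneQ y by auto
    qed
    obtain e where e: "e \<in> W" "E = N #> e" using E(1) by (auto simp: carrier_FactGroup)
    have eN: "e \<notin> N" using E(2) oneQ e by blast
    have ek: "eqm N (\<alpha> e) (e [^] k)"
      using E(3) coset_eq_iff[OF N(1)] \<alpha> WG[OF e(1)] unfolding e(2) f(2)[OF e(1)] powQ[OF e(1)] by simp
    \<comment> \<open>The preimage in \<open>W\<close> of the eigenspace of \<alpha> for the
      eigenvalue \<open>k\<close>.\<close>
    let ?W = "{w \<in> W. eqm N (\<alpha> w) (w [^] k)}"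
    have "invariant ?W" unfolding invariant_def
    proof (intro conjI ballI)
      show "subgroup ?W G"
      proof (rule finite_subgroupI)
        show "finite ?W" using finite_subgroup[OF sW] by simp
        show "?W \<noteq> {}" using e(1) ek by blast
        fix v w assume vw: "v \<in> ?W" "w \<in> ?W"
        then have vwW: "v \<in> W" "w \<in> W" by auto
        have "eqm N (\<alpha> v \<otimes> \<alpha> w) (v [^] k \<otimes> w [^] k)" using vw by (intro mult) auto
        then have "eqm N (\<alpha> (v \<otimes> w)) ((v \<otimes> w) [^] k)"
          using trans sym[OF pow_dist[OF WV[OF vwW(1)] WV[OF vwW(2)]]] A_mult[OF \<alpha> WG[OF vwW(1)] WG[OF vwW(2)]] by metis
        then show "v \<otimes> w \<in> ?W" using vwW subgroup.m_closed[OF sW] by blast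
      qed (use WG in auto)
      fix \<beta> w assume \<beta>: "\<beta> \<in> A" and "w \<in> ?W"
      then have w: "w \<in> W" "eqm N (\<alpha> w) (w [^] k)" by auto
      note wG = WG[OF w(1)]
      have \<beta>w: "\<beta> w \<in> W" using W invariantD(2)[OF _ \<beta> w(1)] by blast
      obtain \<alpha>' \<beta>' where \<alpha>': "\<alpha>' \<in> A" "\<forall>x\<in>carrier G. \<alpha>' (\<alpha> x) = x" and \<beta>': "\<beta>' \<in> A" "\<forall>x\<in>carrier G. \<beta>' (\<beta> x) = x"
        using A_inverse[OF \<alpha>] A_inverse[OF \<beta>] by blast
      \<comment> \<open>The commutator of \<alpha> and \<beta>. Being in the section kernel, it is
        trivial on V/N, so \<alpha> and \<beta> commute modulo \<open>N\<close> and \<beta>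
        preserves the eigenspace.\<close>
      define \<gamma> where "\<gamma> = compose (carrier G) \<alpha> (compose (carrier G) \<beta> (compose (carrier G) \<alpha>' \<beta>'))"
      have \<gamma>A: "\<gamma> \<in> A" unfolding \<gamma>_def using A_compose \<alpha> \<beta> \<alpha>' \<beta>' by blast
      have \<gamma>: "\<gamma> (\<beta> (\<alpha> x)) = \<alpha> (\<beta> x)" if "x \<in> carrier G" for x
        using that \<alpha> \<beta> \<alpha>' \<beta>' by (simp add: \<gamma>_def compose_def)
      have "\<gamma> \<in> section_kernel" by (rule commutator_section_kernel[OF \<beta> \<alpha> \<gamma>A \<gamma>])
      moreover have "\<beta> (\<alpha> w) \<in> V" using invariantD(2)[OF V] \<alpha> \<beta> WV[OF w(1)] by blast
      ultimately have "eqm N (\<alpha> (\<beta> w)) (\<beta> (\<alpha> w))" using ker \<gamma>[OF wG] by metis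
      moreover have "eqm N (\<beta> (\<alpha> w)) (\<beta> w [^] k)" using eqm_image[OF N(1) \<beta> w(2)] A_pow[OF \<beta> wG] by simp
      ultimately show "\<beta> w \<in> ?W" using \<beta>w trans by blast
    qed
    moreover have "n \<in> ?W" if n: "n \<in> N" for n
    proof -
      have "eqm N (\<alpha> n) (n [^] k)"
        using trans[OF eqm_one[OF N(1) invariantD(2)[OF N(1) \<alpha> n]] sym[OF eqm_one[OF N(1) subgroup_nat_pow_closed[OF sN n]]]] .
      then show ?thesis using n NW by blast
    qed
    ultimately have "?P ?W" using e(1) eN ek W by blast
    then have "card W \<le> card ?W" by (rule Wmin)
    then have "?W = W" using finite_subgroup[OF sW] by (intro card_seteq) auto
    then show ?thesis using y(1) by blast
  qed
  have yV: "y \<in> V" using y(1) by (rule WV)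
  \<comment> \<open>The preimage of the line spanned by the common eigenvector
    \<open>y\<close>.\<close>
  define Z where "Z = {u \<otimes> y [^] (i::nat) | u i. u \<in> N}"
  have yp: "y [^] p \<in> N" using yV by (simp add: V_def)
  note Z = adjoin_subgroup[OF sN VG[OF yV] y(2) yp invariant_conj(1)[OF N(1) _ VG[OF yV]], folded Z_def]
  have "invariant Z" unfolding invariant_def
  proof (intro conjI ballI Z(1))
    fix \<alpha> v assume \<alpha>: "\<alpha> \<in> A" and "v \<in> Z"
    then obtain u i where v: "v = u \<otimes> y [^] (i::nat)" "u \<in> N" unfolding Z_def by blast
    obtain k where k: "eqm N (\<alpha> y) (y [^] (k::nat))" using scalar[OF \<alpha>] by blast
    have "\<alpha> y = (\<alpha> y \<otimes> inv (y [^] k)) \<otimes> y [^] k" using \<alpha> VG[OF yV] by (simp add: m_assoc)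
    then have "\<alpha> y \<in> Z" unfolding Z_def using eqmD(3)[OF k] by blast
    then have "\<alpha> u \<otimes> \<alpha> y [^] i \<in> Z"
      using subgroup.m_closed[OF Z(1)] subgroup_nat_pow_closed[OF Z(1)] Z(3) invariantD(2)[OF N(1) \<alpha> v(2)] by blast
    then show "\<alpha> v \<in> Z" using v \<alpha> VG[OF yV] NG by (simp add: A_mult A_pow)
  qed
  then show thesis using that Z by blast
qed

text \<open>Started at an arbitrary invariant \<open>N\<close>, so that the induction can extend
  \<open>N\<close> by one step and prepend it to the series of the larger group.\<close>

lemma exists_invariant_series:
  assumes inner: "\<And>\<beta>. \<beta> \<in> section_kernel \<Longrightarrow> \<exists>g\<in>carrier G. \<forall>x\<in>carrier G. \<beta> x = g \<otimes> x \<otimes> inv g"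
    and N: "invariant N"
  shows "\<exists>(n::nat) T. T 0 = N \<and> T n = carrier G \<and> (\<forall>i\<le>n. invariant (T i))
    \<and> (\<forall>i<n. T i \<subseteq> T (Suc i) \<and> card (T (Suc i)) = p * card (T i))"
  using N
proof (induction "order G - card N" arbitrary: N rule: less_induct)
  case less
  show ?case
  proof (cases "N = carrier G")
    case True
    then show ?thesis using less.prems by (intro exI[of _ 0] exI[of _ "\<lambda>_. N"]) auto
  next
    case False
    obtain M where M: "invariant M" "N \<subseteq> M" "card M = p * card N"
      using exists_invariant_extension[OF less.prems False inner] by blast
    have "card N > 0"
      using finite_subgroup invariantD(1)[OF less.prems] subgroup.one_closed card_gt_0_iff by blast
    then have "card N < card M" using M(3) p_gt_1 by simp
    moreover have "card M \<le> order G" unfolding order_def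
      using finite_carrier subgroup.subset[OF invariantD(1)[OF M(1)]] by (rule card_mono)
    ultimately have "order G - card M < order G - card N" by simp
    then obtain n T where T: "T 0 = M" "T n = carrier G" "\<forall>i\<le>n. invariant (T i)"
      "\<forall>i<n. T i \<subseteq> T (Suc i) \<and> card (T (Suc i)) = p * card (T i)"
      using less.hyps[OF _ M(1)] by blast
    define T' where "T' i = (case i of 0 \<Rightarrow> N | Suc j \<Rightarrow> T j)" for i
    have "\<forall>i\<le>Suc n. invariant (T' i)" using T(3) less.prems by (auto simp: T'_def split: nat.split)
    moreover have "\<forall>i<Suc n. T' i \<subseteq> T' (Suc i) \<and> card (T' (Suc i)) = p * card (T' i)"
      using T(1,4) M by (auto simp: T'_def split: nat.split)
    ultimately show ?thesis using T(2) by (intro exI[of _ "Suc n"] exI[of _ T']) (auto simp: T'_def)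
  qed
qed

end

section \<open>Fusion systems\<close>

lemma (in group) prime_order_cyclic:
  assumes "Factorial_Ring.prime (order G)"
  shows "cyclic_group G"
proof -
  have fin: "finite (carrier G)"
    using prime_gt_0_nat[OF assms] order_gt_0_iff_finite by simp
  have "carrier G \<noteq> {\<one>}" using assms by (auto simp: order_def)
  then obtain x where x: "x \<in> carrier G" "x \<noteq> \<one>" by blast
  have "ord x \<noteq> 1" using x ord_eq_1 by blast
  moreover have "ord x = 1 \<or> ord x = order G"
    using ord_dvd_group_order[OF x(1)] assms unfolding prime_nat_iff by blast
  ultimately have "ord x = order G" by blast
  then have "card (generate G {x}) = card (carrier G)"
    using generate_pow_card[OF x(1)] by (simp add: order_def)
  then have "generate G {x} = carrier G"
    using x(1) fin by (intro card_subset_eq) (auto simp: generate_incl)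
  then have "subgroup_generated G {x} = G" using x(1) by (simp add: subgroup_generated_def)
  then show ?thesis unfolding cyclic_group_def using x(1) by blast
qed

text \<open>Another prime \<open>q\<close> dividing the order would, by Sylow's theorem with
  exponent 1, yield a nontrivial element of order dividing both \<open>q\<close> and a power of
  \<open>p\<close>.\<close>

lemma (in group) prime_power_order_if_p_elements:
  assumes fin: "finite (carrier G)" and p: "Factorial_Ring.prime (p::nat)"
    and elems: "\<And>x. x \<in> carrier G \<Longrightarrow> \<exists>e. x [^] (p ^ e) = \<one>"
  shows "\<exists>n. order G = p ^ n"
proof -
  have "order G \<noteq> 0" using fin order_gt_0_iff_finite by simp
  moreover have "\<not> is_unit p" using prime_gt_1_nat[OF p] by simp
  ultimately obtain m where m: "order G = p ^ multiplicity p (order G) * m" "\<not> p dvd m"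
    using multiplicity_decompose' by metis
  have "m = 1"
  proof (rule ccontr)
    assume "m \<noteq> 1"
    then obtain q where q: "Factorial_Ring.prime q" "q dvd m" using prime_factor_nat by blast
    then have "q dvd p ^ multiplicity p (order G) * m" by simp
    then have "q dvd order G" using m(1) by simp
    then obtain k where "order G = q ^ 1 * k" by auto
    then obtain H where H: "subgroup H G" "card H = q ^ 1" using sylow_thm[OF q(1) is_group _ fin] by blast
    interpret H: group "G\<lparr>carrier := H\<rparr>" using H(1) by (rule subgroup_imp_group)
    have "H \<noteq> {\<one>}" using H(2) q(1) by auto
    then obtain h where h: "h \<in> H" "h \<noteq> \<one>" using subgroup.one_closed[OF H(1)] by blast
    then have hG: "h \<in> carrier G" using subgroup.mem_carrier[OF H(1)] by blast
    have "h [^] q = \<one>"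
      using H.pow_order_eq_1[of h] h(1) H(2) by (simp add: order_def nat_pow_consistent[symmetric])
    then have "ord h dvd q" using pow_eq_id[OF hG] by blast
    moreover obtain e where "h [^] (p ^ e) = \<one>" using elems[OF hG] by blast
    then have "ord h dvd p ^ e" using pow_eq_id[OF hG] by blast
    moreover have "q \<noteq> p" using q(2) m(2) by blast
    then have "coprime q (p ^ e)" using primes_coprime[OF q(1) p] by simp
    ultimately have "ord h = 1" using coprime_common_divisor_nat by blast
    then show False using ord_eq_1[OF hG] h(2) by blast
  qed
  then show ?thesis using m(1) by auto
qed

text \<open>Conjugation is injective, so on a finite \<open>P\<close> inclusion of the conjugate in
  \<open>P\<close> already gives equality.\<close>

lemma (in group) normalizer_finite:
  assumes P: "subgroup P G" and fin: "finite P"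
  shows "normalizer G P = {g \<in> carrier G. \<forall>x\<in>P. g \<otimes> x \<otimes> inv g \<in> P}"
proof -
  note PG = subgroup.subset[OF P]
  have img: "g <# P #> inv g = (\<lambda>x. g \<otimes> x \<otimes> inv g) ` P" for g
    unfolding l_coset_def r_coset_def by auto
  have "(\<lambda>x. g \<otimes> x \<otimes> inv g) ` P = P \<longleftrightarrow> (\<forall>x\<in>P. g \<otimes> x \<otimes> inv g \<in> P)" if g: "g \<in> carrier G" for g
  proof
    assume *: "\<forall>x\<in>P. g \<otimes> x \<otimes> inv g \<in> P"
    have "inj_on (\<lambda>x. g \<otimes> x \<otimes> inv g) P" using g PG by (intro inj_onI) (auto simp: subset_iff)
    then have "card ((\<lambda>x. g \<otimes> x \<otimes> inv g) ` P) = card P" by (rule card_image)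
    then show "(\<lambda>x. g \<otimes> x \<otimes> inv g) ` P = P" using * fin by (intro card_subset_eq) auto
  qed blast
  then show ?thesis unfolding normalizer_def stabilizer_def using PG by (auto simp: img)
qed

section \<open>Morphisms and automorphism groups of a fusion system\<close>

context fusion_system
begin

lemma finite_p_group: "finite_p_group S p"
  using prime_p finite_carrier p_group by unfold_locales

sublocale finite_p_group S p by (rule finite_p_group)

lemma normalizer_eq:
  "subgroup P S \<Longrightarrow> normalizer S P = {g \<in> carrier S. \<forall>x\<in>P. g \<otimes> x \<otimes> inv g \<in> P}"
  using normalizer_finite finite_subgroup by blast

lemma F_hom: "\<lbrakk>subgroup P S; subgroup Q S; \<phi> \<in> F P Q\<rbrakk> \<Longrightarrow> \<phi> \<in> hom (S\<lparr>carrier := P\<rparr>) (S\<lparr>carrier := Q\<rparr>)"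
  using mem_mon unfolding mon_def by blast

lemma F_mult: "\<lbrakk>subgroup P S; subgroup Q S; \<phi> \<in> F P Q; x \<in> P; y \<in> P\<rbrakk> \<Longrightarrow> \<phi> (x \<otimes> y) = \<phi> x \<otimes> \<phi> y"
  using hom_mult[OF F_hom] by fastforce

lemma F_closed: "\<lbrakk>subgroup P S; subgroup Q S; \<phi> \<in> F P Q; x \<in> P\<rbrakk> \<Longrightarrow> \<phi> x \<in> Q"
  using hom_in_carrier[OF F_hom] by fastforce

lemma F_inj: "\<lbrakk>subgroup P S; subgroup Q S; \<phi> \<in> F P Q\<rbrakk> \<Longrightarrow> inj_on \<phi> P"
  using mem_mon unfolding mon_def by fastforce

lemma F_ext: "\<lbrakk>subgroup P S; subgroup Q S; \<phi> \<in> F P Q\<rbrakk> \<Longrightarrow> \<phi> \<in> extensional P"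
  using mem_mon by blast

lemma F_m_inv:
  assumes "subgroup P S" "subgroup Q S" "\<phi> \<in> F P Q" "x \<in> P"
  shows "\<phi> (inv x) = inv (\<phi> x)"
proof -
  have "group_hom (S\<lparr>carrier := P\<rparr>) (S\<lparr>carrier := Q\<rparr>) \<phi>"
    using F_hom[OF assms(1-3)] assms(1,2) subgroup_imp_group by (simp add: group_hom_def group_hom_axioms_def)
  from group_hom.hom_inv[OF this, of x] show ?thesis using assms F_closed by simp
qed

lemma F_image_subgroup:
  assumes "subgroup P S" "subgroup Q S" "\<phi> \<in> F P Q"
  shows "subgroup (\<phi> ` P) S"
proof (rule finite_subgroupI)
  show "finite (\<phi> ` P)" using finite_subgroup[OF assms(1)] by simp
  show "\<phi> ` P \<subseteq> carrier S" using F_closed[OF assms] subgroup.subset[OF assms(2)] by blast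
  show "\<phi> ` P \<noteq> {}" using subgroup.one_closed[OF assms(1)] by blast
  fix a b assume "a \<in> \<phi> ` P" "b \<in> \<phi> ` P"
  then show "a \<otimes> b \<in> \<phi> ` P"
    using F_mult[OF assms] subgroup.m_closed[OF assms(1)] by (metis (no_types, lifting) image_iff)
qed

lemma fusion_iso_inverse:
  assumes "\<phi> \<in> fusion_iso F P Q"
  shows "\<phi> \<in> F P Q" "\<exists>\<psi>\<in>F Q P. (\<forall>x\<in>P. \<psi> (\<phi> x) = x) \<and> (\<forall>y\<in>Q. \<phi> (\<psi> y) = y)"
proof -
  obtain \<psi> where \<psi>: "\<phi> \<in> F P Q" "\<psi> \<in> F Q P" "compose P \<psi> \<phi> = (\<lambda>x\<in>P. x)" "compose Q \<phi> \<psi> = (\<lambda>y\<in>Q. y)"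
    using assms unfolding fusion_iso_def by blast
  have "\<psi> (\<phi> x) = x" if "x \<in> P" for x using fun_cong[OF \<psi>(3), of x] that by (simp add: compose_def)
  moreover have "\<phi> (\<psi> y) = y" if "y \<in> Q" for y using fun_cong[OF \<psi>(4), of y] that by (simp add: compose_def)
  ultimately show "\<exists>\<psi>\<in>F Q P. (\<forall>x\<in>P. \<psi> (\<phi> x) = x) \<and> (\<forall>y\<in>Q. \<phi> (\<psi> y) = y)" using \<psi>(2) by blast
qed (use assms in \<open>auto simp: fusion_iso_def\<close>)

lemma fusion_iso_image:
  assumes "subgroup P S" "subgroup Q S" "\<phi> \<in> fusion_iso F P Q"
  shows "\<phi> ` P = Q" "card P = card Q"
proof -
  obtain \<psi> where \<psi>: "\<phi> \<in> F P Q" "\<psi> \<in> F Q P" "\<forall>y\<in>Q. \<phi> (\<psi> y) = y"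
    using fusion_iso_inverse[OF assms(3)] by blast
  show *: "\<phi> ` P = Q"
  proof
    show "\<phi> ` P \<subseteq> Q" using F_closed[OF assms(1,2) \<psi>(1)] by blast
    show "Q \<subseteq> \<phi> ` P" using F_closed[OF assms(2,1) \<psi>(2)] \<psi>(3) by (metis image_eqI subsetI)
  qed
  show "card P = card Q" using card_image[OF F_inj[OF assms(1,2) \<psi>(1)]] * by simp
qed

lemma fusion_iso_of_card:
  assumes "subgroup P S" "subgroup Q S" "\<phi> \<in> F P Q" "card P = card Q"
  shows "\<phi> \<in> fusion_iso F P Q"
proof -
  have "\<phi> ` P = Q"
    using card_image[OF F_inj[OF assms(1-3)]] F_closed[OF assms(1-3)] assms(4) finite_subgroup[OF assms(2)]
    by (intro card_subset_eq) auto
  then show ?thesis using iso_onto_image[OF assms(1-3)] by simp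
qed

lemma conj_map_F:
  assumes "subgroup P S" "g \<in> normalizer S P"
  shows "conj_map S P g \<in> F P P"
proof -
  have "conj_map S P g \<in> hom_by_conj S P P"
    using assms normalizer_eq[OF assms(1)] unfolding hom_by_conj_def conj_map_def by auto
  then show ?thesis using conj_mem[OF assms(1,1)] by blast
qed

lemma subset_normalizer:
  assumes P: "subgroup P S" shows "P \<subseteq> normalizer S P"
  unfolding normalizer_eq[OF P]
  using subgroup.mem_carrier[OF P] subgroup.m_closed[OF P] subgroup.m_inv_closed[OF P] by blast

lemma automorphism_family_F:
  assumes K: "subgroup K S"
  shows "automorphism_family (S\<lparr>carrier := K\<rparr>) p (F K K)"
proof -
  interpret K: finite_p_group "S\<lparr>carrier := K\<rparr>" p by (rule finite_p_group_subgroup[OF K])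
  show ?thesis
  proof unfold_locales
    show "\<alpha> \<in> hom (S\<lparr>carrier := K\<rparr>) (S\<lparr>carrier := K\<rparr>)" if "\<alpha> \<in> F K K" for \<alpha>
      using F_hom[OF K K that] .
    show "compose (carrier (S\<lparr>carrier := K\<rparr>)) \<alpha> \<beta> \<in> F K K" if "\<alpha> \<in> F K K" "\<beta> \<in> F K K" for \<alpha> \<beta>
      using comp_mem[OF K K K that(2,1)] by simp
    show "\<exists>\<beta>\<in>F K K. \<forall>x\<in>carrier (S\<lparr>carrier := K\<rparr>). \<beta> (\<alpha> x) = x \<and> \<alpha> (\<beta> x) = x" if \<alpha>: "\<alpha> \<in> F K K" for \<alpha>
      using fusion_iso_inverse(2)[OF fusion_iso_of_card[OF K K \<alpha> refl]] by simp blast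
    show "\<exists>\<alpha>\<in>F K K. \<forall>x\<in>carrier (S\<lparr>carrier := K\<rparr>).
        \<alpha> x = g \<otimes>\<^bsub>S\<lparr>carrier := K\<rparr>\<^esub> x \<otimes>\<^bsub>S\<lparr>carrier := K\<rparr>\<^esub> inv\<^bsub>S\<lparr>carrier := K\<rparr>\<^esub> g"
      if "g \<in> carrier (S\<lparr>carrier := K\<rparr>)" for g
      using that K conj_map_F[OF K] subset_normalizer[OF K]
      by (intro bexI[of _ "conj_map S K g"]) (auto simp: conj_map_def)
  qed
qed

text \<open>The form in which semi-invariance enters the study of the action of Aut_F(K) on a fixed
  \<open>K\<close>.\<close>

lemma semi_invariant_invariant:
  assumes K: "subgroup K S" and H: "semi_invariant S F H" "H \<subseteq> K"
  shows "automorphism_family.invariant (S\<lparr>carrier := K\<rparr>) (F K K) H"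
proof -
  interpret K: automorphism_family "S\<lparr>carrier := K\<rparr>" p "F K K" by (rule automorphism_family_F[OF K])
  show ?thesis using H K subgroup_incl[of H K] unfolding K.invariant_def semi_invariant_def by blast
qed

lemma fusion_aut_group_simps:
  "carrier (fusion_aut_group S F K) = F K K"
  "one (fusion_aut_group S F K) = (\<lambda>x\<in>K. x)"
  by (auto simp: fusion_aut_group_def AutoGroup_def BijGroup_def)

text \<open>Multiplication in \<open>BijGroup\<close> is composition on bijections only, so the
  endomorphisms in \<open>F K K\<close> must first be recognized as bijective.\<close>

lemma fusion_aut_group_mult:
  assumes K: "subgroup K S" and "\<alpha> \<in> F K K" "\<beta> \<in> F K K"
  shows "\<alpha> \<otimes>\<^bsub>fusion_aut_group S F K\<^esub> \<beta> = compose K \<alpha> \<beta>"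
proof -
  have "\<gamma> \<in> Bij K" if "\<gamma> \<in> F K K" for \<gamma>
    using F_ext[OF K K that] F_inj[OF K K that] fusion_iso_image(1)[OF K K fusion_iso_of_card[OF K K that refl]]
    by (simp add: Bij_def bij_betw_def)
  then show ?thesis using assms(2,3) by (simp add: fusion_aut_group_def AutoGroup_def BijGroup_def)
qed

lemma group_fusion_aut_group:
  assumes K: "subgroup K S"
  shows "group (fusion_aut_group S F K)"
proof (rule groupI; unfold fusion_aut_group_simps)
  have FK: "\<alpha> \<in> F K K \<Longrightarrow> \<alpha> \<in> K \<rightarrow> K" for \<alpha> using F_closed[OF K K] by blast
  note mult = fusion_aut_group_mult[OF K]
  have id: "(\<lambda>x\<in>K. x) = conj_map S K \<one>"
    using subgroup.mem_carrier[OF K] by (auto simp: conj_map_def restrict_def)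
  show idF: "(\<lambda>x\<in>K. x) \<in> F K K"
    unfolding id using conj_map_F[OF K] subset_normalizer[OF K] subgroup.one_closed[OF K] by blast
  fix \<alpha> \<beta> assume \<alpha>: "\<alpha> \<in> F K K" and \<beta>: "\<beta> \<in> F K K"
  show "\<alpha> \<otimes>\<^bsub>fusion_aut_group S F K\<^esub> \<beta> \<in> F K K" using comp_mem[OF K K K \<beta> \<alpha>] mult[OF \<alpha> \<beta>] by simp
  fix \<gamma> assume \<gamma>: "\<gamma> \<in> F K K"
  show "\<alpha> \<otimes>\<^bsub>fusion_aut_group S F K\<^esub> \<beta> \<otimes>\<^bsub>fusion_aut_group S F K\<^esub> \<gamma>
      = \<alpha> \<otimes>\<^bsub>fusion_aut_group S F K\<^esub> (\<beta> \<otimes>\<^bsub>fusion_aut_group S F K\<^esub> \<gamma>)"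
    using comp_mem[OF K K K \<beta> \<alpha>] comp_mem[OF K K K \<gamma> \<beta>] \<alpha> \<beta> \<gamma> compose_assoc[OF FK[OF \<gamma>], of \<alpha> \<beta>]
    by (simp add: mult)
next
  fix \<alpha> assume \<alpha>: "\<alpha> \<in> F K K"
  have FK: "\<alpha> \<in> K \<rightarrow> K" using F_closed[OF K K \<alpha>] by blast
  have id: "(\<lambda>x\<in>K. x) = conj_map S K \<one>"
    using subgroup.mem_carrier[OF K] by (auto simp: conj_map_def restrict_def)
  have idF: "(\<lambda>x\<in>K. x) \<in> F K K"
    unfolding id using conj_map_F[OF K] subset_normalizer[OF K] subgroup.one_closed[OF K] by blast
  show "(\<lambda>x\<in>K. x) \<otimes>\<^bsub>fusion_aut_group S F K\<^esub> \<alpha> = \<alpha>"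
    unfolding fusion_aut_group_mult[OF K idF \<alpha>] using FK F_ext[OF K K \<alpha>] by (rule Id_compose)
  obtain \<beta> where "\<beta> \<in> F K K" "compose K \<beta> \<alpha> = (\<lambda>x\<in>K. x)"
    using fusion_iso_of_card[OF K K \<alpha> refl] unfolding fusion_iso_def by blast
  then show "\<exists>\<beta>\<in>F K K. \<beta> \<otimes>\<^bsub>fusion_aut_group S F K\<^esub> \<alpha> = (\<lambda>x\<in>K. x)"
    using fusion_aut_group_mult[OF K _ \<alpha>] by auto
qed

lemma finite_F:
  assumes K: "subgroup K S" shows "finite (F K K)"
proof -
  have "F K K \<subseteq> K \<rightarrow>\<^sub>E K" using F_ext[OF K K] F_closed[OF K K] by (auto simp: PiE_def)
  then show ?thesis using finite_PiE finite_subgroup[OF K] finite_subset by metis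
qed

lemma fusion_aut_group_pow:
  assumes K: "subgroup K S" and \<alpha>: "\<alpha> \<in> F K K" and x: "x \<in> K"
  shows "(\<alpha> [^]\<^bsub>fusion_aut_group S F K\<^esub> (n::nat)) x = (\<alpha> ^^ n) x"
proof -
  interpret A: group "fusion_aut_group S F K" by (rule group_fusion_aut_group[OF K])
  have "\<alpha> [^]\<^bsub>fusion_aut_group S F K\<^esub> n \<in> F K K" for n :: nat
    using A.nat_pow_closed[of \<alpha> n] \<alpha> by (simp add: fusion_aut_group_simps)
  then show ?thesis using x
  proof (induction n arbitrary: x)
    case 0 then show ?case by (simp add: fusion_aut_group_simps)
  next
    case (Suc n)
    have "(\<alpha> [^]\<^bsub>fusion_aut_group S F K\<^esub> Suc n) x = (\<alpha> [^]\<^bsub>fusion_aut_group S F K\<^esub> n) (\<alpha> x)"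
      using fusion_aut_group_mult[OF K Suc.prems(1) \<alpha>] Suc.prems(2) by (simp add: compose_def)
    also have "\<dots> = (\<alpha> ^^ n) (\<alpha> x)" using Suc F_closed[OF K K \<alpha>] by blast
    finally show ?case by (simp add: funpow_swap1)
  qed
qed

text \<open>Translates orders in Aut_F(K) into pointwise statements on iterates, the language of
  \<open>automorphism_family\<close>.\<close>

lemma fusion_aut_group_pow_eq_one_iff:
  assumes K: "subgroup K S" and \<alpha>: "\<alpha> \<in> F K K"
  shows "\<alpha> [^]\<^bsub>fusion_aut_group S F K\<^esub> (n::nat) = \<one>\<^bsub>fusion_aut_group S F K\<^esub> \<longleftrightarrow> (\<forall>x\<in>K. (\<alpha> ^^ n) x = x)"
proof -
  interpret A: group "fusion_aut_group S F K" by (rule group_fusion_aut_group[OF K])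
  have "\<alpha> [^]\<^bsub>fusion_aut_group S F K\<^esub> n \<in> F K K"
    using A.nat_pow_closed[of \<alpha> n] \<alpha> by (simp add: fusion_aut_group_simps)
  then have "\<alpha> [^]\<^bsub>fusion_aut_group S F K\<^esub> n \<in> extensional K" by (rule F_ext[OF K K])
  then show ?thesis
    using fusion_aut_group_pow[OF K \<alpha>, of _ n] unfolding fusion_aut_group_simps
    by (auto intro: extensionalityI)
qed

end

section \<open>Fusion systems as in the theorem: extension of morphisms, supersolvability\<close>

lemma comm_groupD: "comm_group G \<Longrightarrow> x \<in> carrier G \<Longrightarrow> y \<in> carrier G \<Longrightarrow> x \<otimes>\<^bsub>G\<^esub> y = y \<otimes>\<^bsub>G\<^esub> x"
  by (rule comm_monoid.m_comm[OF comm_group.axioms(1)])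

text \<open>The subgroup D is represented by its order \<open>p ^ d\<close>; that it is nontrivial
  and proper becomes \<open>d_pos\<close> and \<open>d_less\<close>.\<close>

locale small_semi_invariant = saturated_fusion_system +
  fixes d :: nat
  assumes d_pos: "1 \<le> d" and d_less: "p ^ Suc d \<le> order S"
    and semi_inv: "\<lbrakk>subgroup H S; card H = p ^ d\<rbrakk> \<Longrightarrow> semi_invariant S F H"
    and abelian: "\<lbrakk>subgroup H S; card H = p ^ Suc d\<rbrakk> \<Longrightarrow> comm_group (S\<lparr>carrier := H\<rparr>)"
    and four: "\<lbrakk>\<not> comm_group S; p = 2; d = 1; subgroup H S; cyclic_group (S\<lparr>carrier := H\<rparr>); card H = 4\<rbrakk>
      \<Longrightarrow> semi_invariant S F H"
begin

lemma abelianD: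
  assumes "subgroup H S" "card H = p ^ Suc d" "x \<in> H" "y \<in> H"
  shows "x \<otimes> y = y \<otimes> x"
  using comm_groupD[OF abelian[OF assms(1,2)]] assms(3,4) by simp

lemma coprime_kernel_F_trivial:
  assumes K: "subgroup K S" and size: "p ^ Suc d \<le> card K"
    and r: "r \<in> automorphism_family.coprime_kernel (S\<lparr>carrier := K\<rparr>) p (F K K)" and x: "x \<in> K"
  shows "r x = x"
proof -
  interpret K: automorphism_family "S\<lparr>carrier := K\<rparr>" p "F K K" by (rule automorphism_family_F[OF K])
  have sub: "subgroup H S" "H \<subseteq> K" if "subgroup H (S\<lparr>carrier := K\<rparr>)" for H
    using incl_subgroup[OF K that] subgroup.subset[OF that] by auto
  show ?thesis
  proof (rule K.coprime_kernel_trivial[OF d_pos _ _ _ _ r])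
    show "p ^ Suc d \<le> order (S\<lparr>carrier := K\<rparr>)" using size by (simp add: order_def)
    show "x \<in> carrier (S\<lparr>carrier := K\<rparr>)" using x by simp
    show "K.invariant H" if "subgroup H (S\<lparr>carrier := K\<rparr>)" "card H = p ^ d" for H
      using semi_invariant_invariant[OF K semi_inv] sub[OF that(1)] that(2) by blast
    show "x \<otimes>\<^bsub>S\<lparr>carrier := K\<rparr>\<^esub> y = y \<otimes>\<^bsub>S\<lparr>carrier := K\<rparr>\<^esub> x"
      if "subgroup T (S\<lparr>carrier := K\<rparr>)" "card T = p ^ Suc d" "x \<in> T" "y \<in> T" for T x y
      using abelianD[OF sub(1)[OF that(1)] that(2-4)] by simp
    show "K.invariant (generate (S\<lparr>carrier := K\<rparr>) {x})"
      if "p = 2" "d = 1" "a \<in> carrier (S\<lparr>carrier := K\<rparr>)" "b \<in> carrier (S\<lparr>carrier := K\<rparr>)"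
        "a \<otimes>\<^bsub>S\<lparr>carrier := K\<rparr>\<^esub> b \<noteq> b \<otimes>\<^bsub>S\<lparr>carrier := K\<rparr>\<^esub> a"
        "x \<in> carrier (S\<lparr>carrier := K\<rparr>)" "K.ord x = 4" for a b x
    proof -
      have x: "x \<in> K" "x \<in> carrier S" using that(6) subgroup.mem_carrier[OF K] by auto
      have gen: "generate (S\<lparr>carrier := K\<rparr>) {x} = generate S {x}"
        using generate_consistent[OF _ K, of "{x}"] x by simp
      \<comment> \<open>Two noncommuting elements of \<open>K\<close> make \<open>S\<close> itself
        non-abelian, so that the hypothesis on cyclic subgroups of order 4 is available.\<close>
      have "\<not> comm_group S"
        using comm_groupD[of S a b] that(3-5) subgroup.mem_carrier[OF K] by auto
      moreover have "cyclic_group (S\<lparr>carrier := generate S {x}\<rparr>)"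
        using cyclic_group_generated[of x] x(2) by (simp add: subgroup_generated_def)
      moreover have "card (generate S {x}) = 4"
        using K.generate_pow_card[of x] that(7) x(1) gen by simp
      moreover have "subgroup (generate S {x}) S" using x by (simp add: generate_is_subgroup)
      ultimately have "semi_invariant S F (generate S {x})" using four that(1,2) by blast
      moreover have "generate S {x} \<subseteq> K" using x K by (simp add: generate_subgroup_incl)
      ultimately show ?thesis unfolding gen using semi_invariant_invariant[OF K] by blast
    qed
  qed
qed

text \<open>The section kernel contains all p-elements of Aut_F(K), hence the Sylow subgroup
  Aut_S(K). It is itself a p-group, since its elements of order prime to \<open>p\<close> are
  trivial; comparing orders gives equality.\<close>

lemma aut_by_conj_eq_section_kernel:
  assumes K: "subgroup K S" and size: "p ^ Suc d \<le> card K" and full: "fully_automized S p F K"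
  shows "automorphism_family.section_kernel (S\<lparr>carrier := K\<rparr>) p (F K K) = aut_by_conj S K"
proof -
  interpret K: automorphism_family "S\<lparr>carrier := K\<rparr>" p "F K K" by (rule automorphism_family_F[OF K])
  let ?A = "fusion_aut_group S F K"
  interpret A: group ?A by (rule group_fusion_aut_group[OF K])
  let ?B = "K.section_kernel"
  have BF: "\<beta> \<in> F K K" if "\<beta> \<in> ?B" for \<beta> using that unfolding K.section_kernel_def by blast
  have finA: "finite (carrier ?A)" using finite_F[OF K] by (simp add: fusion_aut_group_simps)
  have orderA: "order ?A \<noteq> 0" using finA A.order_gt_0_iff_finite by simp
  have p_elem: "\<beta> \<in> ?B" if \<beta>: "\<beta> \<in> F K K" and one: "\<beta> [^]\<^bsub>?A\<^esub> (p ^ e) = \<one>\<^bsub>?A\<^esub>" for \<beta> e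
    using K.p_element_section_kernel[OF \<beta>, of e] one fusion_aut_group_pow_eq_one_iff[OF K \<beta>] by simp
  have B: "subgroup ?B ?A"
  proof (rule A.finite_subgroupI)
    show BA: "?B \<subseteq> carrier ?A" using BF by (auto simp: fusion_aut_group_simps)
    then show "finite ?B" using finA finite_subset by blast
    show "?B \<noteq> {}" using p_elem[of "\<one>\<^bsub>?A\<^esub>" 0] A.one_closed by (auto simp: fusion_aut_group_simps(1))
    fix \<alpha> \<beta> assume \<alpha>: "\<alpha> \<in> ?B" and \<beta>: "\<beta> \<in> ?B"
    have mult: "\<alpha> \<otimes>\<^bsub>?A\<^esub> \<beta> = compose K \<alpha> \<beta>" using fusion_aut_group_mult[OF K BF[OF \<alpha>] BF[OF \<beta>]] .
    show "\<alpha> \<otimes>\<^bsub>?A\<^esub> \<beta> \<in> ?B"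
      unfolding mult K.section_kernel_def
    proof (intro CollectI conjI allI impI ballI; (elim conjE)?)
      show "compose K \<alpha> \<beta> \<in> F K K" using comp_mem[OF K K K BF[OF \<beta>] BF[OF \<alpha>]] .
      fix U Y y assume U: "K.invariant U" "K.invariant Y" "U \<subseteq> Y" "card Y = p * card U" and y: "y \<in> Y"
      have sU: "subgroup U S" and sY: "subgroup Y S" "Y \<subseteq> K"
        using incl_subgroup[OF K K.invariantD(1)] subgroup.subset[OF K.invariantD(1)] U by auto
      have \<beta>y: "\<beta> y \<in> Y" using K.invariantD(2)[OF U(2) BF[OF \<beta>] y] .
      have 1: "\<beta> y \<otimes> inv y \<in> U" "\<alpha> (\<beta> y) \<otimes> inv (\<beta> y) \<in> U"
        using K.section_kernelD[OF \<beta> U y] K.section_kernelD[OF \<alpha> U \<beta>y] y \<beta>y sY(2) K by auto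
      have carr: "y \<in> carrier S" "\<beta> y \<in> carrier S" "\<alpha> (\<beta> y) \<in> carrier S"
        using y \<beta>y K.invariantD(2)[OF U(2) BF[OF \<alpha>] \<beta>y] subgroup.mem_carrier[OF sY(1)] by auto
      have "\<alpha> (\<beta> y) \<otimes> inv y = (\<alpha> (\<beta> y) \<otimes> inv (\<beta> y)) \<otimes> (\<beta> y \<otimes> inv y)"
        using carr by (simp add: word_simps)
      then have "\<alpha> (\<beta> y) \<otimes> inv y \<in> U" using 1 subgroup.m_closed[OF sU] by simp
      then show "compose K \<alpha> \<beta> y \<otimes>\<^bsub>S\<lparr>carrier := K\<rparr>\<^esub> inv\<^bsub>S\<lparr>carrier := K\<rparr>\<^esub> y \<in> U"
        using y sY(2) K by (auto simp: compose_def)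
    qed
  qed
  interpret B: group "?A\<lparr>carrier := ?B\<rparr>" by (rule A.subgroup_imp_group[OF B])
  have finB: "finite ?B" using subgroup.subset[OF B] finA finite_subset by blast
  \<comment> \<open>Raising \<beta> to the p-part of its order leaves an element \<open>?c\<close>
    of order prime to \<open>p\<close>, which lies in the coprime kernel and is therefore the
    identity.\<close>
  have "\<exists>e. \<beta> [^]\<^bsub>?A\<^esub> (p ^ e) = \<one>\<^bsub>?A\<^esub>" if \<beta>: "\<beta> \<in> ?B" for \<beta>
  proof -
    have \<beta>A: "\<beta> \<in> carrier ?A" using subgroup.mem_carrier[OF B \<beta>] .
    have "A.ord \<beta> \<noteq> 0" using A.ord_ge_1[OF finA \<beta>A] by simp
    then obtain m where m: "A.ord \<beta> = p ^ multiplicity p (A.ord \<beta>) * m" "\<not> p dvd m"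
      using multiplicity_decompose'[of "A.ord \<beta>" p] p_gt_1 by auto
    let ?e = "multiplicity p (A.ord \<beta>)"
    let ?c = "\<beta> [^]\<^bsub>?A\<^esub> (p ^ ?e)"
    have c: "?c \<in> ?B" using A.subgroup_nat_pow_closed[OF B \<beta>] .
    have "?c [^]\<^bsub>?A\<^esub> m = \<one>\<^bsub>?A\<^esub>"
      using A.pow_ord_eq_1[OF \<beta>A] m(1) A.nat_pow_pow[OF \<beta>A] by simp
    then have "\<forall>x\<in>K. (?c ^^ m) x = x" using fusion_aut_group_pow_eq_one_iff[OF K BF[OF c]] by blast
    moreover have "coprime m p" using m(2) prime_p by (metis coprime_commute prime_imp_coprime_nat)
    ultimately have "?c \<in> K.coprime_kernel" unfolding K.coprime_kernel_def using c by auto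
    then have "\<forall>x\<in>K. (?c ^^ 1) x = x" using coprime_kernel_F_trivial[OF K size] by simp
    then have "?c [^]\<^bsub>?A\<^esub> (1::nat) = \<one>\<^bsub>?A\<^esub>" using fusion_aut_group_pow_eq_one_iff[OF K BF[OF c]] by blast
    then show ?thesis using subgroup.mem_carrier[OF B c] A.nat_pow_eone by auto
  qed
  then have "\<exists>n. order (?A\<lparr>carrier := ?B\<rparr>) = p ^ n"
    using finB prime_p by (intro B.prime_power_order_if_p_elements) (auto simp: A.nat_pow_consistent[symmetric])
  then obtain n where n: "card ?B = p ^ n" by (auto simp: order_def)
  have "card ?B dvd order ?A" using A.lagrange[OF B] by (metis dvd_triv_right)
  then have "n \<le> multiplicity p (order ?A)"
    unfolding n using orderA p_gt_1 by (intro multiplicity_geI) auto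
  then have Ble: "card ?B \<le> p ^ multiplicity p (order ?A)" unfolding n using p_gt_1 by (simp add: power_increasing)
  let ?P = "aut_by_conj S K"
  have P: "subgroup ?P ?A" "card ?P = p ^ multiplicity p (order ?A)"
    using full unfolding fully_automized_def sylow_subgroup_def by auto
  interpret P: group "?A\<lparr>carrier := ?P\<rparr>" by (rule A.subgroup_imp_group[OF P(1)])
  have "?P \<subseteq> ?B"
  proof
    fix \<beta> assume \<beta>: "\<beta> \<in> ?P"
    then have "\<beta> [^]\<^bsub>?A\<^esub> (p ^ multiplicity p (order ?A)) = \<one>\<^bsub>?A\<^esub>"
      using P.pow_order_eq_1[of \<beta>] P(2) by (simp add: order_def A.nat_pow_consistent[symmetric])
    moreover have "\<beta> \<in> F K K" using subgroup.mem_carrier[OF P(1) \<beta>] by (simp add: fusion_aut_group_simps)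
    ultimately show "\<beta> \<in> ?B" using p_elem by blast
  qed
  then have "?P = ?B" using finB Ble P(2) by (intro card_seteq) auto
  then show ?thesis by simp
qed

text \<open>The Sylow subgroup Aut_S(K) is the section kernel and contains every p-element, so
  p-elements lie in it and not merely in one of its conjugates.\<close>

lemma p_automorphism_by_conj:
  assumes K: "subgroup K S" and size: "p ^ Suc d \<le> card K" and full: "fully_automized S p F K"
    and \<beta>: "\<beta> \<in> F K K" "\<And>x. x \<in> K \<Longrightarrow> (\<beta> ^^ (p ^ e)) x = x"
  shows "\<beta> \<in> aut_by_conj S K"
proof -
  interpret K: automorphism_family "S\<lparr>carrier := K\<rparr>" p "F K K" by (rule automorphism_family_F[OF K])
  show ?thesis
    using K.p_element_section_kernel[OF \<beta>(1), of e] \<beta>(2) aut_by_conj_eq_section_kernel[OF K size full] by simp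
qed

text \<open>Transporting conjugation along \<psi> is multiplicative in the conjugating element, and
  for \<open>g\<close> in \<open>P\<close> it gives conjugation by the image of
  \<open>g\<close>.\<close>

lemma extension_domain_subgroup:
  assumes P: "subgroup P S" and Q: "subgroup Q S" and \<psi>: "\<psi> \<in> fusion_iso F P Q"
  shows "subgroup (extension_domain S P Q \<psi>) S" "P \<subseteq> extension_domain S P Q \<psi>"
proof -
  have F\<psi>: "\<psi> \<in> F P Q" using fusion_iso_inverse[OF \<psi>] by blast
  note img = fusion_iso_image(1)[OF P Q \<psi>]
  let ?i = "inv_into P \<psi>"
  have i: "y \<in> Q \<Longrightarrow> ?i y \<in> P" "y \<in> Q \<Longrightarrow> \<psi> (?i y) = y" for y
    using img by (metis inv_into_into, metis f_inv_into_f)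
  have i': "x \<in> P \<Longrightarrow> ?i (\<psi> x) = x" for x using F_inj[OF P Q F\<psi>] by simp
  have PG: "x \<in> P \<Longrightarrow> x \<in> carrier S" and QG: "x \<in> Q \<Longrightarrow> x \<in> carrier S" for x
    using subgroup.mem_carrier P Q by metis+
  let ?t = "\<lambda>g. \<lambda>y\<in>Q. \<psi> (conj_map S P g (?i y))"
  have NP: "normalizer S P = {g \<in> carrier S. \<forall>x\<in>P. g \<otimes> x \<otimes> inv g \<in> P}" by (rule normalizer_eq[OF P])
  have NQ: "normalizer S Q = {g \<in> carrier S. \<forall>x\<in>Q. g \<otimes> x \<otimes> inv g \<in> Q}" by (rule normalizer_eq[OF Q])
  have sNP: "subgroup (normalizer S P) S" and sNQ: "subgroup (normalizer S Q) S"
    using normalizer_imp_subgroup subgroup.subset P Q by blast+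
  show PE: "P \<subseteq> extension_domain S P Q \<psi>"
  proof
    fix g assume g: "g \<in> P"
    have "?t g = conj_map S Q (\<psi> g)"
    proof
      fix y
      show "?t g y = conj_map S Q (\<psi> g) y"
      proof (cases "y \<in> Q")
        case True
        have "\<psi> (g \<otimes> ?i y \<otimes> inv g) = \<psi> g \<otimes> y \<otimes> inv (\<psi> g)"
          using F_mult[OF P Q F\<psi>] F_m_inv[OF P Q F\<psi>] g i True subgroup.m_closed[OF P] subgroup.m_inv_closed[OF P] by simp
        then show ?thesis using True i g by (simp add: conj_map_def)
      qed (simp add: conj_map_def)
    qed
    moreover have "\<psi> g \<in> normalizer S Q" using F_closed[OF P Q F\<psi> g] subset_normalizer[OF Q] by blast
    ultimately show "g \<in> extension_domain S P Q \<psi>"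
      unfolding extension_domain_def aut_by_conj_def using subset_normalizer[OF P] g by blast
  qed
  show "subgroup (extension_domain S P Q \<psi>) S"
  proof (rule finite_subgroupI)
    show sub: "extension_domain S P Q \<psi> \<subseteq> carrier S"
      using NP unfolding extension_domain_def by blast
    then show "finite (extension_domain S P Q \<psi>)" using finite_carrier finite_subset by blast
    show "extension_domain S P Q \<psi> \<noteq> {}" using PE subgroup.one_closed[OF P] by blast
    fix g h assume "g \<in> extension_domain S P Q \<psi>" "h \<in> extension_domain S P Q \<psi>"
    then have g: "g \<in> normalizer S P" "?t g \<in> aut_by_conj S Q" and h: "h \<in> normalizer S P" "?t h \<in> aut_by_conj S Q"
      unfolding extension_domain_def by auto
    obtain a b where a: "a \<in> normalizer S Q" "?t g = conj_map S Q a" and b: "b \<in> normalizer S Q" "?t h = conj_map S Q b"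
      using g(2) h(2) unfolding aut_by_conj_def by blast
    have gh: "g \<otimes> h \<in> normalizer S P" using subgroup.m_closed[OF sNP g(1) h(1)] .
    have ab: "a \<otimes> b \<in> normalizer S Q" using subgroup.m_closed[OF sNQ a(1) b(1)] .
    have "?t (g \<otimes> h) = conj_map S Q (a \<otimes> b)"
    proof
      fix y
      show "?t (g \<otimes> h) y = conj_map S Q (a \<otimes> b) y"
      proof (cases "y \<in> Q")
        case True
        let ?w = "h \<otimes> ?i y \<otimes> inv h"
        have w: "?w \<in> P" using h(1) NP i(1)[OF True] by auto
        have "\<psi> ?w = b \<otimes> y \<otimes> inv b"
          using fun_cong[OF b(2), of y] True i(1)[OF True] by (simp add: conj_map_def)
        moreover have "\<psi> (g \<otimes> ?w \<otimes> inv g) = a \<otimes> \<psi> ?w \<otimes> inv a"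
          using fun_cong[OF a(2), of "\<psi> ?w"] w i' F_closed[OF P Q F\<psi> w] by (simp add: conj_map_def)
        moreover have "g \<otimes> ?w \<otimes> inv g = (g \<otimes> h) \<otimes> ?i y \<otimes> inv (g \<otimes> h)"
          using g(1) h(1) NP PG[OF i(1)[OF True]] by (simp add: word_simps)
        ultimately have "\<psi> ((g \<otimes> h) \<otimes> ?i y \<otimes> inv (g \<otimes> h)) = (a \<otimes> b) \<otimes> y \<otimes> inv (a \<otimes> b)"
          using a(1) b(1) NQ QG[OF True] by (simp add: word_simps)
        then show ?thesis using True i(1)[OF True] by (simp add: conj_map_def)
      qed (simp add: conj_map_def)
    qed
    then show "g \<otimes> h \<in> extension_domain S P Q \<psi>"
      unfolding extension_domain_def aut_by_conj_def using gh ab by blast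
  qed
qed

text \<open>If \<open>P\<close> is small, it lies in an abelian \<open>L\<close> of order
  \<open>p ^ Suc d\<close>, whose elements induce the identity on \<open>P\<close>. If it is large,
  an element \<open>z\<close> outside \<open>P\<close> normalizing \<open>P\<close> transports to a
  p-element of Aut_F(Q), which is a conjugation by \<open>p_automorphism_by_conj\<close>.\<close>

lemma extension_domain_psubset:
  assumes P: "subgroup P S" and Q: "subgroup Q S" and \<psi>: "\<psi> \<in> fusion_iso F P Q"
    and ne: "P \<noteq> carrier S" and full: "fully_automized S p F Q"
  shows "P \<subset> extension_domain S P Q \<psi>"
proof (cases "p ^ Suc d \<le> card P")
  case False
  obtain L where L: "subgroup L S" "P \<subseteq> L" "card L = p ^ Suc d"
    using exists_subgroup_between[OF P subgroup_self subgroup.subset[OF P] _ d_less[unfolded order_def]] False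
    by (metis nat_le_linear)
  have "L \<subseteq> extension_domain S P Q \<psi>"
  proof
    fix g assume g: "g \<in> L"
    have gG: "g \<in> carrier S" using subgroup.mem_carrier[OF L(1) g] .
    have c: "g \<otimes> x \<otimes> inv g = x" if x: "x \<in> P" for x
    proof -
      have "g \<otimes> x = x \<otimes> g" using abelianD[OF L(1,3) g] x L(2) by blast
      then show ?thesis using gG subgroup.mem_carrier[OF P x] by (simp add: m_assoc)
    qed
    have img: "y \<in> Q \<Longrightarrow> inv_into P \<psi> y \<in> P" "y \<in> Q \<Longrightarrow> \<psi> (inv_into P \<psi> y) = y" for y
      using fusion_iso_image(1)[OF P Q \<psi>] by (metis inv_into_into, metis f_inv_into_f)
    have "(\<lambda>y\<in>Q. \<psi> (conj_map S P g (inv_into P \<psi> y))) = conj_map S Q \<one>"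
      using c img subgroup.mem_carrier[OF Q] by (auto simp: conj_map_def restrict_def)
    moreover have "\<one> \<in> normalizer S Q" using subset_normalizer[OF Q] subgroup.one_closed[OF Q] by blast
    moreover have "g \<in> normalizer S P" unfolding normalizer_eq[OF P] using gG c by simp
    ultimately show "g \<in> extension_domain S P Q \<psi>"
      unfolding extension_domain_def aut_by_conj_def by blast
  qed
  moreover have "P \<noteq> L" using L(3) False by auto
  ultimately show ?thesis using L(2) by blast
next
  case True
  obtain z where z: "z \<in> carrier S" "z \<notin> P" "\<And>u. u \<in> P \<Longrightarrow> z \<otimes> u \<otimes> inv z \<in> P"
    using exists_normalizing_outside[OF P ne] by blast
  have zN: "z \<in> normalizer S P" unfolding normalizer_eq[OF P] using z by simp
  obtain \<psi>' where \<psi>': "\<psi> \<in> F P Q" "\<psi>' \<in> F Q P" "\<forall>x\<in>P. \<psi>' (\<psi> x) = x" "\<forall>y\<in>Q. \<psi> (\<psi>' y) = y"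
    using fusion_iso_inverse[OF \<psi>] by blast
  have inv: "inv_into P \<psi> y = \<psi>' y" if "y \<in> Q" for y
    using that \<psi>'(3,4) F_closed[OF Q P \<psi>'(2)] F_inj[OF P Q \<psi>'(1)] by (metis inv_into_f_f)
  \<comment> \<open>The transport of conjugation by \<open>z\<close> along \<psi>; its iterates
    transport conjugation by the powers of \<open>z\<close>, so its order is a power of
    \<open>p\<close>.\<close>
  define \<beta> where "\<beta> = (\<lambda>y\<in>Q. \<psi> (conj_map S P z (inv_into P \<psi> y)))"
  have "\<beta> = compose Q \<psi> (compose Q (conj_map S P z) \<psi>')"
    unfolding \<beta>_def using inv by (auto simp: compose_def restrict_def)
  then have \<beta>F: "\<beta> \<in> F Q Q"
    using comp_mem[OF Q P Q comp_mem[OF Q P P \<psi>'(2) conj_map_F[OF P zN]] \<psi>'(1)] by simp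
  have zn: "z [^] n \<otimes> u \<otimes> inv (z [^] n) \<in> P" if "u \<in> P" for u and n :: nat
    by (rule conj_pow_mem[OF P z(1,3) that])
  have pow: "(\<beta> ^^ n) y = \<psi> (z [^] n \<otimes> \<psi>' y \<otimes> inv (z [^] n))" if y: "y \<in> Q" for n y
  proof (induction n)
    case 0
    then show ?case using y \<psi>'(4) subgroup.mem_carrier[OF P F_closed[OF Q P \<psi>'(2) y]] by simp
  next
    case (Suc n)
    let ?u = "z [^] n \<otimes> \<psi>' y \<otimes> inv (z [^] n)"
    have \<psi>'y: "\<psi>' y \<in> P" "\<psi>' y \<in> carrier S"
      using F_closed[OF Q P \<psi>'(2) y] subgroup.mem_carrier[OF P] by auto
    have u: "?u \<in> P" by (rule zn[OF \<psi>'y(1)])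
    have "\<beta> (\<psi> ?u) = \<psi> (z \<otimes> ?u \<otimes> inv z)"
      unfolding \<beta>_def
      using u F_closed[OF P Q \<psi>'(1) u] inv[OF F_closed[OF P Q \<psi>'(1) u]] \<psi>'(3) by (simp add: conj_map_def)
    then have "(\<beta> ^^ Suc n) y = \<psi> (z \<otimes> ?u \<otimes> inv z)" using Suc by simp
    also have "z \<otimes> ?u \<otimes> inv z = z [^] Suc n \<otimes> \<psi>' y \<otimes> inv (z [^] Suc n)"
      unfolding nat_pow_Suc2[OF z(1)] using z(1) \<psi>'y(2) by (simp add: word_simps del: nat_pow_Suc)
    finally show ?case .
  qed
  obtain e where e: "\<And>x. x \<in> carrier S \<Longrightarrow> x [^] (p ^ e) = \<one>" by (rule pow_prime_power_eq_one) blast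
  have "(\<beta> ^^ (p ^ e)) y = y" if y: "y \<in> Q" for y
    using pow[OF y, of "p ^ e"] e[OF z(1)] y \<psi>'(4) subgroup.mem_carrier[OF P F_closed[OF Q P \<psi>'(2) y]] by simp
  moreover have "p ^ Suc d \<le> card Q" using True fusion_iso_image(2)[OF P Q \<psi>] by simp
  ultimately have "\<beta> \<in> aut_by_conj S Q"
    using p_automorphism_by_conj[OF Q _ full \<beta>F, of e] by blast
  then have "z \<in> extension_domain S P Q \<psi>" unfolding extension_domain_def \<beta>_def using zN by blast
  then show ?thesis using extension_domain_subgroup(2)[OF P Q \<psi>] z(2) by blast
qed

text \<open>Downward induction on the order of \<open>P\<close>. Both \<open>P\<close> and its image
  map isomorphically onto a fully automized receptive \<open>Q\<close>. Receptivity extends these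
  isomorphisms to larger domains, and induction to all of \<open>S\<close>; the given morphism is
  recovered as a quotient of the two automorphisms.\<close>

lemma morphism_extends:
  assumes "subgroup P S" "\<phi> \<in> F P (carrier S)"
  shows "\<exists>\<alpha>\<in>F (carrier S) (carrier S). \<forall>x\<in>P. \<phi> x = \<alpha> x"
  using assms
proof (induction "order S - card P" arbitrary: P \<phi> rule: less_induct)
  case less
  note P = less.prems(1)
  note self = subgroup_self
  show ?case
  proof (cases "P = carrier S")
    case True then show ?thesis using less.prems by blast
  next
    case False
    obtain Q \<chi> where Q: "subgroup Q S" "fully_automized S p F Q" "receptive S F Q" and \<chi>: "\<chi> \<in> fusion_iso F P Q"
      using saturated[OF P] by blast
    \<comment> \<open>Stated for any \<open>P'\<close> of the same order as \<open>P\<close>, since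
      it is used for \<open>P\<close> and for its image under \<phi>.\<close>
    have ext: "\<exists>\<alpha>\<in>F (carrier S) (carrier S). \<forall>x\<in>P'. \<psi> x = \<alpha> x"
      if P': "subgroup P' S" "P' \<noteq> carrier S" "card P' = card P" and \<psi>: "\<psi> \<in> fusion_iso F P' Q" for P' \<psi>
    proof -
      let ?N = "extension_domain S P' Q \<psi>"
      note N = extension_domain_subgroup(1)[OF P'(1) Q(1) \<psi>]
      have "P' \<subset> ?N" by (rule extension_domain_psubset[OF P'(1) Q(1) \<psi> P'(2) Q(2)])
      from psubset_card_mono[OF finite_subgroup[OF N] this] have "card P < card ?N" using P'(3) by simp
      moreover have "card ?N \<le> order S"
        unfolding order_def using finite_carrier subgroup.subset[OF N] by (rule card_mono)
      ultimately have smaller: "order S - card ?N < order S - card P" by simp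
      obtain \<psi>' where \<psi>': "\<psi>' \<in> F ?N (carrier S)" "\<forall>x\<in>P'. \<psi>' x = \<psi> x"
        using Q(3) P'(1) \<psi> unfolding receptive_def by blast
      obtain \<alpha> where "\<alpha> \<in> F (carrier S) (carrier S)" "\<forall>x\<in>?N. \<psi>' x = \<alpha> x"
        using less.hyps[OF smaller N \<psi>'(1)] by blast
      then show ?thesis using \<psi>'(2) \<open>P' \<subset> ?N\<close> by (metis psubsetD)
    qed
    obtain \<gamma> where \<gamma>: "\<gamma> \<in> F (carrier S) (carrier S)" "\<forall>x\<in>P. \<chi> x = \<gamma> x"
      using ext[OF P False refl \<chi>] by blast
    let ?P = "\<phi> ` P"
    have P': "subgroup ?P S" by (rule F_image_subgroup[OF P self less.prems(2)])
    have card: "card ?P = card P" using card_image[OF F_inj[OF P self less.prems(2)]] .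
    have \<phi>: "\<phi> \<in> fusion_iso F P ?P" by (rule iso_onto_image[OF P self less.prems(2)])
    obtain \<phi>' where \<phi>': "\<phi>' \<in> F ?P P" "\<forall>x\<in>P. \<phi>' (\<phi> x) = x" using fusion_iso_inverse[OF \<phi>] by blast
    have "\<chi> \<in> F P Q" using fusion_iso_inverse[OF \<chi>] by blast
    then have "compose ?P \<chi> \<phi>' \<in> F ?P Q" using comp_mem[OF P' P Q(1) \<phi>'(1)] by blast
    then have iso: "compose ?P \<chi> \<phi>' \<in> fusion_iso F ?P Q"
      using fusion_iso_of_card[OF P' Q(1)] card fusion_iso_image(2)[OF P Q(1) \<chi>] by simp
    have "?P \<noteq> carrier S"
      using False card card_subset_eq[OF finite_carrier subgroup.subset[OF P]] by auto
    then obtain \<beta> where \<beta>: "\<beta> \<in> F (carrier S) (carrier S)" "\<forall>y\<in>?P. compose ?P \<chi> \<phi>' y = \<beta> y"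
      using ext[OF P' _ card iso] by blast
    obtain \<beta>' where \<beta>': "\<beta>' \<in> F (carrier S) (carrier S)" "\<forall>x\<in>carrier S. \<beta>' (\<beta> x) = x"
      using fusion_iso_inverse(2)[OF fusion_iso_of_card[OF self self \<beta>(1) refl]] by blast
    have "\<phi> x = compose (carrier S) \<beta>' \<gamma> x" if x: "x \<in> P" for x
    proof -
      have "\<beta> (\<phi> x) = \<gamma> x" using \<beta>(2) \<phi>'(2) \<gamma>(2) x by (auto simp: compose_def)
      then have "\<beta>' (\<gamma> x) = \<phi> x" using \<beta>'(2) F_closed[OF P self less.prems(2) x] by metis
      then show ?thesis using subgroup.mem_carrier[OF P x] by (simp add: compose_def)
    qed
    then show ?thesis using comp_mem[OF self self self \<gamma>(1) \<beta>'(1)] by blast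
  qed
qed

text \<open>Saturation gives a fully automized subgroup isomorphic to \<open>S\<close> in the fusion
  system; having the order of \<open>S\<close>, it equals \<open>S\<close>.\<close>

lemma fully_automized_carrier: "fully_automized S p F (carrier S)"
proof -
  obtain Q where Q: "subgroup Q S" "fusion_iso F (carrier S) Q \<noteq> {}" "fully_automized S p F Q"
    using saturated[OF subgroup_self] by blast
  then have "card (carrier S) = card Q" using fusion_iso_image(2)[OF subgroup_self Q(1)] by blast
  then have "Q = carrier S" using card_subset_eq[OF finite_carrier subgroup.subset[OF Q(1)]] by simp
  then show ?thesis using Q(3) by simp
qed

text \<open>By \<open>fully_automized_carrier\<close> the section kernel for \<open>S\<close>
  consists of inner automorphisms, so an invariant series exists. Its members are strongly closed
  because every morphism into \<open>S\<close> is a restriction of an automorphism in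
  Aut_F(S).\<close>

theorem supersolvable: "supersolvable S p F"
proof -
  have S: "S\<lparr>carrier := carrier S\<rparr> = S" by simp
  interpret A: automorphism_family S p "F (carrier S) (carrier S)"
    using automorphism_family_F[OF subgroup_self] unfolding S .
  have kernel: "A.section_kernel = aut_by_conj S (carrier S)"
    using aut_by_conj_eq_section_kernel[OF subgroup_self _ fully_automized_carrier] d_less
    unfolding S order_def .
  have inner: "\<exists>g\<in>carrier S. \<forall>x\<in>carrier S. \<beta> x = g \<otimes> x \<otimes> inv g" if \<beta>: "\<beta> \<in> A.section_kernel" for \<beta>
  proof -
    obtain g where "g \<in> normalizer S (carrier S)" "\<beta> = conj_map S (carrier S) g"
      using \<beta> unfolding kernel aut_by_conj_def by blast
    then show ?thesis unfolding normalizer_eq[OF subgroup_self] by (auto simp: conj_map_def)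
  qed
  obtain n :: nat and T where T: "T 0 = {\<one>}" "T n = carrier S" "\<forall>i\<le>n. A.invariant (T i)"
    "\<forall>i<n. T i \<subseteq> T (Suc i) \<and> card (T (Suc i)) = p * card (T i)"
    using A.exists_invariant_series[OF inner A.invariant_trivial] by blast
  have "strongly_closed S F (T i)" if i: "i \<le> n" for i
    unfolding strongly_closed_def
  proof (intro conjI allI impI ballI)
    have inv: "A.invariant (T i)" using T(3) i by blast
    then show "subgroup (T i) S" by (rule A.invariantD)
    fix P \<phi> assume P: "subgroup P S \<and> P \<subseteq> T i" and \<phi>: "\<phi> \<in> F P (carrier S)"
    obtain \<alpha> where "\<alpha> \<in> F (carrier S) (carrier S)" "\<forall>x\<in>P. \<phi> x = \<alpha> x"
      using morphism_extends \<phi> P by blast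
    then show "\<phi> ` P \<subseteq> T i" using A.invariantD(2)[OF inv] P by auto
  qed
  moreover have "cyclic_group ((S\<lparr>carrier := T (Suc i)\<rparr>) Mod (T i))" if i: "i < n" for i
  proof -
    have inv: "A.invariant (T i)" "A.invariant (T (Suc i))" using T(3) i by auto
    note sub = A.invariantD(1)[OF inv(1)] A.invariantD(1)[OF inv(2)]
    let ?Y = "S\<lparr>carrier := T (Suc i)\<rparr>"
    interpret Y: group ?Y using sub(2) by (rule subgroup_imp_group)
    have le: "T i \<subseteq> T (Suc i)" "card (T (Suc i)) = p * card (T i)" using T(4) i by auto
    have normal: "T i \<lhd> ?Y"
      unfolding Y.normal_inv_iff
      using subgroup_incl[OF sub le(1)] A.invariant_conj(1)[OF inv(1)] subgroup.mem_carrier[OF sub(2)] sub(2) by auto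
    interpret Q: group "?Y Mod T i" using normal by (rule normal.factorgroup_is_group)
    have "card (T i) > 0" using subgroup.finite_imp_card_positive[OF sub(1) finite_carrier] .
    moreover have "order (?Y Mod T i) * card (T i) = card (T (Suc i))"
      using Y.lagrange[OF normal_imp_subgroup[OF normal]] by (simp add: order_def FactGroup_def)
    ultimately have "order (?Y Mod T i) = p" using le(2) by simp
    then show ?thesis using Q.prime_order_cyclic prime_p by simp
  qed
  ultimately show ?thesis
    unfolding supersolvable_def using saturated_fusion_system_axioms T(1,2,4) by blast
qed

end

theorem theorem4p1:
  fixes S :: "('a, 'b) monoid_scheme" and p :: nat and F :: "'a fusion_homs" and D :: "'a set"
  assumes "Factorial_Ring.prime p"
    and "saturated_fusion_system S p F"
    and "subgroup D S" and "D \<noteq> {\<one>\<^bsub>S\<^esub>}" and "D \<noteq> carrier S"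
    and "\<And>H. \<lbrakk>subgroup H S; card H = card D\<rbrakk> \<Longrightarrow>
           comm_group (S\<lparr>carrier := H\<rparr>) \<and> semi_invariant S F H"
    and "\<And>H. \<lbrakk>subgroup H S; card H = p * card D\<rbrakk> \<Longrightarrow> comm_group (S\<lparr>carrier := H\<rparr>)"
    and "\<And>H. \<lbrakk>\<not> comm_group S; p = 2; card D = 2;
               subgroup H S; cyclic_group (S\<lparr>carrier := H\<rparr>); card H = 4\<rbrakk> \<Longrightarrow>
           semi_invariant S F H"
  shows "supersolvable S p F"
proof -
  interpret saturated_fusion_system S p F by fact
  obtain d where d: "card D = p ^ d" using card_subgroup_prime_power[OF assms(3)] .
  obtain n where n: "order S = p ^ n" using p_group by blast
  have "d \<noteq> 0"
  proof
    assume "d = 0"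
    then have "D = {\<one>\<^bsub>S\<^esub>}"
      using d subgroup.one_closed[OF assms(3)] by (metis card_1_singletonE power_0 singletonD)
    then show False using assms(4) by simp
  qed
  moreover have "card D < order S"
    unfolding order_def
    using assms(5) subgroup.subset[OF assms(3)] finite_carrier by (intro psubset_card_mono) auto
  \<comment> \<open>Both orders are powers of \<open>p\<close>, so properness of \<open>D\<close>
    leaves room for a subgroup of order \<open>p\<close> times that of \<open>D\<close>.\<close>
  then have "d < n" unfolding d n using p_gt_1 power_less_imp_less_exp by blast
  then have "p ^ Suc d \<le> order S" unfolding n using p_gt_1 by (intro power_increasing) auto
  ultimately interpret small_semi_invariant S p F d
  proof (intro small_semi_invariant.intro small_semi_invariant_axioms.intro)
    show "1 \<le> d" using \<open>d \<noteq> 0\<close> by simp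
    show "semi_invariant S F H" if "subgroup H S" "card H = p ^ d" for H
      using assms(6) that d by simp
    show "comm_group (S\<lparr>carrier := H\<rparr>)" if "subgroup H S" "card H = p ^ Suc d" for H
      using assms(7) that d by simp
    show "semi_invariant S F H"
      if "\<not> comm_group S" "p = 2" "d = 1" "subgroup H S" "cyclic_group (S\<lparr>carrier := H\<rparr>)" "card H = 4" for H
      using assms(8) that d by simp
  qed (use assms(2) in auto)
  show ?thesis by (rule supersolvable)
qed

end
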